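(* In the graph sampling model for Max-Weight-IS with similarity parameter $c$ on a graph with inductive independence number $\rho$, the following online algorithm is $O(\alpha\log n)$-competitive, where $\alpha=O(\rho^2)$ is the competitive ratio of the unweighted algorithm $\mathcal{A}_1$ described below and $n=\mathbb{E}[|V^I|]$. Algorithm: for each $v\in V$ flip a fair coin; on heads set $w^I(v):=0$ (i.e. ignore $v$ if it arrives), on tails set $w^S(v):=0$ (i.e. remove $v$ from the sample); with the modified weights and $V^S,V^I$ the nodes of positive modified weight, let $v^{\max}=\arg\max_{v\in V^S}w^S(v)$ and $B=w^S(v^{\max})$; choose $X$ uniformly at random from $\{-1,0,1,\dots,\lceil\log((c+2)|V^S|)\rceil\}$ and set $p=2^{-X}B$; run $\mathcal{A}_1$ with sample node set $V^S_p=\{v\in V^S\setminus\{v^{\max}\}: w^S(v)\ge p\}$ and online node set $V^I_p=\{v\in V^I: w^I(v)\ge p\}$ (other arriving nodes are rejected).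
   Context: Max-Weight-IS: find an independent set of maximum total weight. Inductive independence number $\rho$: smallest $\rho$ for which there is a total order $\prec$ on $V$ (known to the algorithm) with $|\{u\in S:u\succ v,\{u,v\}\in E\}|\le\rho$ for every independent set $S$ and every $v\in V$. Graph sampling model (parameter $c\ge1$): $G=(V,E)$ is a graph; for each $v\in V$ a pair of nonnegative integer weights $(w^I(v),w^S(v))$ is drawn at random, pairs for different nodes mutually independent (the two weights of a node may be correlated), and $\Pr[w^I(v)=b]\le c\Pr[w^S(v)=b]$, $\Pr[w^S(v)=b]\le c\Pr[w^I(v)=b]$ for all $v$ and integers $b>0$. $V^I=\{v:w^I(v)>0\}$, $V^S=\{v:w^S(v)>0\}$. The algorithm initially gets $G[V^S]$ with $w^S$; nodes of $V^I$ arrive in adversarial order; on arrival of $v$ it learns $w^I(v)$, edges to $V^S$ and to earlier arrivals, and whether $v\in V^S$, and irrevocably accepts or rejects $v$. Competitive ratio: $\mathbb{E}[\mathrm{OPT}(w^I)]/\mathbb{E}[\mathrm{ALG}]$, $\mathrm{OPT}(w^I)$ the maximum $w^I$-weight of an independent set and $\mathrm{ALG}$ the $w^I$-weight of the accepted set. Logarithms are base 2; constants in $O(\cdot)$ may depend on $c$. Unweighted algorithm $\mathcal{A}_1$ (given sample set $S$ and online set $I$): $M_1$: go through $S$ in order $\prec$, adding $v$ if $M_1\cup\{v\}$ is independent. For each arriving $v\in I$: add $v$ to $M_2$ if no $u\in M_1$ with $u\prec v$ is adjacent to $v$; if $v\in M_2$, add it to $M_3$ independently with probability $\frac{1}{2\rho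 c}$; if $v\in M_3$ and $v$ has no neighbor in $M_4$, add $v$ to $M_4$ (accept). Output $M_4$. *)

theory Defs
  imports "HOL-Probability.Probability" "HOL-Probability.Product_PMF"
begin

section \<open>Graphs and the inductive independence number\<close>

text \<open>Nodes are natural numbers. Every finite graph is isomorphic to one of this form, and a
  fixed node type makes the constants hidden in $O(\cdot)$ uniform over all finite graphs.\<close>

type_synonym node = nat

definition simple_graph :: "node set \<Rightarrow> node set set \<Rightarrow> bool" where
  "simple_graph V E \<longleftrightarrow> finite V \<and> E \<subseteq> {{u, v} | u v. u \<in> V \<and> v \<in> V \<and> u \<noteq> v}"

definition independent_set :: "node set set \<Rightarrow> node set \<Rightarrow> bool" where
  "independent_set E S \<longleftrightarrow> (\<forall>u\<in>S. \<forall>v\<in>S. {u, v} \<notin> E)"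

text \<open>A total order on a finite set is represented by its increasing enumeration.\<close>

definition enumerates :: "'a list \<Rightarrow> 'a set \<Rightarrow> bool" where
  "enumerates xs A \<longleftrightarrow> distinct xs \<and> set xs = A"

definition precedes :: "'a list \<Rightarrow> 'a \<Rightarrow> 'a \<Rightarrow> bool" where
  "precedes xs u v \<longleftrightarrow> (\<exists>i j. i < j \<and> j < length xs \<and> xs ! i = u \<and> xs ! j = v)"

definition inductive_order :: "node set \<Rightarrow> node set set \<Rightarrow> node list \<Rightarrow> nat \<Rightarrow> bool" where
  "inductive_order V E ord k \<longleftrightarrow> enumerates ord V \<and>
     (\<forall>S v. S \<subseteq> V \<and> independent_set E S \<and> v \<in> V \<longrightarrow>
        card {u \<in> S. precedes ord v u \<and> {u, v} \<in> E} \<le> k)"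

definition inductive_independence_number :: "node set \<Rightarrow> node set set \<Rightarrow> nat" where
  "inductive_independence_number V E = (LEAST k. \<exists>ord. inductive_order V E ord k)"

section \<open>The graph sampling model\<close>

text \<open>\<open>w v\<close> is the pair $(w^I(v), w^S(v))$, and \<open>D v\<close> is its joint law.\<close>

type_synonym weights = "node \<Rightarrow> nat \<times> nat"

definition similar :: "real \<Rightarrow> (nat \<times> nat) pmf \<Rightarrow> bool" where
  "similar c d \<longleftrightarrow> (\<forall>b>0.
     pmf (map_pmf fst d) b \<le> c * pmf (map_pmf snd d) b \<and>
     pmf (map_pmf snd d) b \<le> c * pmf (map_pmf fst d) b)"

definition weights_pmf :: "node set \<Rightarrow> (node \<Rightarrow> (nat \<times> nat) pmf) \<Rightarrow> weights pmf" where
  "weights_pmf V D = Pi_pmf V (0, 0) D"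

text \<open>The list \<open>ord\<close> is the order known to the algorithm; it attains the number \<open>\<rho>\<close>.\<close>

definition sampling_instance ::
  "real \<Rightarrow> nat \<Rightarrow> node set \<Rightarrow> node set set \<Rightarrow> node list \<Rightarrow> (node \<Rightarrow> (nat \<times> nat) pmf) \<Rightarrow> bool" where
  "sampling_instance c \<rho> V E ord D \<longleftrightarrow>
     simple_graph V E \<and> inductive_independence_number V E = \<rho> \<and> inductive_order V E ord \<rho> \<and>
     (\<forall>v\<in>V. similar c (D v))"

definition positive_nodes :: "node set \<Rightarrow> (node \<Rightarrow> nat) \<Rightarrow> node set" where
  "positive_nodes V f = {v \<in> V. f v > 0}"

definition wI :: "weights \<Rightarrow> node \<Rightarrow> nat" where "wI w v = fst (w v)"
definition wS :: "weights \<Rightarrow> node \<Rightarrow> nat" where "wS w v = snd (w v)"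

definition opt :: "node set \<Rightarrow> node set set \<Rightarrow> weights \<Rightarrow> nat" where
  "opt V E w = Max {\<Sum>v\<in>S. wI w v | S. S \<subseteq> V \<and> independent_set E S}"

definition expected_arrivals :: "node set \<Rightarrow> (node \<Rightarrow> (nat \<times> nat) pmf) \<Rightarrow> real" where
  "expected_arrivals V D =
     measure_pmf.expectation (weights_pmf V D) (\<lambda>w. real (card (positive_nodes V (wI w))))"

text \<open>Expectations are taken in \<open>ennreal\<close>, where $x/0 = \infty$ for $x \neq 0$ and
  $0/0 = \infty/\infty = 0$. Hence, for $0 < a < \infty$, the ratio is at most \<open>a\<close> iff
  $\mathrm{E}[\mathrm{OPT}] \le a \cdot \mathrm{E}[\mathrm{ALG}]$.\<close>

definition competitive_ratio :: "'o pmf \<Rightarrow> ('o \<Rightarrow> nat) \<Rightarrow> ('o \<Rightarrow> nat) \<Rightarrow> ennreal" where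
  "competitive_ratio P OPT ALG =
     (\<integral>\<^sup>+\<omega>. of_nat (OPT \<omega>) \<partial>measure_pmf P) / (\<integral>\<^sup>+\<omega>. of_nat (ALG \<omega>) \<partial>measure_pmf P)"

text \<open>An adversary maps each outcome (the weights together with all random bits of the algorithm)
  to an ordering of $V^I$. This subsumes oblivious and adaptive adversaries.\<close>

definition adversary :: "node set \<Rightarrow> ('o \<Rightarrow> weights) \<Rightarrow> ('o \<Rightarrow> node list) \<Rightarrow> bool" where
  "adversary V W arr \<longleftrightarrow> (\<forall>\<omega>. enumerates (arr \<omega>) (positive_nodes V (wI (W \<omega>))))"

section \<open>The unweighted algorithm\<close>

definition M1 :: "node set set \<Rightarrow> node list \<Rightarrow> node set \<Rightarrow> node set" where
  "M1 E ord S =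
     fold (\<lambda>v M. if independent_set E (insert v M) then insert v M else M)
       (filter (\<lambda>v. v \<in> S) ord) {}"

definition in_M2 :: "node set set \<Rightarrow> node list \<Rightarrow> node set \<Rightarrow> node \<Rightarrow> bool" where
  "in_M2 E ord S v \<longleftrightarrow> \<not> (\<exists>u\<in>M1 E ord S. precedes ord u v \<and> {u, v} \<in> E)"

text \<open>\<open>A1 E ord S t xs\<close> is the output $M_4$ for sample set \<open>S\<close> and online nodes arriving in the
  order \<open>xs\<close>. The coin \<open>t v\<close> decides whether a node \<open>v\<close> of $M_2$ enters $M_3$; it is drawn in
  advance for every node.\<close>

definition A1 ::
  "node set set \<Rightarrow> node list \<Rightarrow> node set \<Rightarrow> (node \<Rightarrow> bool) \<Rightarrow> node list \<Rightarrow> node set" where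
  "A1 E ord S t xs =
     fold (\<lambda>v M. if in_M2 E ord S v \<and> t v \<and> (\<forall>u\<in>M. {u, v} \<notin> E) then insert v M else M) xs {}"

definition thinning_pmf :: "node set \<Rightarrow> nat \<Rightarrow> real \<Rightarrow> (node \<Rightarrow> bool) pmf" where
  "thinning_pmf V \<rho> c = Pi_pmf V False (\<lambda>_. bernoulli_pmf (1 / (2 * real \<rho> * c)))"

type_synonym A1_outcome = "weights \<times> (node \<Rightarrow> bool)"

definition A1_ratio_on ::
  "real \<Rightarrow> nat \<Rightarrow> node set \<Rightarrow> node set set \<Rightarrow> node list \<Rightarrow> (node \<Rightarrow> (nat \<times> nat) pmf) \<Rightarrow>
   (A1_outcome \<Rightarrow> node list) \<Rightarrow> ennreal" where
  "A1_ratio_on c \<rho> V E ord D arr =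
     competitive_ratio (pair_pmf (weights_pmf V D) (thinning_pmf V \<rho> c))
       (\<lambda>(w, t). opt V E w)
       (\<lambda>(w, t). card (A1 E ord (positive_nodes V (wS w)) t (arr (w, t))))"

text \<open>The unweighted problem is the case in which all weights are 0 or 1. The competitive ratio
  $\alpha$ is the worst case over all unweighted instances with parameters \<open>c\<close> and \<open>\<rho>\<close>.\<close>

definition A1_ratio :: "real \<Rightarrow> nat \<Rightarrow> ennreal" where
  "A1_ratio c \<rho> = Sup {A1_ratio_on c \<rho> V E ord D arr | V E ord D arr.
     sampling_instance c \<rho> V E ord D \<and> (\<forall>v\<in>V. set_pmf (D v) \<subseteq> {0, 1} \<times> {0, 1}) \<and>
     adversary V fst arr}"

section \<open>The weighted algorithm\<close>

text \<open>\<open>f v\<close> is the fair coin of \<open>v\<close>, with \<open>True\<close> for heads.\<close>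

definition split_weights :: "(node \<Rightarrow> bool) \<Rightarrow> weights \<Rightarrow> weights" where
  "split_weights f w = (\<lambda>v. if f v then (0, wS w v) else (wI w v, 0))"

definition X_range :: "real \<Rightarrow> node set \<Rightarrow> int set" where
  "X_range c VS = {-1..\<lceil>log 2 ((c + 2) * real (card VS))\<rceil>}"

text \<open>Ties in the choice of $v^{\max}$ are resolved in favour of the first node in a fixed
  enumeration \<open>tb\<close> of \<open>V\<close>.\<close>

definition v_max :: "node list \<Rightarrow> node set \<Rightarrow> (node \<Rightarrow> nat) \<Rightarrow> node" where
  "v_max tb VS s = hd (filter (\<lambda>v. v \<in> VS \<and> (\<forall>u\<in>VS. s u \<le> s v)) tb)"

text \<open>\<open>w\<close> are the original weights and \<open>xs\<close> is the arrival order of the original $V^I$. If the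
  modified sample is empty, then $v^{\max}$ does not exist and every node is rejected.\<close>

definition weighted_alg ::
  "node set \<Rightarrow> node set set \<Rightarrow> node list \<Rightarrow> node list \<Rightarrow> weights \<Rightarrow> (node \<Rightarrow> bool) \<Rightarrow> int \<Rightarrow>
   (node \<Rightarrow> bool) \<Rightarrow> node list \<Rightarrow> node set" where
  "weighted_alg V E ord tb w f X t xs =
     (let w' = split_weights f w;
          VS = positive_nodes V (wS w');
          VI = positive_nodes V (wI w');
          vm = v_max tb VS (wS w');
          B = wS w' vm;
          p = 2 powr (- real_of_int X) * real B
      in if VS = {} then {}
         else A1 E ord {v \<in> VS - {vm}. real (wS w' v) \<ge> p} t
                (filter (\<lambda>v. v \<in> VI \<and> real (wI w' v) \<ge> p) xs))"

type_synonym outcome = "weights \<times> (node \<Rightarrow> bool) \<times> int \<times> (node \<Rightarrow> bool)"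

definition outcome_pmf ::
  "real \<Rightarrow> nat \<Rightarrow> node set \<Rightarrow> (node \<Rightarrow> (nat \<times> nat) pmf) \<Rightarrow> outcome pmf" where
  "outcome_pmf c \<rho> V D =
     bind_pmf (weights_pmf V D) (\<lambda>w.
     bind_pmf (Pi_pmf V False (\<lambda>_. bernoulli_pmf (1 / 2))) (\<lambda>f.
     bind_pmf (pmf_of_set (X_range c (positive_nodes V (wS (split_weights f w))))) (\<lambda>X.
     bind_pmf (thinning_pmf V \<rho> c) (\<lambda>t.
     return_pmf (w, f, X, t)))))"

definition weighted_ratio_on ::
  "real \<Rightarrow> nat \<Rightarrow> node set \<Rightarrow> node set set \<Rightarrow> node list \<Rightarrow> node list \<Rightarrow>
   (node \<Rightarrow> (nat \<times> nat) pmf) \<Rightarrow> (outcome \<Rightarrow> node list) \<Rightarrow> ennreal" where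
  "weighted_ratio_on c \<rho> V E ord tb D arr =
     competitive_ratio (outcome_pmf c \<rho> V D)
       (\<lambda>(w, f, X, t). opt V E w)
       (\<lambda>(w, f, X, t). \<Sum>v\<in>weighted_alg V E ord tb w f X t (arr (w, f, X, t)). wI w v)"

end

theory Submission
  imports Defs
begin

text \<open>
  Unweighted case: a node of an independent set of arrivals either passes the test of \<open>M2\<close> or is
  blocked by an earlier neighbour in \<open>M1\<close>, and each node of \<open>M1\<close> blocks at most \<open>\<rho>\<close> of them. Whether
  \<open>v\<close> passes depends only on the sample before \<open>v\<close>, so turning \<open>v\<close> from sampled into online (or
  back) costs a factor \<open>c\<close>. Hence \<open>M1\<close> is at most \<open>c\<close> times as large as \<open>M2\<close> in expectation, and
  \<open>M2\<close> has average degree \<open>O(\<rho>)\<close>. After thinning, a constant fraction of the survivors is isolated,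
  and isolated survivors are accepted in every arrival order.

  Weighted case: the coins make the two weights of a node exclusive, so they can be exchanged at
  cost \<open>c\<close>. Rank the nodes by weight, whether sampled or online. If the heaviest node is sampled,
  the unweighted argument applies to each dyadic weight class below it. If the heaviest node
  arrives, exchanging it or the second heaviest node leads to the former case or to the case that
  \<open>X = -1\<close> isolates the heaviest node. Exchange arguments show that these cases carry a constant
  fraction of the optimum, and that the number of choices for \<open>X\<close> is \<open>O(log n)\<close> there. Finally,
  \<open>\<rho>\<^sup>2\<close> is expressed through the ratio of the unweighted algorithm by a matching lower bound.
\<close>

section \<open>Greedy independent sets\<close>

text \<open>An exchange must not disturb what the algorithm derives from its sample: the threshold
  \<open>2^-X * B\<close> and the law of \<open>X\<close>. Hence nodes are ranked by a weight that
  ignores their role, and the heaviest sampled node, which fixes the threshold, is kept out of the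
  sample passed to \<open>A1\<close>. The size of the range of \<open>X\<close> still depends on the
  sample size, which moves by one. The probability \<open>g\<close> of a single value is therefore
  carried inside the expectations, changes by a factor of at most 2, and is compared with
  \<open>log n\<close> only at the end, under the law weighted by \<open>Q\<close>. A second
  obstacle is an outcome with a single present node, where nothing can be earned. It is compensated
  by a further sampled node, and this needs \<open>n >= 2\<close>. Weights may have infinite mean,
  so cancellations of expectations in the weighted case rely on truncation or on a case
  distinction.\<close>

lemma precedes_nth_iff:
  assumes "distinct xs" "j < length xs"
  shows "precedes xs u (xs ! j) \<longleftrightarrow> (\<exists>i<j. u = xs ! i)"
  using assms unfolding precedes_def by (metis nth_eq_iff_index_eq order.strict_trans)

lemma precedes_in_set: "precedes xs u v \<Longrightarrow> u \<in> set xs \<and> v \<in> set xs"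
  unfolding precedes_def by (metis nth_mem order.strict_trans)

lemma precedes_irrefl: "distinct xs \<Longrightarrow> \<not> precedes xs v v"
  unfolding precedes_def by (metis less_irrefl nth_eq_iff_index_eq order.strict_trans)

lemma precedes_trans:
  assumes "distinct xs" "precedes xs u v" "precedes xs v x"
  shows "precedes xs u x"
  using assms unfolding precedes_def by (metis nth_eq_iff_index_eq order.strict_trans)

lemma precedes_total:
  "u \<in> set xs \<Longrightarrow> v \<in> set xs \<Longrightarrow> u \<noteq> v \<Longrightarrow> precedes xs u v \<or> precedes xs v u"
  unfolding precedes_def in_set_conv_nth by (metis linorder_neqE_nat)

lemma precedes_snoc:
  assumes "distinct (xs @ [x])"
  shows "precedes (xs @ [x]) u v \<longleftrightarrow> precedes xs u v \<or> (u \<in> set xs \<and> v = x)"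
proof
  assume "precedes (xs @ [x]) u v"
  then obtain i j where "i < j" "j < Suc (length xs)" "(xs @ [x]) ! i = u" "(xs @ [x]) ! j = v"
    unfolding precedes_def by auto
  then show "precedes xs u v \<or> (u \<in> set xs \<and> v = x)"
    unfolding precedes_def
    by (cases "j < length xs") (auto simp: nth_append less_Suc_eq split: if_splits)
next
  assume "precedes xs u v \<or> (u \<in> set xs \<and> v = x)"
  then show "precedes (xs @ [x]) u v"
  proof
    assume "precedes xs u v"
    then obtain i j where "i < j" "j < length xs" "xs ! i = u" "xs ! j = v"
      unfolding precedes_def by blast
    then show ?thesis
      unfolding precedes_def by (intro exI[of _ i] exI[of _ j]) (simp add: nth_append)
  next
    assume "u \<in> set xs \<and> v = x"
    then obtain i where "i < length xs" "xs ! i = u" "v = x" by (auto simp: in_set_conv_nth)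
    then show ?thesis
      unfolding precedes_def by (intro exI[of _ i] exI[of _ "length xs"]) (simp add: nth_append)
  qed
qed

lemma simple_graph_no_loop: "simple_graph V E \<Longrightarrow> {v, v} \<notin> E"
  unfolding simple_graph_def by (auto simp: doubleton_eq_iff)

text \<open>Used with \<open>I = S\<close> as well: there the same test describes the greedy set,
  see \<open>M1_eq\<close>. One description for sampled and arriving nodes makes them
  comparable.\<close>

definition M2 :: "node set set \<Rightarrow> node list \<Rightarrow> node set \<Rightarrow> node set \<Rightarrow> node set" where
  "M2 E ord S I = {v \<in> I. in_M2 E ord S v}"

lemma M1_snoc:
  "M1 E (xs @ [x]) S =
     (if x \<in> S \<and> independent_set E (insert x (M1 E xs S)) then insert x (M1 E xs S)
      else M1 E xs S)"
  by (simp add: M1_def)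

text \<open>When \<open>x\<close> is scanned, the current greedy set consists exactly of the members
  of \<open>M1\<close> before \<open>x\<close>. So the greedy independence test is the test
  \<open>in_M2\<close>: a sampled node is chosen by the criterion that an arriving node has to
  meet.\<close>

lemma M1_greedy:
  assumes "\<And>v. {v, v} \<notin> E" "distinct ord"
  shows "independent_set E (M1 E ord S) \<and> M1 E ord S = M2 E ord S (S \<inter> set ord)"
  using assms(2)
proof (induction ord rule: rev_induct)
  case Nil
  then show ?case by (simp add: M1_def M2_def independent_set_def)
next
  case (snoc x xs)
  let ?M = "M1 E xs S" and ?M' = "M1 E (xs @ [x]) S"
  have IH: "independent_set E ?M" "?M = M2 E xs S (S \<inter> set xs)" and x: "x \<notin> set xs"
    using snoc by auto
  have sub: "?M \<subseteq> set xs" using IH(2) by (auto simp: M2_def)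
  have iff: "independent_set E (insert x ?M) \<longleftrightarrow> (\<forall>u\<in>?M. {u, x} \<notin> E)"
    using IH(1) assms(1) unfolding independent_set_def by (auto simp: insert_commute)
  have ind: "independent_set E ?M'" using IH(1) by (auto simp: M1_snoc)
  have sub': "?M' \<subseteq> insert x ?M" "?M \<subseteq> ?M'" by (auto simp: M1_snoc)
  have old: "in_M2 E (xs @ [x]) S v \<longleftrightarrow> in_M2 E xs S v" if "v \<in> set xs" for v
  proof -
    have "u \<in> ?M' \<and> precedes (xs @ [x]) u v \<longleftrightarrow> u \<in> ?M \<and> precedes xs u v" for u
      using that x sub' precedes_in_set[of xs u v] by (auto simp: precedes_snoc[OF snoc.prems])
    then show ?thesis unfolding in_M2_def by metis
  qed
  have new: "in_M2 E (xs @ [x]) S x \<longleftrightarrow> (\<forall>u\<in>?M. {u, x} \<notin> E)"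
  proof -
    have "u \<in> ?M' \<and> precedes (xs @ [x]) u x \<longleftrightarrow> u \<in> ?M" for u
      using x sub' sub precedes_in_set[of xs u x] by (auto simp: precedes_snoc[OF snoc.prems])
    then show ?thesis unfolding in_M2_def by metis
  qed
  have "v \<in> ?M' \<longleftrightarrow> v \<in> M2 E (xs @ [x]) S (S \<inter> set (xs @ [x]))" for v
  proof (cases "v = x")
    case True
    then show ?thesis using new iff x sub by (auto simp: M1_snoc M2_def)
  next
    case False
    then have "v \<in> ?M' \<longleftrightarrow> v \<in> M2 E xs S (S \<inter> set xs)"
      using IH(2) by (auto simp: M1_snoc)
    then show ?thesis using False old by (auto simp: M2_def)
  qed
  then show ?case using ind by blast
qed

text \<open>Strong induction along the order: the test looks at earlier members of
  \<open>M1\<close>, whose membership is decided by their own test and by \<open>S\<close> at their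
  place. In particular the test of \<open>v\<close> ignores whether \<open>v\<close> itself is
  sampled, so \<open>v\<close> can be exchanged without changing its own test.\<close>

lemma in_M2_cong:
  assumes "\<And>v. {v, v} \<notin> E" "distinct ord" "v \<in> set ord"
    and "\<And>u. precedes ord u v \<Longrightarrow> u \<in> S \<longleftrightarrow> u \<in> S'"
  shows "in_M2 E ord S v \<longleftrightarrow> in_M2 E ord S' v"
proof -
  have "in_M2 E ord S (ord ! j) \<longleftrightarrow> in_M2 E ord S' (ord ! j)"
    if "j < length ord" "\<And>u. precedes ord u (ord ! j) \<Longrightarrow> u \<in> S \<longleftrightarrow> u \<in> S'" for j
    using that
  proof (induction j rule: less_induct)
    case (less j)
    have "u \<in> M1 E ord S \<longleftrightarrow> u \<in> M1 E ord S'" if p: "precedes ord u (ord ! j)" for u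
    proof -
      obtain i where i: "i < j" "u = ord ! i"
        using p precedes_nth_iff[OF assms(2) less.prems(1)] by blast
      have "in_M2 E ord S u \<longleftrightarrow> in_M2 E ord S' u"
        unfolding i(2)
      proof (rule less.IH[OF i(1)])
        show "i < length ord" using i(1) less.prems(1) by simp
        fix x assume "precedes ord x (ord ! i)"
        then show "x \<in> S \<longleftrightarrow> x \<in> S'"
          using less.prems(2) precedes_trans[OF assms(2) _ p] i(2) by metis
      qed
      then show ?thesis
        using M1_greedy[OF assms(1,2)] less.prems(2)[OF p] by (simp add: M2_def)
    qed
    then show ?case unfolding in_M2_def by blast
  qed
  then show ?thesis using assms(3,4) by (metis in_set_conv_nth)
qed

section \<open>Thinning and isolated survivors\<close>

definition nbrs :: "node set set \<Rightarrow> node set \<Rightarrow> node \<Rightarrow> node set" where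
  "nbrs E M v = {u \<in> M. {u, v} \<in> E}"

lemma A1_contains_isolated:
  assumes "\<And>v. {v, v} \<notin> E"
    and "v \<in> M2 E ord S (set xs)" "t v" "\<And>u. u \<in> nbrs E (M2 E ord S (set xs)) v \<Longrightarrow> \<not> t u"
  shows "v \<in> A1 E ord S t xs"
proof -
  let ?st = "\<lambda>v M. if in_M2 E ord S v \<and> t v \<and> (\<forall>u\<in>M. {u, v} \<notin> E) then insert v M else M"
  have "fold ?st ys {} \<subseteq> {u \<in> set ys. in_M2 E ord S u \<and> t u} \<and>
        (v \<in> set ys \<longrightarrow> v \<in> fold ?st ys {})" if "set ys \<subseteq> set xs" for ys
    using that
  proof (induction ys rule: rev_induct)
    case (snoc y ys)
    then have IH: "fold ?st ys {} \<subseteq> {u \<in> set ys. in_M2 E ord S u \<and> t u}"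
      "v \<in> set ys \<longrightarrow> v \<in> fold ?st ys {}" by auto
    have "\<forall>u\<in>fold ?st ys {}. {u, v} \<notin> E"
      using IH(1) snoc.prems assms(4) by (fastforce simp: nbrs_def M2_def)
    then show ?case using IH assms(2,3) by (auto simp: M2_def)
  qed simp
  then show ?thesis unfolding A1_def using assms(2) by (auto simp: M2_def)
qed

lemma A1_subset: "A1 E ord S t xs \<subseteq> {v \<in> M2 E ord S (set xs). t v}"
proof -
  let ?st = "\<lambda>v M. if in_M2 E ord S v \<and> t v \<and> (\<forall>u\<in>M. {u, v} \<notin> E) then insert v M else M"
  have "fold ?st ys {} \<subseteq> {v \<in> M2 E ord S (set ys). t v}" for ys
    by (induction ys rule: rev_induct) (auto simp: M2_def)
  then show ?thesis unfolding A1_def .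
qed

text \<open>\<open>exp (-2 * q) <= 1 - q\<close> on \<open>[0, 1/2]\<close> gives
  \<open>(1 - q) ^ d >= exp (-2 * q * d)\<close>; then \<open>1 + x <= exp x\<close> is used at
  \<open>x = y - 2 * q * d\<close>. The result is linear in \<open>d\<close>, so a bound on the
  average degree can be inserted directly. The line touches the exponential where
  \<open>2 * q * d = y\<close>.\<close>

lemma isolation_tangent:
  fixes q y :: real
  assumes "0 \<le> q" "q \<le> 1/2"
  shows "1 + y \<le> exp y * (1 - q) ^ d + 2 * q * real d"
proof -
  have "q * (2 * q) \<le> q * 1" using assms by (intro mult_left_mono) auto
  then have "- 2 * q \<le> ln (1 - q)"
    using ln_one_minus_pos_lower_bound[OF assms] by (simp add: power2_eq_square)
  then have "exp (- 2 * q) \<le> 1 - q"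
    using assms by (subst (asm) exp_le_cancel_iff[symmetric]) simp
  then have "exp (- 2 * q) ^ d \<le> (1 - q) ^ d" by (rule power_mono) simp
  then have "exp y * exp (- 2 * q * real d) \<le> exp y * (1 - q) ^ d"
    by (simp add: exp_of_nat_mult[symmetric] mult_ac)
  moreover have "1 + (y - 2 * q * real d) \<le> exp (y - 2 * q * real d)"
    by (rule exp_ge_add_one_self)
  ultimately have "1 + (y - 2 * q * real d) \<le> exp y * (1 - q) ^ d"
    unfolding diff_conv_add_uminus[of y] exp_add minus_mult_left by (rule order_trans[rotated])
  then show ?thesis by simp
qed

locale ordered_graph =
  fixes V :: "node set" and E :: "node set set" and ord :: "node list" and \<rho> :: nat
  assumes graph: "simple_graph V E" and order: "inductive_order V E ord \<rho>" and rho: "\<rho> \<ge> 1"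
begin

lemma fin: "finite V"
  using graph by (simp add: simple_graph_def)

lemma no_loop: "{v, v} \<notin> E"
  using graph by (rule simple_graph_no_loop)

lemma ord: "distinct ord" "set ord = V"
  using order by (auto simp: inductive_order_def enumerates_def)

lemma finite_M2: "I \<subseteq> V \<Longrightarrow> finite (M2 E ord S I)"
  using fin by (auto simp: M2_def intro: finite_subset)

lemma M1_eq: "S \<subseteq> V \<Longrightarrow> M1 E ord S = M2 E ord S S"
  using M1_greedy[OF no_loop ord(1), of S] ord(2) by (simp add: Int_absorb2)

lemma M1_independent: "independent_set E (M1 E ord S)"
  using M1_greedy[OF no_loop ord(1)] by blast

lemma successors_le:
  "S \<subseteq> V \<Longrightarrow> independent_set E S \<Longrightarrow> v \<in> V \<Longrightarrow> card {u \<in> S. precedes ord v u \<and> {u, v} \<in> E} \<le> \<rho>"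
  using order by (simp add: inductive_order_def)

lemma card_independent_le:
  assumes "S \<subseteq> V" "I \<subseteq> V" "T \<subseteq> I" "independent_set E T"
  shows "card T \<le> card (M2 E ord S I) + \<rho> * card (M1 E ord S)"
proof -
  let ?blk = "\<lambda>u. {v \<in> T. precedes ord u v \<and> {v, u} \<in> E}"
  have finM1: "finite (M1 E ord S)" using M1_eq[OF assms(1)] finite_M2[OF assms(1)] by simp
  have finT: "finite T" using assms(2,3) fin by (meson finite_subset)
  have "T \<subseteq> M2 E ord S I \<union> (\<Union>u\<in>M1 E ord S. ?blk u)"
    using assms(3) by (auto simp: M2_def in_M2_def insert_commute)
  then have "card T \<le> card (M2 E ord S I \<union> (\<Union>u\<in>M1 E ord S. ?blk u))"
    using finM1 finT finite_M2[OF assms(2)] by (intro card_mono) auto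
  also have "\<dots> \<le> card (M2 E ord S I) + card (\<Union>u\<in>M1 E ord S. ?blk u)"
    by (rule card_Un_le)
  also have "card (\<Union>u\<in>M1 E ord S. ?blk u) \<le> (\<Sum>u\<in>M1 E ord S. card (?blk u))"
    by (rule card_UN_le[OF finM1])
  also have "\<dots> \<le> (\<Sum>u\<in>M1 E ord S. \<rho>)"
    using assms M1_eq[OF assms(1)] successors_le[of T]
    by (intro sum_mono) (auto simp: M2_def)
  finally show ?thesis by (simp add: mult.commute)
qed

end

section \<open>Independent coordinates\<close>

lemma nn_integral_pmf_mult_sum:
  fixes h :: "'o \<Rightarrow> ennreal"
  shows "(\<integral>\<^sup>+\<omega>. h \<omega> * (\<Sum>x\<in>A. f x \<omega>) \<partial>measure_pmf P) = (\<Sum>x\<in>A. \<integral>\<^sup>+\<omega>. h \<omega> * f x \<omega> \<partial>measure_pmf P)"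
  by (simp add: sum_distrib_left nn_integral_sum)

lemma nn_integral_pmf_mult_cmult:
  fixes h :: "'o \<Rightarrow> ennreal"
  shows "(\<integral>\<^sup>+\<omega>. h \<omega> * (a * f \<omega>) \<partial>measure_pmf P) = a * (\<integral>\<^sup>+\<omega>. h \<omega> * f \<omega> \<partial>measure_pmf P)"
  by (subst mult.left_commute) (rule nn_integral_cmult, simp)

lemma nn_integral_Pi_pmf_coord:
  assumes "finite V" "v \<in> V"
  shows "(\<integral>\<^sup>+w. F w \<partial>Pi_pmf V d D) = (\<integral>\<^sup>+f. \<integral>\<^sup>+x. F (f(v := x)) \<partial>D v \<partial>Pi_pmf (V - {v}) d D)"
proof -
  have "Pi_pmf V d D = map_pmf (\<lambda>(y, f). f(v := y)) (pair_pmf (D v) (Pi_pmf (V - {v}) d D))"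
    using Pi_pmf_insert[of "V - {v}" v d D] assms by (simp add: insert_absorb)
  also have "\<dots> = map_pmf (\<lambda>(f, y). f(v := y)) (pair_pmf (Pi_pmf (V - {v}) d D) (D v))"
    by (subst pair_commute_pmf) (simp add: pmf.map_comp o_def case_prod_unfold)
  finally show ?thesis by (simp add: nn_integral_pair_pmf' case_prod_unfold)
qed

lemma nn_integral_Pi_pmf_indep:
  fixes F :: "('a \<Rightarrow> 'b) \<Rightarrow> ennreal"
  assumes "finite V" "v \<in> V" "\<And>w x. F (w(v := x)) = F w"
  shows "(\<integral>\<^sup>+w. g (w v) * F w \<partial>Pi_pmf V d D) = (\<integral>\<^sup>+x. g x \<partial>D v) * (\<integral>\<^sup>+w. F w \<partial>Pi_pmf V d D)"
  by (subst (1 2) nn_integral_Pi_pmf_coord[OF assms(1,2)])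
     (simp add: assms(3) nn_integral_multc nn_integral_cmult)

lemma thinning_isolated:
  assumes "finite V" "v \<in> V" "N \<subseteq> V" "v \<notin> N" "0 \<le> q" "q \<le> 1"
  shows "(\<integral>\<^sup>+t. of_bool (t v \<and> (\<forall>u\<in>N. \<not> t u)) \<partial>Pi_pmf V False (\<lambda>_. bernoulli_pmf q)) =
    ennreal (q * (1 - q) ^ card N)"
proof -
  let ?g = "\<lambda>x b. of_bool (if x = v then b else x \<in> N \<longrightarrow> \<not> b) :: ennreal"
  let ?r = "\<lambda>x. if x = v then ennreal q else ennreal (1 - q)"
  have eq: "(of_bool (t v \<and> (\<forall>u\<in>N. \<not> t u)) :: ennreal) = (\<Prod>x\<in>V. ?g x (t x))" for t
  proof -
    have "t v \<and> (\<forall>u\<in>N. \<not> t u) \<longleftrightarrow> (\<forall>x\<in>V. if x = v then t x else x \<in> N \<longrightarrow> \<not> t x)"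
      using assms(2-4) by (auto split: if_splits)
    moreover have "(\<Prod>x\<in>V. of_bool (Q x)) = (of_bool (\<forall>x\<in>V. Q x) :: ennreal)" for Q
      using assms(1) by (induction V rule: finite_induct) auto
    ultimately show ?thesis by presburger
  qed
  have "(\<integral>\<^sup>+t. of_bool (t v \<and> (\<forall>u\<in>N. \<not> t u)) \<partial>Pi_pmf V False (\<lambda>_. bernoulli_pmf q)) =
    (\<integral>\<^sup>+t. (\<Prod>x\<in>V. ?g x (t x)) \<partial>Pi_pmf V False (\<lambda>_. bernoulli_pmf q))"
    unfolding eq by (rule refl)
  also have "\<dots> = (\<Prod>x\<in>V. \<integral>\<^sup>+b. ?g x b \<partial>bernoulli_pmf q)"
    by (rule nn_integral_prod_Pi_pmf[OF assms(1)])
  also have "\<dots> = (\<Prod>x\<in>V. if x \<in> insert v N then ?r x else 1)"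
    using assms by (intro prod.cong refl) (auto simp: ennreal_plus[symmetric] simp del: ennreal_plus)
  also have "\<dots> = (\<Prod>x\<in>insert v N. ?r x)"
  proof -
    have "V \<inter> insert v N = insert v N" using assms by auto
    then show ?thesis using prod.inter_restrict[OF assms(1), of ?r "insert v N"] by simp
  qed
  also have "\<dots> = ennreal q * (\<Prod>x\<in>N. ennreal (1 - q))"
  proof -
    have "finite N" using assms finite_subset by blast
    moreover have "(\<Prod>x\<in>N. ?r x) = (\<Prod>x\<in>N. ennreal (1 - q))"
      using assms(4) by (intro prod.cong) auto
    ultimately show ?thesis using assms(4) by simp
  qed
  also have "\<dots> = ennreal (q * (1 - q) ^ card N)"
    using assms by (simp add: ennreal_mult ennreal_power)
  finally show ?thesis .
qed

context ordered_graph
begin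

text \<open>The arrival order \<open>xs t\<close> may depend on the coins, as the adversary of the
  model sees them. Only isolated survivors are counted, and these are accepted in any order.\<close>

lemma A1_expectation_ge:
  fixes y :: "node \<Rightarrow> nat"
  assumes "I \<subseteq> V" "\<And>t. set (xs t) = I" "0 \<le> q" "q \<le> 1"
  shows "(\<Sum>v\<in>M2 E ord S I. of_nat (y v) * ennreal (q * (1 - q) ^ card (nbrs E (M2 E ord S I) v)))
    \<le> (\<integral>\<^sup>+t. of_nat (\<Sum>v\<in>A1 E ord S t (xs t). y v) \<partial>Pi_pmf V False (\<lambda>_. bernoulli_pmf q))"
proof -
  let ?M = "M2 E ord S I"
  let ?iso = "\<lambda>t v. t v \<and> (\<forall>u\<in>nbrs E ?M v. \<not> t u)"
  have finM: "finite ?M" using finite_M2[OF assms(1)] .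
  have "(\<Sum>v\<in>?M. of_nat (y v) * ennreal (q * (1 - q) ^ card (nbrs E ?M v))) =
    (\<Sum>v\<in>?M. of_nat (y v) * (\<integral>\<^sup>+t. of_bool (?iso t v) \<partial>Pi_pmf V False (\<lambda>_. bernoulli_pmf q)))"
    using assms no_loop fin
    by (intro sum.cong refl arg_cong2[where f = times] thinning_isolated[symmetric])
      (auto simp: M2_def nbrs_def)
  also have "\<dots> = (\<integral>\<^sup>+t. (\<Sum>v\<in>?M. of_nat (y v) * of_bool (?iso t v)) \<partial>Pi_pmf V False (\<lambda>_. bernoulli_pmf q))"
    by (subst nn_integral_sum) (simp_all add: nn_integral_cmult)
  also have "\<dots> \<le> (\<integral>\<^sup>+t. of_nat (\<Sum>v\<in>A1 E ord S t (xs t). y v) \<partial>Pi_pmf V False (\<lambda>_. bernoulli_pmf q))"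
  proof (intro nn_integral_mono)
    fix t
    have "(\<Sum>v\<in>?M. of_nat (y v) * of_bool (?iso t v) :: ennreal) = (\<Sum>v\<in>{v \<in> ?M. ?iso t v}. of_nat (y v))"
      using finM by (intro sum.mono_neutral_cong_right) auto
    also have "\<dots> \<le> (\<Sum>v\<in>A1 E ord S t (xs t). of_nat (y v))"
    proof (rule sum_mono2)
      show "finite (A1 E ord S t (xs t))"
        using A1_subset[of E ord S t "xs t"] finM assms(2) by (auto intro: finite_subset)
      show "{v \<in> ?M. ?iso t v} \<subseteq> A1 E ord S t (xs t)"
        using A1_contains_isolated[OF no_loop, of _ ord S "xs t" t] assms(2)[of t] by auto
    qed simp
    finally show "(\<Sum>v\<in>?M. of_nat (y v) * of_bool (?iso t v) :: ennreal)
      \<le> of_nat (\<Sum>v\<in>A1 E ord S t (xs t). y v)" by simp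
  qed
  finally show ?thesis .
qed

text \<open>The hypothesis \<open>swap\<close> turns an online node \<open>u\<close> into a sampled one, and the sampled nodes
  that pass the test form the independent set \<open>M1\<close>. So the average degree inside \<open>M2\<close> is
  \<open>O(\<rho>)\<close>, and a constant fraction of \<open>M2\<close> is isolated after thinning.\<close>

lemma isolated_lower_bound:
  fixes P :: "'o pmf" and S I :: "'o \<Rightarrow> node set" and h :: "'o \<Rightarrow> ennreal"
  assumes sub: "\<And>\<omega>. S \<omega> \<subseteq> V" "\<And>\<omega>. I \<omega> \<subseteq> V"
    and K: "0 \<le> K" and q: "0 \<le> q" "q \<le> 1/2" and y: "4 * q * K * real \<rho> \<le> y"
    and finite_h: "(\<integral>\<^sup>+\<omega>. h \<omega> \<partial>P) < \<infinity>"
    and swap: "\<And>u v. u \<in> V \<Longrightarrow> v \<in> V \<Longrightarrow> precedes ord v u \<Longrightarrow>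
      (\<integral>\<^sup>+\<omega>. h \<omega> * of_bool (v \<in> M2 E ord (S \<omega>) (I \<omega>) \<and> u \<in> M2 E ord (S \<omega>) (I \<omega>)) \<partial>P) \<le>
      ennreal K * (\<integral>\<^sup>+\<omega>. h \<omega> * of_bool (v \<in> M2 E ord (S \<omega>) (I \<omega>) \<and> u \<in> M2 E ord (S \<omega>) (S \<omega>)) \<partial>P)"
  shows "(\<integral>\<^sup>+\<omega>. h \<omega> * of_nat (card (M2 E ord (S \<omega>) (I \<omega>))) \<partial>P) \<le>
    ennreal (exp y) * (\<integral>\<^sup>+\<omega>. h \<omega> * (\<Sum>v\<in>M2 E ord (S \<omega>) (I \<omega>).
      ennreal ((1 - q) ^ card (nbrs E (M2 E ord (S \<omega>) (I \<omega>)) v))) \<partial>P)"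
proof -
  define M where "M \<omega> = M2 E ord (S \<omega>) (I \<omega>)" for \<omega>
  define N where "N \<omega> = M2 E ord (S \<omega>) (S \<omega>)" for \<omega>
  define d where "d \<omega> v = card (nbrs E (M \<omega>) v)" for \<omega> v
  define m where "m = (\<integral>\<^sup>+\<omega>. h \<omega> * of_nat (card (M \<omega>)) \<partial>P)"
  define R where "R = (\<integral>\<^sup>+\<omega>. h \<omega> * (\<Sum>v\<in>M \<omega>. ennreal ((1 - q) ^ d \<omega> v)) \<partial>P)"
  have MV: "M \<omega> \<subseteq> V" "N \<omega> \<subseteq> V" for \<omega> using sub by (auto simp: M_def N_def M2_def)
  have finM: "finite (M \<omega>)" "finite (N \<omega>)" for \<omega> using MV[of \<omega>] fin by (auto intro: finite_subset)
  have "0 \<le> 4 * q * K * real \<rho>" using q K by simp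
  then have y0: "0 \<le> y" using y by linarith
  \<comment> \<open>Finiteness of \<open>m\<close> permits the cancellation of
    \<open>ennreal y * m\<close> in the last step.\<close>
  have "m \<le> (\<integral>\<^sup>+\<omega>. h \<omega> * of_nat (card V) \<partial>P)"
    unfolding m_def using card_mono[OF fin MV(1)] by (intro nn_integral_mono mult_left_mono) auto
  also have "\<dots> < \<infinity>" using finite_h by (simp add: nn_integral_multc ennreal_mult_less_top of_nat_less_top)
  finally have finm: "m < \<infinity>" .
  have card_bool: "(of_nat (card (M \<omega>)) :: ennreal) = (\<Sum>v\<in>V. of_bool (v \<in> M \<omega>))" for \<omega>
    using MV(1)[of \<omega>] fin by (simp add: Int_absorb1)
  let ?e = "\<lambda>u v \<omega>. h \<omega> * of_bool (v \<in> M \<omega> \<and> u \<in> M \<omega>)"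
  let ?F = "{(v, u) \<in> V \<times> V. precedes ord v u \<and> {u, v} \<in> E}"
  have finF: "finite ?F" using fin by (auto intro: finite_subset[of _ "V \<times> V"])
  \<comment> \<open>Every edge inside \<open>M \<omega>\<close> is recorded at its earlier end
    \<open>v\<close>; the later end \<open>u\<close> is the node to which \<open>swap\<close>
    applies. The factor 2 counts both ends.\<close>
  have deg: "(of_nat (\<Sum>v\<in>M \<omega>. d \<omega> v) :: ennreal) = 2 * (\<Sum>(v, u)\<in>?F. of_bool (v \<in> M \<omega> \<and> u \<in> M \<omega>))" for \<omega>
  proof -
    let ?A = "{(v, u) \<in> M \<omega> \<times> M \<omega>. precedes ord v u \<and> {u, v} \<in> E}"
    let ?B = "{(v, u) \<in> M \<omega> \<times> M \<omega>. precedes ord u v \<and> {u, v} \<in> E}"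
    have "(\<Sum>v\<in>M \<omega>. d \<omega> v) = card (SIGMA v:M \<omega>. nbrs E (M \<omega>) v)"
      unfolding d_def using finM by (subst card_SigmaI) (auto simp: nbrs_def)
    also have "(SIGMA v:M \<omega>. nbrs E (M \<omega>) v) = ?A \<union> ?B"
      using precedes_total[of _ ord] ord MV(1)[of \<omega>] no_loop by (fastforce simp: nbrs_def)
    also have "card (?A \<union> ?B) = card ?A + card ?B"
    proof (rule card_Un_disjoint)
      show "finite ?A" "finite ?B" using finM by (auto intro: finite_subset[of _ "M \<omega> \<times> M \<omega>"])
      show "?A \<inter> ?B = {}" using precedes_trans[OF ord(1)] precedes_irrefl[OF ord(1)] by blast
    qed
    also have "card ?B = card ?A"
      by (rule bij_betw_same_card[of prod.swap])
         (auto intro!: bij_betwI[where g = prod.swap] simp: insert_commute)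
    finally have "(\<Sum>v\<in>M \<omega>. d \<omega> v) = 2 * card ?A" by simp
    moreover have "(\<Sum>(v, u)\<in>?F. of_bool (v \<in> M \<omega> \<and> u \<in> M \<omega>)) = (of_nat (card ?A) :: ennreal)"
    proof -
      have "(\<Sum>(v, u)\<in>?F. of_bool (v \<in> M \<omega> \<and> u \<in> M \<omega>)) = (\<Sum>x\<in>?A. 1 :: ennreal)"
        using finF MV(1)[of \<omega>] by (intro sum.mono_neutral_cong_right) auto
      then show ?thesis by simp
    qed
    ultimately show ?thesis by simp
  qed
  \<comment> \<open>After the exchange, \<open>u\<close> ranges over the independent set
    \<open>N \<omega>\<close>, which is \<open>M1\<close>, and at most \<open>\<rho>\<close> of its
    nodes are later neighbours of \<open>v\<close>.\<close>
  have N_succ: "(\<Sum>u\<in>{u \<in> V. precedes ord v u \<and> {u, v} \<in> E}. of_bool (v \<in> M \<omega> \<and> u \<in> N \<omega>))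
      \<le> (of_nat \<rho> :: ennreal) * of_bool (v \<in> M \<omega>)" if "v \<in> V" for v \<omega>
  proof -
    have "(\<Sum>u\<in>{u \<in> V. precedes ord v u \<and> {u, v} \<in> E}. of_bool (u \<in> N \<omega>)) =
      (\<Sum>u\<in>{u \<in> N \<omega>. precedes ord v u \<and> {u, v} \<in> E}. 1 :: ennreal)"
      using fin MV(2)[of \<omega>] by (intro sum.mono_neutral_cong_right) auto
    also have "\<dots> \<le> of_nat \<rho>"
      using successors_le[OF MV(2) _ that, of \<omega>] M1_independent[of "S \<omega>"] M1_eq[OF sub(1)]
      by (simp add: N_def)
    finally show ?thesis by (cases "v \<in> M \<omega>") simp_all
  qed
  have "(\<integral>\<^sup>+\<omega>. h \<omega> * of_nat (\<Sum>v\<in>M \<omega>. d \<omega> v) \<partial>P) = 2 * (\<Sum>(v, u)\<in>?F. \<integral>\<^sup>+\<omega>. ?e u v \<omega> \<partial>P)"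
    unfolding deg nn_integral_pmf_mult_cmult nn_integral_pmf_mult_sum case_prod_unfold by (rule refl)
  also have "(\<Sum>(v, u)\<in>?F. \<integral>\<^sup>+\<omega>. ?e u v \<omega> \<partial>P)
      \<le> (\<Sum>(v, u)\<in>?F. ennreal K * (\<integral>\<^sup>+\<omega>. h \<omega> * of_bool (v \<in> M \<omega> \<and> u \<in> N \<omega>) \<partial>P))"
    using swap by (intro sum_mono) (auto simp: M_def N_def)
  also have "\<dots> = (\<Sum>v\<in>V. \<Sum>u\<in>{u \<in> V. precedes ord v u \<and> {u, v} \<in> E}.
      ennreal K * (\<integral>\<^sup>+\<omega>. h \<omega> * of_bool (v \<in> M \<omega> \<and> u \<in> N \<omega>) \<partial>P))"
    using fin by (subst sum.Sigma) (auto intro!: sum.cong)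
  also have "\<dots> = (\<Sum>v\<in>V. ennreal K * (\<integral>\<^sup>+\<omega>. h \<omega> *
      (\<Sum>u\<in>{u \<in> V. precedes ord v u \<and> {u, v} \<in> E}. of_bool (v \<in> M \<omega> \<and> u \<in> N \<omega>)) \<partial>P))"
    unfolding nn_integral_pmf_mult_sum by (simp only: sum_distrib_left)
  also have "\<dots> \<le> (\<Sum>v\<in>V. ennreal K * (\<integral>\<^sup>+\<omega>. h \<omega> * (of_nat \<rho> * of_bool (v \<in> M \<omega>)) \<partial>P))"
    using N_succ by (intro sum_mono mult_left_mono nn_integral_mono) auto
  also have "\<dots> = ennreal K * of_nat \<rho> * m"
    unfolding m_def card_bool nn_integral_pmf_mult_sum nn_integral_pmf_mult_cmult
    by (simp add: sum_distrib_left mult.assoc)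
  finally have edges: "(\<integral>\<^sup>+\<omega>. h \<omega> * of_nat (\<Sum>v\<in>M \<omega>. d \<omega> v) \<partial>P) \<le> 2 * (ennreal K * of_nat \<rho> * m)"
    by (simp add: mult_left_mono)
  \<comment> \<open>The tangent bound is summed over \<open>M \<omega>\<close>. The degree term is
    at most \<open>y * m\<close> by \<open>edges\<close> and the assumption on \<open>y\<close>, and
    cancels against the left side.\<close>
  have "ennreal (1 + y) * m = (\<integral>\<^sup>+\<omega>. h \<omega> * (\<Sum>v\<in>M \<omega>. ennreal (1 + y)) \<partial>P)"
    unfolding m_def nn_integral_pmf_mult_cmult[symmetric] by (simp add: mult.commute)
  also have "\<dots> \<le> (\<integral>\<^sup>+\<omega>. h \<omega> * (\<Sum>v\<in>M \<omega>. ennreal (exp y) * ennreal ((1 - q) ^ d \<omega> v)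
      + ennreal (2 * q) * of_nat (d \<omega> v)) \<partial>P)"
  proof (intro nn_integral_mono mult_left_mono sum_mono)
    fix \<omega> v
    have "ennreal (1 + y) \<le> ennreal (exp y * (1 - q) ^ d \<omega> v + 2 * q * real (d \<omega> v))"
      by (intro ennreal_leI isolation_tangent q)
    also have "\<dots> = ennreal (exp y) * ennreal ((1 - q) ^ d \<omega> v) + ennreal (2 * q) * of_nat (d \<omega> v)"
      using q by (simp add: ennreal_plus ennreal_mult ennreal_of_nat_eq_real_of_nat)
    finally show "ennreal (1 + y) \<le> \<dots>" .
  qed simp
  also have "\<dots> = ennreal (exp y) * R
      + ennreal (2 * q) * (\<integral>\<^sup>+\<omega>. h \<omega> * of_nat (\<Sum>v\<in>M \<omega>. d \<omega> v) \<partial>P)"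
    unfolding R_def nn_integral_pmf_mult_cmult[symmetric] sum.distrib distrib_left of_nat_sum
      sum_distrib_left[symmetric]
    by (rule nn_integral_add) auto
  also have "\<dots> \<le> ennreal (exp y) * R + ennreal (2 * q) * (2 * (ennreal K * of_nat \<rho> * m))"
    by (intro add_left_mono mult_left_mono edges) simp
  also have "ennreal (2 * q) * (2 * (ennreal K * of_nat \<rho> * m)) = ennreal (4 * q * K * real \<rho>) * m"
  proof -
    have "4 * q * K * real \<rho> = (2 * q) * (2 * (K * real \<rho>))" by simp
    also have "ennreal \<dots> = ennreal (2 * q) * (2 * (ennreal K * of_nat \<rho>))"
      using q K by (simp only: ennreal_mult ennreal_numeral ennreal_of_nat_eq_real_of_nat
          mult_nonneg_nonneg of_nat_0_le_iff zero_le_numeral)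
    finally show ?thesis by (simp only: mult.assoc)
  qed
  also have "\<dots> \<le> ennreal y * m"
    by (intro mult_right_mono ennreal_leI y) simp
  finally have "ennreal (1 + y) * m \<le> ennreal (exp y) * R + ennreal y * m"
    by (simp add: add_left_mono)
  then have "m + ennreal y * m \<le> ennreal (exp y) * R + ennreal y * m"
    using y0 by (simp add: ennreal_plus distrib_right)
  moreover have "ennreal y * m < \<infinity>" using finm by (simp add: ennreal_mult_less_top)
  ultimately have "m \<le> ennreal (exp y) * R"
    by (auto simp: ennreal_add_left_cancel_le add.commute[of _ "ennreal y * m"])
  then show ?thesis by (simp add: m_def R_def M_def d_def)
qed

end

section \<open>The unweighted algorithm\<close>

text \<open>In the degenerate cases the conventions of \<open>ennreal\<close> decide:
  \<open>y = 0\<close> forces \<open>x = 0\<close>, and \<open>0 / 0 = 0\<close>; for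
  \<open>y = top\<close> the quotient is 0.\<close>

lemma competitive_ratio_le:
  assumes "(\<integral>\<^sup>+\<omega>. of_nat (OPT \<omega>) \<partial>measure_pmf P) \<le> ennreal a * (\<integral>\<^sup>+\<omega>. of_nat (ALG \<omega>) \<partial>measure_pmf P)"
  shows "competitive_ratio P OPT ALG \<le> ennreal a"
proof -
  define x where "x = (\<integral>\<^sup>+\<omega>. of_nat (OPT \<omega>) \<partial>measure_pmf P)"
  define y where "y = (\<integral>\<^sup>+\<omega>. of_nat (ALG \<omega>) \<partial>measure_pmf P)"
  have le: "x \<le> ennreal a * y" using assms by (simp add: x_def y_def)
  consider "y = 0" | "y = top" | "y \<noteq> 0" "y \<noteq> top" by blast
  then have "x / y \<le> ennreal a"
  proof cases
    case 3
    have "x / y \<le> ennreal a * y / y" by (rule divide_right_mono_ennreal[OF le])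
    also have "\<dots> = ennreal a" using 3 by (rule ennreal_mult_divide_eq)
    finally show ?thesis .
  qed (use le in auto)
  then show ?thesis by (simp add: competitive_ratio_def x_def y_def)
qed

lemma ennreal_inverse_antimono: "(a :: ennreal) \<le> b \<Longrightarrow> inverse b \<le> inverse a"
  including ennreal.lifting by transfer (rule ereal_inverse_antimono)

lemma finite_independent_sums:
  "finite V \<Longrightarrow> finite {\<Sum>v\<in>S. f v | S. S \<subseteq> V \<and> independent_set E S}"
  by (rule finite_subset[of _ "(\<lambda>S. \<Sum>v\<in>S. f v) ` Pow V"]) auto

lemma opt_ge:
  assumes "finite V" "T \<subseteq> V" "independent_set E T"
  shows "(\<Sum>v\<in>T. wI w v) \<le> opt V E w"
  unfolding opt_def using assms by (intro Max_ge finite_independent_sums) auto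

lemma opt_attained:
  assumes "finite V"
  obtains T where "T \<subseteq> V" "independent_set E T" "opt V E w = (\<Sum>v\<in>T. wI w v)"
proof -
  have "opt V E w \<in> {\<Sum>v\<in>S. wI w v | S. S \<subseteq> V \<and> independent_set E S}"
    unfolding opt_def using assms
    by (intro Max_in finite_independent_sums) (auto simp: independent_set_def intro!: exI[of _ "{}"])
  then show ?thesis using that by blast
qed

text \<open>Similarity says nothing about the weight 0, hence the factor
  \<open>of_bool (b > 0)\<close> on both sides.\<close>

lemma nn_integral_pmf_le_scaled:
  assumes "\<And>b. b > 0 \<Longrightarrow> pmf p b \<le> c * pmf p' b" "c \<ge> 0"
  shows "(\<integral>\<^sup>+b. of_bool (b > 0) * f b \<partial>measure_pmf p) \<le>
    ennreal c * (\<integral>\<^sup>+b. of_bool ((b::nat) > 0) * f b \<partial>measure_pmf p')"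
proof -
  have "(\<integral>\<^sup>+b. of_bool (b > 0) * f b \<partial>measure_pmf p) =
    (\<integral>\<^sup>+b. ennreal (pmf p b) * (of_bool (b > 0) * f b) \<partial>count_space UNIV)"
    by (rule nn_integral_measure_pmf)
  also have "\<dots> \<le> (\<integral>\<^sup>+b. ennreal c * (ennreal (pmf p' b) * (of_bool (b > 0) * f b)) \<partial>count_space UNIV)"
  proof (rule nn_integral_mono)
    fix b
    show "ennreal (pmf p b) * (of_bool (b > 0) * f b)
      \<le> ennreal c * (ennreal (pmf p' b) * (of_bool (b > 0) * f b))"
    proof (cases "b > 0")
      case True
      then have "ennreal (pmf p b) \<le> ennreal c * ennreal (pmf p' b)"
        using assms by (simp add: ennreal_mult[symmetric] ennreal_leI)
      then show ?thesis by (simp add: mult.assoc[symmetric] mult_right_mono)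
    qed simp
  qed
  also have "\<dots> = ennreal c * (\<integral>\<^sup>+b. of_bool (b > 0) * f b \<partial>measure_pmf p')"
    by (simp add: nn_integral_cmult nn_integral_measure_pmf)
  finally show ?thesis .
qed

lemma similar_fst_le:
  assumes "similar c d" "c \<ge> 0"
  shows "(\<integral>\<^sup>+x. of_bool (fst x > 0) * f (fst x) \<partial>measure_pmf d) \<le>
    ennreal c * (\<integral>\<^sup>+x. of_bool (snd x > 0) * f (snd x) \<partial>measure_pmf d)"
  using nn_integral_pmf_le_scaled[of "map_pmf fst d" c "map_pmf snd d" f] assms
  by (simp add: similar_def)

lemma similar_snd_le:
  assumes "similar c d" "c \<ge> 0"
  shows "(\<integral>\<^sup>+x. of_bool (snd x > 0) * f (snd x) \<partial>measure_pmf d) \<le>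
    ennreal c * (\<integral>\<^sup>+x. of_bool (fst x > 0) * f (fst x) \<partial>measure_pmf d)"
  using nn_integral_pmf_le_scaled[of "map_pmf snd d" c "map_pmf fst d" f] assms
  by (simp add: similar_def)

lemma positive_nodes_subset: "positive_nodes V f \<subseteq> V"
  by (auto simp: positive_nodes_def)

lemma ennreal_of_nat_sum_bool:
  "finite V \<Longrightarrow> A \<subseteq> V \<Longrightarrow> (of_nat (card A) :: ennreal) = (\<Sum>v\<in>V. of_bool (v \<in> A))"
  by (simp add: Int_absorb1)

text \<open>The constant is the product of \<open>2 * \<rho> * c\<close>, lost from the optimum to
  \<open>M2\<close>, of \<open>exp 2\<close>, lost from \<open>M2\<close> to its isolated nodes, and
  of \<open>1 / q = 2 * \<rho> * c\<close>, lost by thinning.\<close>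

lemma A1_ratio_on_le:
  assumes c: "c \<ge> 1" and rho: "\<rho> \<ge> 1" and inst: "sampling_instance c \<rho> V E ord D"
    and unweighted: "\<forall>v\<in>V. set_pmf (D v) \<subseteq> {0, 1} \<times> {0, 1}" and adv: "adversary V fst arr"
  shows "A1_ratio_on c \<rho> V E ord D arr \<le> ennreal (4 * exp 2 * c\<^sup>2 * real \<rho> ^ 2)"
proof -
  interpret ordered_graph V E ord \<rho>
    using inst rho by unfold_locales (auto simp: sampling_instance_def)
  define W where "W = weights_pmf V D"
  define S where "S w = positive_nodes V (wS w)" for w
  define I where "I w = positive_nodes V (wI w)" for w
  define q where "q = 1 / (2 * real \<rho> * c)"
  define M where "M w = M2 E ord (S w) (I w)" for w
  have sub: "S w \<subseteq> V" "I w \<subseteq> V" for w by (simp_all add: S_def I_def positive_nodes_subset)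
  have MV: "M w \<subseteq> V" "M2 E ord (S w) (S w) \<subseteq> V" for w using sub by (auto simp: M_def M2_def)
  have "1 * 1 \<le> real \<rho> * c" using c rho by (intro mult_mono) auto
  then have rc: "1 \<le> real \<rho> * c" by simp
  then have q: "0 \<le> q" "q \<le> 1/2" "q \<le> 1" "q > 0" using c rho by (auto simp: q_def field_simps)
  have sim: "similar c (D v)" if "v \<in> V" for v using inst that by (simp add: sampling_instance_def)
  have pass: "in_M2 E ord (S (w(u := x))) v \<longleftrightarrow> in_M2 E ord (S w) v"
    if "v \<in> V" "v = u \<or> precedes ord v u" for w u x v
  proof (rule in_M2_cong[OF no_loop ord(1)])
    fix z assume "precedes ord z v"
    then have "z \<noteq> u" using that(2) precedes_irrefl[OF ord(1)] precedes_trans[OF ord(1)] by blast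
    then show "z \<in> S (w(u := x)) \<longleftrightarrow> z \<in> S w" by (simp add: S_def positive_nodes_def wS_def)
  qed (use that ord in auto)
  \<comment> \<open>\<open>F\<close> does not see the weights of \<open>u\<close>, so
    \<open>u\<close> contributes an independent factor on each side, and only its two marginal laws
    are compared.\<close>
  have exch: "(\<integral>\<^sup>+w. of_bool (u \<in> I w) * F w \<partial>W) \<le> ennreal c * (\<integral>\<^sup>+w. of_bool (u \<in> S w) * F w \<partial>W)"
             "(\<integral>\<^sup>+w. of_bool (u \<in> S w) * F w \<partial>W) \<le> ennreal c * (\<integral>\<^sup>+w. of_bool (u \<in> I w) * F w \<partial>W)"
    if u: "u \<in> V" and F: "\<And>w x. F (w(u := x)) = F w" for u and F :: "weights \<Rightarrow> ennreal"
  proof -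
    have I: "(\<integral>\<^sup>+w. of_bool (u \<in> I w) * F w \<partial>W) = (\<integral>\<^sup>+x. of_bool (fst x > 0) \<partial>D u) * (\<integral>\<^sup>+w. F w \<partial>W)"
      using nn_integral_Pi_pmf_indep[where g = "\<lambda>x. of_bool (fst x > 0)" and d = "(0, 0)" and D = D, OF fin u F] u
      by (simp add: I_def positive_nodes_def wI_def W_def weights_pmf_def)
    have S: "(\<integral>\<^sup>+w. of_bool (u \<in> S w) * F w \<partial>W) = (\<integral>\<^sup>+x. of_bool (snd x > 0) \<partial>D u) * (\<integral>\<^sup>+w. F w \<partial>W)"
      using nn_integral_Pi_pmf_indep[where g = "\<lambda>x. of_bool (snd x > 0)" and d = "(0, 0)" and D = D, OF fin u F] u
      by (simp add: S_def positive_nodes_def wS_def W_def weights_pmf_def)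
    show "(\<integral>\<^sup>+w. of_bool (u \<in> I w) * F w \<partial>W) \<le> ennreal c * (\<integral>\<^sup>+w. of_bool (u \<in> S w) * F w \<partial>W)"
      using similar_fst_le[OF sim[OF u], of "\<lambda>_. 1"] c unfolding I S
      by (simp add: mult.assoc[symmetric] mult_right_mono)
    show "(\<integral>\<^sup>+w. of_bool (u \<in> S w) * F w \<partial>W) \<le> ennreal c * (\<integral>\<^sup>+w. of_bool (u \<in> I w) * F w \<partial>W)"
      using similar_snd_le[OF sim[OF u], of "\<lambda>_. 1"] c unfolding I S
      by (simp add: mult.assoc[symmetric] mult_right_mono)
  qed
  define m where "m = (\<integral>\<^sup>+w. of_nat (card (M w)) \<partial>W)"
  define R where "R = (\<integral>\<^sup>+w. (\<Sum>v\<in>M w. ennreal ((1 - q) ^ card (nbrs E (M w) v))) \<partial>W)"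
  define A where "A = (\<integral>\<^sup>+w. \<integral>\<^sup>+t. of_nat (card (A1 E ord (S w) t (arr (w, t)))) \<partial>thinning_pmf V \<rho> c \<partial>W)"
  have m_le: "m \<le> ennreal (exp 2) * R"
  proof -
    have "(\<integral>\<^sup>+w. 1 * of_nat (card (M2 E ord (S w) (I w))) \<partial>W) \<le>
      ennreal (exp 2) * (\<integral>\<^sup>+w. 1 * (\<Sum>v\<in>M2 E ord (S w) (I w).
      ennreal ((1 - q) ^ card (nbrs E (M2 E ord (S w) (I w)) v))) \<partial>W)"
    \<comment> \<open>Here the weight \<open>h\<close> is 1 and the exchange of the later end
      \<open>u\<close> costs \<open>K = c\<close>, so that
      \<open>4 * q * K * \<rho> = 2\<close>.\<close>
    proof (rule isolated_lower_bound[OF sub, of c q 2])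
      show "4 * q * c * real \<rho> \<le> 2" using c rho by (simp add: q_def field_simps)
      fix u v assume uv: "u \<in> V" "v \<in> V" "precedes ord v u"
      then have "v \<noteq> u" using precedes_irrefl[OF ord(1)] by blast
      define F where "F w = (of_bool (v \<in> I w \<and> in_M2 E ord (S w) v \<and> in_M2 E ord (S w) u) :: ennreal)" for w
      have F: "F (w(u := x)) = F w" for w x
        unfolding F_def using pass[of v u w x] pass[of u u w x] uv \<open>v \<noteq> u\<close>
        by (simp add: I_def positive_nodes_def wI_def)
      have "(\<integral>\<^sup>+w. 1 * of_bool (v \<in> M2 E ord (S w) (I w) \<and> u \<in> M2 E ord (S w) (I w)) \<partial>W)
        = (\<integral>\<^sup>+w. of_bool (u \<in> I w) * F w \<partial>W)"
        by (intro nn_integral_cong) (auto simp: M2_def F_def)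
      also have "\<dots> \<le> ennreal c * (\<integral>\<^sup>+w. of_bool (u \<in> S w) * F w \<partial>W)"
        by (rule exch(1)[OF uv(1) F])
      also have "(\<integral>\<^sup>+w. of_bool (u \<in> S w) * F w \<partial>W) =
        (\<integral>\<^sup>+w. 1 * of_bool (v \<in> M2 E ord (S w) (I w) \<and> u \<in> M2 E ord (S w) (S w)) \<partial>W)"
        by (intro nn_integral_cong) (auto simp: M2_def F_def)
      finally show "(\<integral>\<^sup>+w. 1 * of_bool (v \<in> M2 E ord (S w) (I w) \<and> u \<in> M2 E ord (S w) (I w)) \<partial>W) \<le>
        ennreal c * (\<integral>\<^sup>+w. 1 * of_bool (v \<in> M2 E ord (S w) (I w) \<and> u \<in> M2 E ord (S w) (S w)) \<partial>W)" .
    qed (use c q in auto)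
    then show ?thesis by (simp add: m_def R_def M_def)
  qed
  have alg: "ennreal q * R \<le> A"
  proof -
    have "ennreal q * R = (\<integral>\<^sup>+w. (\<Sum>v\<in>M w. ennreal (q * (1 - q) ^ card (nbrs E (M w) v))) \<partial>W)"
      unfolding R_def using q
      by (subst nn_integral_cmult[symmetric]) (simp_all add: ennreal_mult sum_distrib_left del: sum_ennreal)
    also have "\<dots> \<le> A"
      unfolding A_def
    proof (rule nn_integral_mono)
      fix w
      have "set (arr (w, t)) = I w" for t
        using adv by (auto simp: adversary_def enumerates_def I_def)
      then show "(\<Sum>v\<in>M w. ennreal (q * (1 - q) ^ card (nbrs E (M w) v)))
        \<le> (\<integral>\<^sup>+t. of_nat (card (A1 E ord (S w) t (arr (w, t)))) \<partial>thinning_pmf V \<rho> c)"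
        using A1_expectation_ge[where I = "I w" and xs = "\<lambda>t. arr (w, t)" and q = q and S = "S w" and y = "\<lambda>_. 1"] q sub(2)[of w]
        by (simp add: M_def thinning_pmf_def q_def)
    qed
    finally show ?thesis .
  qed
  have M1_le: "(\<integral>\<^sup>+w. of_nat (card (M1 E ord (S w))) \<partial>W) \<le> ennreal c * m"
  proof -
    have "(\<integral>\<^sup>+w. of_nat (card (M1 E ord (S w))) \<partial>W) =
      (\<Sum>v\<in>V. \<integral>\<^sup>+w. of_bool (v \<in> S w) * of_bool (in_M2 E ord (S w) v) \<partial>W)"
      unfolding M1_eq[OF sub(1)] ennreal_of_nat_sum_bool[OF fin MV(2)]
      by (subst nn_integral_sum) (simp_all add: M2_def of_bool_conj)
    also have "\<dots> \<le> (\<Sum>v\<in>V. ennreal c * (\<integral>\<^sup>+w. of_bool (v \<in> I w) * of_bool (in_M2 E ord (S w) v) \<partial>W))"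
      using pass by (intro sum_mono exch(2)) auto
    also have "\<dots> = ennreal c * m"
      unfolding m_def ennreal_of_nat_sum_bool[OF fin MV(1)] sum_distrib_left[symmetric]
      by (subst nn_integral_sum) (simp_all add: M2_def M_def of_bool_conj)
    finally show ?thesis .
  qed
  have "(\<integral>\<^sup>+w. of_nat (opt V E w) \<partial>W) \<le> (\<integral>\<^sup>+w. of_nat (card (M w)) + of_nat \<rho> * of_nat (card (M1 E ord (S w))) \<partial>W)"
  proof (intro nn_integral_mono_AE AE_pmfI)
    fix w assume w: "w \<in> set_pmf W"
    obtain T where T: "T \<subseteq> V" "independent_set E T" "opt V E w = (\<Sum>v\<in>T. wI w v)"
      using opt_attained[OF fin] .
    have w01: "wI w v \<le> 1" if "v \<in> V" for v
    proof -
      have "w v \<in> set_pmf (D v)"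
        using w that fin by (auto simp: W_def weights_pmf_def set_Pi_pmf PiE_dflt_def)
      then have "w v \<in> {0, 1} \<times> {0, 1}" using unweighted that by blast
      then show ?thesis by (auto simp: wI_def)
    qed
    have "(\<Sum>v\<in>T. wI w v) = (\<Sum>v\<in>T \<inter> I w. wI w v)"
      using T fin by (intro sum.mono_neutral_right) (auto simp: I_def positive_nodes_def intro: finite_subset)
    also have "\<dots> \<le> (\<Sum>v\<in>T \<inter> I w. 1)" using T w01 by (intro sum_mono) auto
    also have "\<dots> = card (T \<inter> I w)" by simp
    also have "\<dots> \<le> card (M2 E ord (S w) (I w)) + \<rho> * card (M1 E ord (S w))"
      using T(2) by (intro card_independent_le sub) (auto simp: independent_set_def)
    finally show "of_nat (opt V E w) \<le> (of_nat (card (M w)) + of_nat \<rho> * of_nat (card (M1 E ord (S w))) :: ennreal)"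
      unfolding T(3) M_def of_nat_mult[symmetric] of_nat_add[symmetric] by (rule of_nat_mono)
  qed
  also have "\<dots> = m + of_nat \<rho> * (\<integral>\<^sup>+w. of_nat (card (M1 E ord (S w))) \<partial>W)"
    by (simp add: nn_integral_add nn_integral_cmult m_def)
  also have "\<dots> \<le> m + of_nat \<rho> * (ennreal c * m)"
    by (intro add_left_mono mult_left_mono M1_le) simp
  also have "\<dots> = ennreal (1 + real \<rho> * c) * m"
    using c by (simp add: ennreal_plus ennreal_mult distrib_right ennreal_of_nat_eq_real_of_nat mult.assoc)
  also have "\<dots> \<le> ennreal (2 * real \<rho> * c) * (ennreal (exp 2) * R)"
    using rc by (intro mult_mono ennreal_leI m_le) (auto simp: mult.commute)
  also have "\<dots> = ennreal (4 * exp 2 * c\<^sup>2 * real \<rho> ^ 2) * (ennreal q * R)"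
    using c rho q by (simp add: ennreal_mult[symmetric] mult.assoc[symmetric] del: ennreal_power)
      (simp add: q_def field_simps power2_eq_square)
  also have "\<dots> \<le> ennreal (4 * exp 2 * c\<^sup>2 * real \<rho> ^ 2) * A"
    by (intro mult_left_mono alg) simp
  finally show ?thesis
    unfolding A1_ratio_on_def A_def W_def S_def
    by (intro competitive_ratio_le) (simp add: nn_integral_pair_pmf')
qed

lemma A1_ratio_le:
  assumes "c \<ge> 1" "\<rho> \<ge> 1"
  shows "A1_ratio c \<rho> \<le> ennreal (4 * exp 2 * c\<^sup>2 * real \<rho> ^ 2)"
  unfolding A1_ratio_def
proof (rule Sup_least, clarify)
  fix V E ord D and arr :: "A1_outcome \<Rightarrow> node list"
  assume "sampling_instance c \<rho> V E ord D" "\<forall>v\<in>V. set_pmf (D v) \<subseteq> {0, 1} \<times> {0, 1}" "adversary V fst arr"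
  then show "A1_ratio_on c \<rho> V E ord D arr \<le> ennreal (4 * exp 2 * c\<^sup>2 * real \<rho> ^ 2)"
    by (rule A1_ratio_on_le[OF assms])
qed

text \<open>The bound \<open>\<rho>\<^sup>2\<close> is attained on \<open>K\<^bsub>\<rho>,\<rho>\<^esub>\<close>: a single left node that is first in the order and
  always sampled blocks the whole right side, and it survives the thinning with probability
  \<open>1 / (2 \<rho> c)\<close>. This lets bounds of order \<open>\<rho>\<^sup>2\<close> be restated in terms of \<open>A1_ratio\<close>.\<close>

lemma A1_ratio_ge:
  assumes c: "c \<ge> 1" and rho: "\<rho> \<ge> 1"
  shows "ennreal (2 * c * real \<rho> ^ 2) \<le> A1_ratio c \<rho>"
proof -
  define V where "V = {0..<2 * \<rho>}"
  define E where "E = {{u, v} | u v. u < \<rho> \<and> \<rho> \<le> v \<and> v < 2 * \<rho>}"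
  define ord where "ord = [0..<2 * \<rho>]"
  \<comment> \<open>Deterministic weights: the nodes of \<open>J\<close> are sampled and also
    arrive, with weight 1. The other left nodes never appear; they serve to make the inductive
    independence number equal to \<open>\<rho>\<close>.\<close>
  define J where "J = insert 0 {\<rho>..<2 * \<rho>}"
  define D where "D v = return_pmf (if v \<in> J then (1, 1) else (0, 0) :: nat \<times> nat)" for v :: nat
  define w0 where "w0 v = (if v \<in> J then (1, 1) else (0, 0) :: nat \<times> nat)" for v :: nat
  define arr where "arr = (\<lambda>(w, t :: node \<Rightarrow> bool). filter (\<lambda>v. wI w v > 0) ord)"
  have E_iff: "{u, v} \<in> E \<longleftrightarrow> u < \<rho> \<and> \<rho> \<le> v \<and> v < 2 * \<rho> \<or> v < \<rho> \<and> \<rho> \<le> u \<and> u < 2 * \<rho>" for u v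
    unfolding E_def by (auto simp: doubleton_eq_iff)
  have graph: "simple_graph V E" unfolding simple_graph_def V_def E_def by fastforce
  have prec: "precedes ord u v \<longleftrightarrow> u < v \<and> v < 2 * \<rho>" for u v
  proof
    assume "u < v \<and> v < 2 * \<rho>"
    then show "precedes ord u v"
      unfolding precedes_def ord_def by (intro exI[of _ u] exI[of _ v]) simp
  qed (auto simp: precedes_def ord_def)
  have ord_V: "enumerates ord V" unfolding enumerates_def ord_def V_def by simp
  have order: "inductive_order V E ord \<rho>"
    unfolding inductive_order_def
  proof (intro conjI ord_V allI impI)
    fix S v
    let ?A = "{u \<in> S. precedes ord v u \<and> {u, v} \<in> E}"
    have "?A \<subseteq> {\<rho>..<2 * \<rho>}" by (auto simp: E_iff prec)
    then have "card ?A \<le> card {\<rho>..<2 * \<rho>}" by (intro card_mono) auto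
    then show "card ?A \<le> \<rho>" by simp
  qed
  \<comment> \<open>The first node of any order precedes the whole opposite side, which is an
    independent set of \<open>\<rho>\<close> neighbours.\<close>
  have least: "\<rho> \<le> k" if "inductive_order V E ord' k" for ord' k
  proof -
    have ord': "distinct ord'" "set ord' = V"
      using that by (auto simp: inductive_order_def enumerates_def)
    have "V \<noteq> {}" using rho by (simp add: V_def)
    then have len: "0 < length ord'" using ord'(2) by auto
    define x where "x = ord' ! 0"
    have x: "x \<in> V" using len ord'(2) nth_mem x_def by blast
    define S where "S = (if x < \<rho> then {\<rho>..<2 * \<rho>} else {0..<\<rho>})"
    have S: "S \<subseteq> V" "independent_set E S" by (auto simp: S_def V_def independent_set_def E_iff)
    have "precedes ord' x u" if "u \<in> S" for u
    proof -
      have "u \<in> set ord'" "u \<noteq> x" using that S ord' x by (auto simp: S_def V_def split: if_splits)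
      then obtain j where "j < length ord'" "ord' ! j = u" "j \<noteq> 0"
        by (metis in_set_conv_nth x_def)
      then show ?thesis unfolding precedes_def x_def by blast
    qed
    then have "{u \<in> S. precedes ord' x u \<and> {u, x} \<in> E} = S"
      using x by (auto simp: S_def V_def E_iff)
    then have "card S \<le> k" using that S x unfolding inductive_order_def by metis
    then show ?thesis by (simp add: S_def split: if_splits)
  qed
  have number: "inductive_independence_number V E = \<rho>"
    unfolding inductive_independence_number_def using order least by (intro Least_equality) blast+
  have inst: "sampling_instance c \<rho> V E ord D"
    using c by (auto simp: sampling_instance_def graph order number similar_def D_def map_return_pmf
        pmf_return indicator_def)
  have adv: "adversary V fst arr"
    unfolding adversary_def enumerates_def arr_def ord_def V_def positive_nodes_def by auto
  interpret ordered_graph V E ord \<rho> by unfold_locales (rule graph order rho)+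
  have J: "J \<subseteq> V" using rho by (auto simp: J_def V_def)
  have w0: "weights_pmf V D = return_pmf w0"
    unfolding weights_pmf_def D_def w0_def using J fin by (subst Pi_pmf_return_pmf) (auto simp: fun_eq_iff)
  have pos: "positive_nodes V (wI w0) = J" "positive_nodes V (wS w0) = J"
    using J by (auto simp: positive_nodes_def wI_def wS_def w0_def)
  have zero: "0 \<in> M1 E ord J" unfolding M1_eq[OF J] by (simp add: M2_def J_def in_M2_def prec)
  have M2: "M2 E ord J J \<subseteq> {0}"
  proof
    fix v assume v: "v \<in> M2 E ord J J"
    show "v \<in> {0}"
    proof (rule ccontr)
      assume "v \<notin> {0}"
      then have "precedes ord 0 v \<and> {0, v} \<in> E" using v rho by (auto simp: M2_def J_def prec E_iff)
      then show False using v zero by (auto simp: M2_def in_M2_def)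
    qed
  qed
  define q where "q = 1 / (2 * real \<rho> * c)"
  have "1 * 1 \<le> real \<rho> * c" using c rho by (intro mult_mono) auto
  then have q: "0 \<le> q" "q \<le> 1" "q > 0" using c rho by (auto simp: q_def field_simps)
  have alg: "(\<integral>\<^sup>+t. of_nat (card (A1 E ord J t (arr (w0, t)))) \<partial>thinning_pmf V \<rho> c) \<le> ennreal q"
  proof -
    have "(\<integral>\<^sup>+t. of_nat (card (A1 E ord J t (arr (w0, t)))) \<partial>thinning_pmf V \<rho> c)
      \<le> (\<integral>\<^sup>+t. of_bool (t 0 \<and> (\<forall>u\<in>{}. \<not> t u)) \<partial>thinning_pmf V \<rho> c)"
    proof (rule nn_integral_mono)
      fix t
      have "set (arr (w0, t)) = J"
        using adv pos by (auto simp: adversary_def enumerates_def)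
      then have "A1 E ord J t (arr (w0, t)) \<subseteq> (if t 0 then {0} else {})"
        using A1_subset[of E ord J t "arr (w0, t)"] M2 by auto
      then have "card (A1 E ord J t (arr (w0, t))) \<le> card (if t 0 then {0 :: nat} else {})"
        by (intro card_mono) auto
      then show "of_nat (card (A1 E ord J t (arr (w0, t)))) \<le> (of_bool (t 0 \<and> (\<forall>u\<in>{}. \<not> t u)) :: ennreal)"
        by (cases "t 0") (auto intro: of_nat_mono[where j = 1, simplified])
    qed
    also have "\<dots> = ennreal q"
      using thinning_isolated[OF fin, of 0 "{}" q] rho q by (simp add: thinning_pmf_def q_def V_def)
    finally show ?thesis .
  qed
  have "\<rho> \<le> opt V E w0"
  proof -
    have "(\<Sum>v\<in>{\<rho>..<2 * \<rho>}. wI w0 v) \<le> opt V E w0"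
      by (intro opt_ge fin) (auto simp: V_def independent_set_def E_iff)
    then show ?thesis by (simp add: wI_def w0_def J_def)
  qed
  then have "ennreal (real \<rho>) / ennreal q \<le> of_nat (opt V E w0) / (\<integral>\<^sup>+t. of_nat (card (A1 E ord J t (arr (w0, t)))) \<partial>thinning_pmf V \<rho> c)"
    using alg unfolding divide_ennreal_def ennreal_of_nat_eq_real_of_nat
    by (intro mult_mono ennreal_leI ennreal_inverse_antimono) auto
  also have "\<dots> = A1_ratio_on c \<rho> V E ord D arr"
    unfolding A1_ratio_on_def competitive_ratio_def by (simp add: w0 nn_integral_pair_pmf' pos)
  also have "\<dots> \<le> A1_ratio c \<rho>"
  proof -
    have "\<forall>v\<in>V. set_pmf (D v) \<subseteq> {0, 1} \<times> {0, 1}" by (auto simp: D_def)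
    then show ?thesis unfolding A1_ratio_def using inst adv by (intro Sup_upper) blast
  qed
  also have "ennreal (real \<rho>) / ennreal q = ennreal (2 * c * real \<rho> ^ 2)"
    using q by (simp add: divide_ennreal q_def power2_eq_square mult_ac)
  finally show ?thesis .
qed

section \<open>Exchanging online and sample weights\<close>

lemma v_max_props:
  assumes "enumerates tb V" "A \<subseteq> V" "A \<noteq> {}" "finite V"
  shows "v_max tb A s \<in> A" "\<And>u. u \<in> A \<Longrightarrow> s u \<le> s (v_max tb A s)"
proof -
  let ?P = "\<lambda>v. v \<in> A \<and> (\<forall>u\<in>A. s u \<le> s v)"
  have "finite A" using assms finite_subset by blast
  then have "Max (s ` A) \<in> s ` A" "\<forall>u\<in>A. s u \<le> Max (s ` A)" using assms(3) by auto
  then obtain x where "?P x" by (metis imageE)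
  then have "filter ?P tb \<noteq> []"
    using assms(1,2) by (auto simp: enumerates_def filter_empty_conv)
  then have "hd (filter ?P tb) \<in> set (filter ?P tb)" by (rule hd_in_set)
  then have "?P (v_max tb A s)" by (simp add: v_max_def)
  then show "v_max tb A s \<in> A" "\<And>u. u \<in> A \<Longrightarrow> s u \<le> s (v_max tb A s)" by auto
qed

text \<open>The maximisers over \<open>A'\<close> are those over \<open>A\<close> that lie in
  \<open>A'\<close>, because \<open>A'\<close> contains at least one of them; and the first of them
  in \<open>tb\<close> stays the first. This identifies the heaviest sampled node with a node ranked
  among all present ones, ties included.\<close>

lemma v_max_subset:
  assumes "enumerates tb V" "A \<subseteq> V" "finite V"
    and "A' \<subseteq> A" "v_max tb A s \<in> A'" "\<And>u. u \<in> A' \<Longrightarrow> s' u = s u"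
  shows "v_max tb A' s' = v_max tb A s"
proof -
  let ?x = "v_max tb A s"
  have "A \<noteq> {}" using assms by auto
  note mx = v_max_props[OF assms(1,2) this assms(3), where s = s]
  have iff: "v \<in> A' \<and> (\<forall>u\<in>A'. s' u \<le> s' v) \<longleftrightarrow> v \<in> A' \<and> (v \<in> A \<and> (\<forall>u\<in>A. s u \<le> s v))" for v
  proof
    assume L: "v \<in> A' \<and> (\<forall>u\<in>A'. s' u \<le> s' v)"
    then have "s ?x \<le> s v" using assms(5,6) by metis
    then show "v \<in> A' \<and> (v \<in> A \<and> (\<forall>u\<in>A. s u \<le> s v))"
      using L assms(4) mx(2) order_trans by blast
  next
    assume "v \<in> A' \<and> (v \<in> A \<and> (\<forall>u\<in>A. s u \<le> s v))"
    then show "v \<in> A' \<and> (\<forall>u\<in>A'. s' u \<le> s' v)" using assms(4,6) by auto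
  qed
  have hd_filter: "hd (filter (\<lambda>v. Q v) ys) = hd ys" if "ys \<noteq> []" "Q (hd ys)" for Q and ys :: "nat list"
    using that by (cases ys) auto
  let ?ys = "filter (\<lambda>v. v \<in> A \<and> (\<forall>u\<in>A. s u \<le> s v)) tb"
  have "?x \<in> set ?ys" using mx assms(1,2) by (auto simp: enumerates_def)
  then have "?ys \<noteq> []" by (metis empty_iff empty_set)
  then have "hd (filter (\<lambda>v. v \<in> A') ?ys) = hd ?ys"
    using assms(5) by (intro hd_filter) (auto simp: v_max_def)
  then show ?thesis unfolding v_max_def iff by (simp add: conj_commute)
qed

section \<open>Exchanging the two weights of a node\<close>

definition flip :: "node \<Rightarrow> weights \<Rightarrow> weights" where
  "flip v w = w(v := prod.swap (w v))"

lemma wI_flip: "wI (flip v w) u = (if u = v then wS w v else wI w u)"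
  and wS_flip: "wS (flip v w) u = (if u = v then wI w v else wS w u)"
  by (simp_all add: wI_def wS_def flip_def)

lemma flip_flip [simp]: "flip v (flip v w) = w"
  by (simp add: flip_def)

text \<open>After the coins at most one summand is nonzero, so this is the weight of
  \<open>v\<close> whichever role it has. Everything ranked by it is invariant under
  \<open>flip\<close>.\<close>

definition tot :: "weights \<Rightarrow> node \<Rightarrow> nat" where
  "tot w v = wI w v + wS w v"

lemma tot_flip [simp]: "tot (flip v w) = tot w"
  by (auto simp: tot_def wI_flip wS_flip)

lemma sum_of_bool_delta:
  assumes "finite A"
  shows "(\<Sum>u\<in>A. of_bool (Q u) * (of_bool (x = u) * h u)) = of_bool (x \<in> A \<and> Q x) * (h x :: ennreal)"
proof -
  have "(\<Sum>u\<in>A. of_bool (Q u) * (of_bool (x = u) * h u)) = (\<Sum>u\<in>A. if x = u then of_bool (Q x) * h x else 0)"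
    by (intro sum.cong) auto
  then show ?thesis using assms by simp
qed

lemma opt_mono:
  assumes "finite V" "\<And>v. v \<in> V \<Longrightarrow> wI w v \<le> wI w' v"
  shows "opt V E w \<le> opt V E w'"
proof -
  obtain T where T: "T \<subseteq> V" "independent_set E T" "opt V E w = (\<Sum>v\<in>T. wI w v)"
    using opt_attained[OF assms(1)] .
  have "(\<Sum>v\<in>T. wI w v) \<le> (\<Sum>v\<in>T. wI w' v)" using T assms(2) by (intro sum_mono) auto
  then show ?thesis using opt_ge[OF assms(1) T(1,2), of w'] T(3) by linarith
qed

text \<open>\<open>W\<close> is the law of the weights after the fair coins have been applied. The coins make the
  two weights of a node exclusive, so exchanging them costs only the factor \<open>c\<close>, and \<open>P u\<close> is the
  probability that \<open>u\<close> is sampled.\<close>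

locale split_model = ordered_graph V E ord \<rho>
  for V :: "node set" and E :: "node set set" and ord :: "node list" and \<rho> :: nat +
  fixes c :: real and tb :: "node list" and W :: "weights pmf" and P :: "node \<Rightarrow> ennreal" and N :: real
  assumes c: "c \<ge> 1" and tb: "enumerates tb V"
    and exclusive: "\<And>w v. w \<in> set_pmf W \<Longrightarrow> wI w v = 0 \<or> wS w v = 0"
    and exchange_IS: "\<And>v F. v \<in> V \<Longrightarrow> (\<integral>\<^sup>+w. of_bool (wI w v > 0) * F w \<partial>measure_pmf W) \<le>
      ennreal c * (\<integral>\<^sup>+w. of_bool (wS w v > 0) * F (flip v w) \<partial>measure_pmf W)"
    and exchange_SI: "\<And>v F. v \<in> V \<Longrightarrow> (\<integral>\<^sup>+w. of_bool (wS w v > 0) * F w \<partial>measure_pmf W) \<le>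
      ennreal c * (\<integral>\<^sup>+w. of_bool (wI w v > 0) * F (flip v w) \<partial>measure_pmf W)"
    and indep: "\<And>u F. u \<in> V \<Longrightarrow> (\<And>w x. F (w(u := x)) = F w) \<Longrightarrow>
      (\<integral>\<^sup>+w. of_bool (wS w u > 0) * F w \<partial>measure_pmf W) = P u * (\<integral>\<^sup>+w. F w \<partial>measure_pmf W)"
    and P_ge: "\<And>v. v \<in> V \<Longrightarrow> ennreal (1 / (2 * c)) \<le> (\<Sum>u\<in>V - {v}. P u)"
    and P_le: "(\<Sum>u\<in>V. P u) \<le> ennreal N" and N: "N \<ge> 0"
begin

abbreviation EW :: "(weights \<Rightarrow> ennreal) \<Rightarrow> ennreal" where
  "EW f \<equiv> (\<integral>\<^sup>+w. f w \<partial>measure_pmf W)"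

abbreviation cc :: ennreal where "cc \<equiv> ennreal c"

lemma EW_mono: "(\<And>w. w \<in> set_pmf W \<Longrightarrow> f w \<le> g w) \<Longrightarrow> EW f \<le> EW g"
  by (intro nn_integral_mono_AE AE_pmfI) blast

lemma EW_cong: "(\<And>w. w \<in> set_pmf W \<Longrightarrow> f w = g w) \<Longrightarrow> EW f = EW g"
  by (intro nn_integral_cong_AE AE_pmfI) blast

lemma EW_add: "EW (\<lambda>w. f w + g w) = EW f + EW g"
  by (rule nn_integral_add) auto

lemma EW_cmult: "EW (\<lambda>w. k * f w) = k * EW f"
  by (rule nn_integral_cmult) auto

lemma EW_sum: "EW (\<lambda>w. \<Sum>x\<in>A. f x w) = (\<Sum>x\<in>A. EW (f x))"
  by (rule nn_integral_sum) auto

definition VI :: "weights \<Rightarrow> node set" where "VI w = positive_nodes V (wI w)"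
definition VS :: "weights \<Rightarrow> node set" where "VS w = positive_nodes V (wS w)"
definition pres :: "weights \<Rightarrow> node set" where "pres w = positive_nodes V (tot w)"

text \<open>With too few present nodes \<open>top1\<close> and \<open>top2\<close> are unspecified
  values of \<open>hd []\<close>. Statements about them are guarded by
  \<open>pres w \<noteq> {}\<close>, by \<open>two w\<close> or, for \<open>top1\<close>, by
  membership in \<open>VI w\<close> or \<open>VS w\<close>.\<close>

definition top1 :: "weights \<Rightarrow> node" where "top1 w = v_max tb (pres w) (tot w)"
definition top2 :: "weights \<Rightarrow> node" where "top2 w = v_max tb (pres w - {top1 w}) (tot w)"
definition z1 :: "weights \<Rightarrow> nat" where "z1 w = tot w (top1 w)"
definition z2 :: "weights \<Rightarrow> nat" where "z2 w = tot w (top2 w)"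
definition two :: "weights \<Rightarrow> bool" where "two w \<longleftrightarrow> card (pres w) \<ge> 2"

lemma flip_invariant [simp]:
  "pres (flip v w) = pres w" "top1 (flip v w) = top1 w" "top2 (flip v w) = top2 w"
  "z1 (flip v w) = z1 w" "z2 (flip v w) = z2 w" "two (flip v w) = two w"
  by (simp_all add: pres_def top1_def top2_def z1_def z2_def two_def)

lemma sub [simp]: "VI w \<subseteq> V" "VS w \<subseteq> V" "pres w \<subseteq> V"
  by (simp_all add: VI_def VS_def pres_def positive_nodes_subset)

lemma finite_sets [simp]: "finite (VI w)" "finite (VS w)" "finite (pres w)"
  by (rule finite_subset[OF _ fin], simp)+

lemma pres_eq: "pres w = VI w \<union> VS w"
  by (auto simp: pres_def VI_def VS_def positive_nodes_def tot_def)

lemma mem_VI: "v \<in> V \<Longrightarrow> v \<in> VI w \<longleftrightarrow> wI w v > 0"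
  and mem_VS: "v \<in> V \<Longrightarrow> v \<in> VS w \<longleftrightarrow> wS w v > 0"
  by (simp_all add: VI_def VS_def positive_nodes_def)

lemma mem_VI_flip: "u \<in> VI (flip v w) \<longleftrightarrow> (if u = v then v \<in> VS w else u \<in> VI w)"
  and mem_VS_flip: "u \<in> VS (flip v w) \<longleftrightarrow> (if u = v then v \<in> VI w else u \<in> VS w)"
  by (auto simp: VI_def VS_def positive_nodes_def wI_flip wS_flip)

lemma VI_VS_disjoint: "w \<in> set_pmf W \<Longrightarrow> v \<in> VI w \<Longrightarrow> v \<notin> VS w"
  using exclusive[of w v] by (auto simp: VI_def VS_def positive_nodes_def)

lemma top1_props:
  assumes "pres w \<noteq> {}"
  shows "top1 w \<in> pres w" "\<And>u. u \<in> pres w \<Longrightarrow> tot w u \<le> z1 w"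
  using v_max_props[OF tb _ assms fin, where s = "tot w"] by (auto simp: top1_def z1_def)

lemma top2_props:
  assumes "two w"
  shows "top2 w \<in> pres w" "top2 w \<noteq> top1 w" "\<And>u. u \<in> pres w \<Longrightarrow> u \<noteq> top1 w \<Longrightarrow> tot w u \<le> z2 w"
    "pres w \<noteq> {}"
proof -
  show ne: "pres w \<noteq> {}" using assms by (auto simp: two_def)
  have "card (pres w - {top1 w}) \<ge> 1"
    using assms top1_props(1)[OF ne] by (simp add: two_def)
  then have ne': "pres w - {top1 w} \<noteq> {}" by (metis card.empty not_one_le_zero)
  have "pres w - {top1 w} \<subseteq> V" using sub(3)[of w] by blast
  from v_max_props[OF tb this ne' fin, where s = "tot w"]
  show "top2 w \<in> pres w" "top2 w \<noteq> top1 w" "\<And>u. u \<in> pres w \<Longrightarrow> u \<noteq> top1 w \<Longrightarrow> tot w u \<le> z2 w"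
    by (auto simp: top2_def z2_def)
qed

text \<open>Split by the value \<open>u\<close> of the selected node and exchange the weights of
  \<open>u\<close>. Since \<open>sel\<close> is invariant under \<open>flip\<close>, the exchanged
  outcome selects the same \<open>u\<close>, and the pieces reassemble without overlap.\<close>

lemma sel_IS:
  assumes "\<And>v w. sel (flip v w) = sel w"
  shows "EW (\<lambda>w. of_bool (sel w \<in> VI w) * H w) \<le> cc * EW (\<lambda>w. of_bool (sel w \<in> VS w) * H (flip (sel w) w))"
proof -
  have "EW (\<lambda>w. of_bool (sel w \<in> VI w) * H w) =
    EW (\<lambda>w. \<Sum>u\<in>V. of_bool (wI w u > 0) * (of_bool (sel w = u) * H w))"
    by (simp add: sum_of_bool_delta[OF fin] VI_def positive_nodes_def)
  also have "\<dots> \<le> (\<Sum>u\<in>V. cc * EW (\<lambda>w. of_bool (wS w u > 0) * (of_bool (sel (flip u w) = u) * H (flip u w))))"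
    unfolding EW_sum by (intro sum_mono exchange_IS)
  also have "\<dots> = cc * EW (\<lambda>w. \<Sum>u\<in>V. of_bool (wS w u > 0) * (of_bool (sel w = u) * H (flip u w)))"
    unfolding EW_sum sum_distrib_left assms by (rule refl)
  also have "EW (\<lambda>w. \<Sum>u\<in>V. of_bool (wS w u > 0) * (of_bool (sel w = u) * H (flip u w))) =
    EW (\<lambda>w. of_bool (sel w \<in> VS w) * H (flip (sel w) w))"
    by (simp add: sum_of_bool_delta[OF fin] VS_def positive_nodes_def)
  finally show ?thesis .
qed

lemma sel_SI:
  assumes "\<And>v w. sel (flip v w) = sel w"
  shows "EW (\<lambda>w. of_bool (sel w \<in> VS w) * H w) \<le> cc * EW (\<lambda>w. of_bool (sel w \<in> VI w) * H (flip (sel w) w))"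
proof -
  have "EW (\<lambda>w. of_bool (sel w \<in> VS w) * H w) =
    EW (\<lambda>w. \<Sum>u\<in>V. of_bool (wS w u > 0) * (of_bool (sel w = u) * H w))"
    by (simp add: sum_of_bool_delta[OF fin] VS_def positive_nodes_def)
  also have "\<dots> \<le> (\<Sum>u\<in>V. cc * EW (\<lambda>w. of_bool (wI w u > 0) * (of_bool (sel (flip u w) = u) * H (flip u w))))"
    unfolding EW_sum by (intro sum_mono exchange_SI)
  also have "\<dots> = cc * EW (\<lambda>w. \<Sum>u\<in>V. of_bool (wI w u > 0) * (of_bool (sel w = u) * H (flip u w)))"
    unfolding EW_sum sum_distrib_left assms by (rule refl)
  also have "EW (\<lambda>w. \<Sum>u\<in>V. of_bool (wI w u > 0) * (of_bool (sel w = u) * H (flip u w))) =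
    EW (\<lambda>w. of_bool (sel w \<in> VI w) * H (flip (sel w) w))"
    by (simp add: sum_of_bool_delta[OF fin] VI_def positive_nodes_def)
  finally show ?thesis .
qed

text \<open>A present node is sampled or arrives. The part with the unwanted role is exchanged at
  cost \<open>c\<close>, whence \<open>1 + c\<close> for prescribing the role.\<close>

lemma sel_pres_le:
  assumes sel: "\<And>v w. sel (flip v w) = sel w" and G: "\<And>w. G (flip (sel w) w) = G w"
  shows "EW (\<lambda>w. of_bool (sel w \<in> pres w) * G w) \<le> (1 + cc) * EW (\<lambda>w. of_bool (sel w \<in> VS w) * G w)"
    and "EW (\<lambda>w. of_bool (sel w \<in> pres w) * G w) \<le> (1 + cc) * EW (\<lambda>w. of_bool (sel w \<in> VI w) * G w)"
proof -
  have le: "EW (\<lambda>w. of_bool (sel w \<in> pres w) * G w) \<le>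
    EW (\<lambda>w. of_bool (sel w \<in> VS w) * G w) + EW (\<lambda>w. of_bool (sel w \<in> VI w) * G w)"
    unfolding EW_add[symmetric] by (intro EW_mono) (auto simp: pres_eq)
  show "EW (\<lambda>w. of_bool (sel w \<in> pres w) * G w) \<le> (1 + cc) * EW (\<lambda>w. of_bool (sel w \<in> VS w) * G w)"
    using order_trans[OF le add_left_mono[OF sel_IS[OF sel, of G]]] by (simp add: G distrib_right)
  show "EW (\<lambda>w. of_bool (sel w \<in> pres w) * G w) \<le> (1 + cc) * EW (\<lambda>w. of_bool (sel w \<in> VI w) * G w)"
    using order_trans[OF le add_right_mono[OF sel_SI[OF sel, of G]]] by (simp add: G distrib_right add.commute)
qed

text \<open>The role of \<open>top1\<close> is prescribed first, then that of \<open>top2\<close>.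
  The two nodes differ, so the second exchange respects the first choice.\<close>

lemma two_IS_le:
  assumes F: "\<And>v w. F (flip v w) = F w"
  shows "EW (\<lambda>w. of_bool (two w) * F w) \<le>
    (1 + cc) * ((1 + cc) * EW (\<lambda>w. of_bool (two w \<and> top1 w \<in> VI w \<and> top2 w \<in> VS w) * F w))"
proof -
  have "EW (\<lambda>w. of_bool (two w) * F w) = EW (\<lambda>w. of_bool (top1 w \<in> pres w) * (of_bool (two w) * F w))"
    using top1_props(1) top2_props(4) by (intro EW_cong) auto
  also have "\<dots> \<le> (1 + cc) * EW (\<lambda>w. of_bool (top1 w \<in> VI w) * (of_bool (two w) * F w))"
    by (intro sel_pres_le) (simp_all add: F)
  also have "EW (\<lambda>w. of_bool (top1 w \<in> VI w) * (of_bool (two w) * F w)) =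
    EW (\<lambda>w. of_bool (top2 w \<in> pres w) * (of_bool (two w \<and> top1 w \<in> VI w) * F w))"
    using top2_props(1) by (intro EW_cong) auto
  also have "\<dots> \<le> (1 + cc) * EW (\<lambda>w. of_bool (top2 w \<in> VS w) * (of_bool (two w \<and> top1 w \<in> VI w) * F w))"
  proof (rule sel_pres_le)
    fix w
    show "of_bool (two (flip (top2 w) w) \<and> top1 (flip (top2 w) w) \<in> VI (flip (top2 w) w)) * F (flip (top2 w) w) =
      of_bool (two w \<and> top1 w \<in> VI w) * F w"
      using top2_props(2)[of w] by (cases "two w") (auto simp: F mem_VI_flip)
  qed simp
  also have "EW (\<lambda>w. of_bool (top2 w \<in> VS w) * (of_bool (two w \<and> top1 w \<in> VI w) * F w)) =
    EW (\<lambda>w. of_bool (two w \<and> top1 w \<in> VI w \<and> top2 w \<in> VS w) * F w)"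
    by (intro EW_cong) auto
  finally show ?thesis by (simp add: mult_left_mono)
qed

lemma two_SI_le:
  assumes F: "\<And>v w. F (flip v w) = F w"
  shows "EW (\<lambda>w. of_bool (two w) * F w) \<le>
    (1 + cc) * ((1 + cc) * EW (\<lambda>w. of_bool (two w \<and> top1 w \<in> VS w \<and> top2 w \<in> VI w) * F w))"
proof -
  have "EW (\<lambda>w. of_bool (two w) * F w) = EW (\<lambda>w. of_bool (top1 w \<in> pres w) * (of_bool (two w) * F w))"
    using top1_props(1) top2_props(4) by (intro EW_cong) auto
  also have "\<dots> \<le> (1 + cc) * EW (\<lambda>w. of_bool (top1 w \<in> VS w) * (of_bool (two w) * F w))"
    by (intro sel_pres_le) (simp_all add: F)
  also have "EW (\<lambda>w. of_bool (top1 w \<in> VS w) * (of_bool (two w) * F w)) =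
    EW (\<lambda>w. of_bool (top2 w \<in> pres w) * (of_bool (two w \<and> top1 w \<in> VS w) * F w))"
    using top2_props(1) by (intro EW_cong) auto
  also have "\<dots> \<le> (1 + cc) * EW (\<lambda>w. of_bool (top2 w \<in> VI w) * (of_bool (two w \<and> top1 w \<in> VS w) * F w))"
  proof (rule sel_pres_le)
    fix w
    show "of_bool (two (flip (top2 w) w) \<and> top1 (flip (top2 w) w) \<in> VS (flip (top2 w) w)) * F (flip (top2 w) w) =
      of_bool (two w \<and> top1 w \<in> VS w) * F w"
      using top2_props(2)[of w] by (cases "two w") (auto simp: F mem_VS_flip)
  qed simp
  also have "EW (\<lambda>w. of_bool (top2 w \<in> VI w) * (of_bool (two w \<and> top1 w \<in> VS w) * F w)) =
    EW (\<lambda>w. of_bool (two w \<and> top1 w \<in> VS w \<and> top2 w \<in> VI w) * F w)"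
    by (intro EW_cong) auto
  finally show ?thesis by (simp add: mult_left_mono)
qed

end

section \<open>Isolating the part of the optimum that the algorithm collects\<close>

lemma ennreal_mult_divide_of_nat: "0 < k \<Longrightarrow> of_nat k * (x / of_nat k) = (x :: ennreal)"
  by (simp add: ennreal_times_divide mult.commute[of "of_nat k"] ennreal_mult_divide_eq)

lemma ennreal_le_double: "x \<le> 2 * (x :: ennreal)"
  by (simp add: mult_2 add_increasing)

text \<open>Collects the estimates of \<open>opt_le_Q\<close>: with \<open>Z\<close> the mean of
  \<open>z1\<close> on the event \<open>two\<close>, the optimum is at most
  \<open>(1 + c) * (EW Q + c * Z) + (4 * c + 1) * Z\<close>, and \<open>Z\<close> is at most
  \<open>2 * (1 + c)^2 * EW Q\<close>.\<close>

definition C1 :: "real \<Rightarrow> real" where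
  "C1 c = (1 + c) + ((1 + c) * c + (4 * c + 1)) * (2 * (1 + c)\<^sup>2)"

lemma C1_ge_1: "0 \<le> c \<Longrightarrow> 1 \<le> C1 c"
  unfolding C1_def by (simp add: add_increasing2)

context split_model
begin

lemma VS_flip_S: "w \<in> set_pmf W \<Longrightarrow> v \<in> VS w \<Longrightarrow> VS (flip v w) = VS w - {v}"
  using VI_VS_disjoint[of w v] by (auto simp: mem_VS_flip split: if_splits)

lemma VS_flip_I: "v \<in> VI w \<Longrightarrow> VS (flip v w) = insert v (VS w)"
  by (auto simp: mem_VS_flip split: if_splits)

lemma opt_le_flip_top:
  assumes "top1 w \<in> VI w"
  shows "opt V E w \<le> opt V E (flip (top1 w) w) + z1 w"
proof -
  obtain T where T: "T \<subseteq> V" "independent_set E T" "opt V E w = (\<Sum>v\<in>T. wI w v)"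
    using opt_attained[OF fin] .
  have finT: "finite T" using T(1) fin finite_subset by blast
  have "(\<Sum>v\<in>T. wI w v) \<le> (\<Sum>v\<in>insert (top1 w) (T - {top1 w}). wI w v)"
    using finT by (intro sum_mono2) auto
  also have "\<dots> = wI w (top1 w) + (\<Sum>v\<in>T - {top1 w}. wI (flip (top1 w) w) v)"
    using finT by (subst sum.insert) (auto simp: wI_flip)
  also have "\<dots> \<le> z1 w + opt V E (flip (top1 w) w)"
    using T by (intro add_mono opt_ge fin) (auto simp: z1_def tot_def independent_set_def)
  finally show ?thesis using T(3) by simp
qed

lemma opt_eq_0: "pres w = {} \<Longrightarrow> opt V E w = 0"
proof -
  assume "pres w = {}"
  then have "wI w v = 0" if "v \<in> V" for v
    using that by (auto simp: pres_def positive_nodes_def tot_def)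
  then show ?thesis using opt_attained[OF fin, of E w]
    by (metis (no_types, lifting) subset_iff sum.neutral)
qed

text \<open>If \<open>top1\<close> arrives, discarding it costs at most \<open>z1\<close> and leaves
  the optimum of the outcome in which \<open>top1\<close> is sampled instead; \<open>sel_IS\<close>
  charges that to the first term.\<close>

lemma opt_top_le:
  "EW (\<lambda>w. of_nat (opt V E w)) \<le> (1 + cc) * EW (\<lambda>w. of_bool (top1 w \<in> VS w) * of_nat (opt V E w))
    + EW (\<lambda>w. of_bool (pres w \<noteq> {}) * of_nat (z1 w))"
proof -
  have "EW (\<lambda>w. of_nat (opt V E w)) \<le> EW (\<lambda>w. of_bool (top1 w \<in> VS w) * of_nat (opt V E w)
      + (of_bool (top1 w \<in> VI w) * of_nat (opt V E (flip (top1 w) w))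
      + of_bool (pres w \<noteq> {}) * of_nat (z1 w)))"
  proof (rule EW_mono)
    fix w assume "w \<in> set_pmf W"
    show "of_nat (opt V E w) \<le> (of_bool (top1 w \<in> VS w) * of_nat (opt V E w)
      + (of_bool (top1 w \<in> VI w) * of_nat (opt V E (flip (top1 w) w))
      + of_bool (pres w \<noteq> {}) * of_nat (z1 w)) :: ennreal)"
    proof (cases "top1 w \<in> VS w \<or> pres w = {}")
      case True
      then show ?thesis using opt_eq_0[of w] by auto
    next
      case False
      then have I: "top1 w \<in> VI w" using top1_props(1)[of w] by (auto simp: pres_eq)
      have "(of_nat (opt V E w) :: ennreal) \<le> of_nat (opt V E (flip (top1 w) w) + z1 w)"
        by (rule of_nat_mono[OF opt_le_flip_top[OF I]])
      then show ?thesis using False I by simp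
    qed
  qed
  also have "\<dots> = EW (\<lambda>w. of_bool (top1 w \<in> VS w) * of_nat (opt V E w))
      + (EW (\<lambda>w. of_bool (top1 w \<in> VI w) * of_nat (opt V E (flip (top1 w) w)))
      + EW (\<lambda>w. of_bool (pres w \<noteq> {}) * of_nat (z1 w)))"
    unfolding EW_add by (rule refl)
  also have "EW (\<lambda>w. of_bool (top1 w \<in> VI w) * of_nat (opt V E (flip (top1 w) w))) \<le>
    cc * EW (\<lambda>w. of_bool (top1 w \<in> VS w) * of_nat (opt V E w))"
    using sel_IS[of top1 "\<lambda>w. of_nat (opt V E (flip (top1 w) w))"] by simp
  finally show ?thesis by (simp add: distrib_right add_mono add.assoc)
qed

text \<open>With a single present node the algorithm earns nothing, so this mass is charged to
  outcomes with two present nodes. By \<open>P_ge\<close> the expected number of sampled nodes other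
  than \<open>v\<close> is at least \<open>1 / (2 * c)\<close>, and adding a sampled
  \<open>u\<close> to the outcome \<open>{v}\<close> gives \<open>{u, v}\<close>. Each pair is
  reached from at most two sides, whence \<open>4 * c\<close>.\<close>

lemma single_le:
  "EW (\<lambda>w. of_bool (card (pres w) = 1) * of_nat (z1 w)) \<le> 4 * cc * EW (\<lambda>w. of_bool (two w) * of_nat (z1 w))"
proof -
  define L where "L v = EW (\<lambda>w. of_bool (pres w = {v}) * of_nat (tot w v))" for v
  \<comment> \<open>\<open>G v u\<close> reads nothing at \<open>u\<close>, so \<open>indep\<close>
    applies to it, and it dominates the integrand of \<open>L v\<close> for every
    \<open>u \<noteq> v\<close>.\<close>
  define G where "G v u w = (of_bool (pres w - {u} = {v}) * of_nat (tot w v) :: ennreal)" for v u w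
  have L_le: "L v \<le> 2 * cc * (\<Sum>u\<in>V - {v}. EW (\<lambda>w. of_bool (wS w u > 0) * G v u w))" if v: "v \<in> V" for v
  proof -
    have "ennreal (1 / (2 * c)) * L v \<le> (\<Sum>u\<in>V - {v}. P u) * L v"
      by (intro mult_right_mono P_ge v) simp
    also have "\<dots> = (\<Sum>u\<in>V - {v}. P u * L v)" by (simp add: sum_distrib_right)
    also have "\<dots> \<le> (\<Sum>u\<in>V - {v}. P u * EW (G v u))"
      unfolding L_def G_def by (intro sum_mono mult_left_mono EW_mono) auto
    also have "\<dots> = (\<Sum>u\<in>V - {v}. EW (\<lambda>w. of_bool (wS w u > 0) * G v u w))"
    proof (intro sum.cong refl indep[symmetric])
      fix u w x assume u: "u \<in> V - {v}"
      have "pres (w(u := x)) - {u} = pres w - {u}"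
        by (auto simp: pres_def positive_nodes_def tot_def wI_def wS_def)
      moreover have "tot (w(u := x)) v = tot w v" using u by (simp add: tot_def wI_def wS_def)
      ultimately show "G v u (w(u := x)) = G v u w" by (simp add: G_def)
    qed auto
    finally have "2 * cc * (ennreal (1 / (2 * c)) * L v) \<le>
      2 * cc * (\<Sum>u\<in>V - {v}. EW (\<lambda>w. of_bool (wS w u > 0) * G v u w))"
      by (rule mult_left_mono) simp
    moreover have "2 * cc * (ennreal (1 / (2 * c)) * L v) = L v"
    proof -
      have "2 * cc = ennreal (2 * c)" using c by (simp add: ennreal_mult)
      moreover have "ennreal (2 * c) * ennreal (1 / (2 * c)) = 1"
        using c by (subst ennreal_mult[symmetric]) auto
      ultimately have "2 * cc * ennreal (1 / (2 * c)) = 1" by simp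
      then show ?thesis by (simp add: mult.assoc[symmetric])
    qed
    ultimately show ?thesis by simp
  qed
  have "EW (\<lambda>w. of_bool (card (pres w) = 1) * of_nat (z1 w)) \<le> (\<Sum>v\<in>V. L v)"
    unfolding L_def EW_sum[symmetric]
  proof (rule EW_mono)
    fix w
    show "of_bool (card (pres w) = 1) * of_nat (z1 w) \<le> (\<Sum>v\<in>V. of_bool (pres w = {v}) * of_nat (tot w v) :: ennreal)"
    proof (cases "card (pres w) = 1")
      case True
      then obtain x where x: "pres w = {x}" using card_1_singletonE by blast
      then have "top1 w = x" using top1_props(1)[of w] by simp
      then have "of_nat (z1 w) = (of_bool (pres w = {x}) * of_nat (tot w x) :: ennreal)"
        using x by (simp add: z1_def)
      also have "\<dots> \<le> (\<Sum>v\<in>V. of_bool (pres w = {v}) * of_nat (tot w v))"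
        using sub(3)[of w] x fin by (intro member_le_sum) auto
      finally show ?thesis using True by simp
    qed simp
  qed
  also have "\<dots> \<le> (\<Sum>v\<in>V. 2 * cc * (\<Sum>u\<in>V - {v}. EW (\<lambda>w. of_bool (wS w u > 0) * G v u w)))"
    by (intro sum_mono L_le)
  also have "\<dots> = 2 * cc * EW (\<lambda>w. \<Sum>v\<in>V. \<Sum>u\<in>V - {v}. of_bool (wS w u > 0) * G v u w)"
    unfolding EW_sum sum_distrib_left by (rule refl)
  also have "EW (\<lambda>w. \<Sum>v\<in>V. \<Sum>u\<in>V - {v}. of_bool (wS w u > 0) * G v u w)
    \<le> EW (\<lambda>w. 2 * (of_bool (two w) * of_nat (z1 w)))"
  proof (rule EW_mono)
    fix w
    let ?t = "\<lambda>v u. of_bool (wS w u > 0) * G v u w"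
    show "(\<Sum>v\<in>V. \<Sum>u\<in>V - {v}. ?t v u) \<le> 2 * (of_bool (two w) * of_nat (z1 w))"
    proof (cases "card (pres w) = 2")
      case False
      have "?t v u = 0" if "v \<in> V" "u \<in> V - {v}" for v u
      proof (rule ccontr)
        assume "?t v u \<noteq> 0"
        then have "wS w u > 0" "pres w - {u} = {v}" by (auto simp: G_def)
        moreover have "u \<in> pres w" using that \<open>wS w u > 0\<close> by (simp add: pres_def positive_nodes_def tot_def)
        ultimately have "pres w = {u, v}" by blast
        then show False using False that by auto
      qed
      then have "(\<Sum>v\<in>V. \<Sum>u\<in>V - {v}. ?t v u) = 0" by (intro sum.neutral ballI) blast
      then show ?thesis by (simp only: zero_le)
    next
      case True
      then have tw: "two w" by (simp add: two_def)
      have "(\<Sum>u\<in>V - {v}. ?t v u) \<le> of_bool (v \<in> pres w) * of_nat (z1 w)" for v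
      proof -
        have "(\<Sum>u\<in>V - {v}. ?t v u) \<le> (\<Sum>u\<in>V - {v}. of_bool (u \<in> pres w) * (of_bool (v \<in> pres w) * of_nat (z1 w)))"
        proof (intro sum_mono)
          fix u assume u: "u \<in> V - {v}"
          show "?t v u \<le> of_bool (u \<in> pres w) * (of_bool (v \<in> pres w) * of_nat (z1 w))"
          proof (cases "wS w u > 0 \<and> pres w - {u} = {v}")
            case True
            then have "u \<in> pres w" using u by (simp add: pres_def positive_nodes_def tot_def)
            moreover have v: "v \<in> pres w" using True by blast
            moreover have "tot w v \<le> z1 w" using v by (intro top1_props(2)) auto
            ultimately show ?thesis using True by (simp add: G_def)
          next
            case False
            then have "?t v u = 0" by (cases "wS w u > 0") (simp_all add: G_def)
            then show ?thesis by (simp only: zero_le)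
          qed
        qed
        also have "\<dots> = (\<Sum>u\<in>V - {v}. of_bool (u \<in> pres w)) * (of_bool (v \<in> pres w) * of_nat (z1 w))"
          by (simp only: sum_distrib_right)
        also have "(\<Sum>u\<in>V - {v}. of_bool (u \<in> pres w)) = (of_nat (card (pres w - {v})) :: ennreal)"
        proof -
          have "(V - {v}) \<inter> {u. u \<in> pres w} = pres w - {v}" using sub(3)[of w] by blast
          then show ?thesis using fin by simp
        qed
        finally show ?thesis using True by (cases "v \<in> pres w") auto
      qed
      then have "(\<Sum>v\<in>V. \<Sum>u\<in>V - {v}. ?t v u) \<le> (\<Sum>v\<in>V. of_bool (v \<in> pres w) * of_nat (z1 w))"
        by (intro sum_mono) blast
      also have "\<dots> = (\<Sum>v\<in>V. of_bool (v \<in> pres w)) * of_nat (z1 w)"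
        by (simp only: sum_distrib_right)
      also have "(\<Sum>v\<in>V. of_bool (v \<in> pres w)) = (2 :: ennreal)"
        using ennreal_of_nat_sum_bool[OF fin sub(3), of w] True by simp
      finally show ?thesis using tw by simp
    qed
  qed
  also have "\<dots> = 2 * EW (\<lambda>w. of_bool (two w) * of_nat (z1 w))" by (rule EW_cmult)
  finally have "EW (\<lambda>w. of_bool (card (pres w) = 1) * of_nat (z1 w)) \<le>
    2 * cc * (2 * EW (\<lambda>w. of_bool (two w) * of_nat (z1 w)))"
    by (simp add: mult_left_mono)
  also have "\<dots> = (2 * 2) * cc * EW (\<lambda>w. of_bool (two w) * of_nat (z1 w))" by (simp only: mult_ac)
  finally show ?thesis by simp
qed

text \<open>Erases arrivals lighter than \<open>z1 / (2 * card VS)\<close>. The dyadic classes of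
  the others, counted down from \<open>z1\<close>, satisfy \<open>2 ^ k < 4 * card VS\<close> by
  \<open>dyadic_level\<close>, and for a nonempty sample these lie in the range of
  \<open>X\<close>.\<close>

definition cut :: "weights \<Rightarrow> weights" where
  "cut w v = (if z1 w \<le> 2 * card (VS w) * wI w v then wI w v else 0, 0)"

lemma wI_cut: "wI (cut w) v = (if z1 w \<le> 2 * card (VS w) * wI w v then wI w v else 0)"
  by (simp add: wI_def cut_def)

definition lev :: "weights \<Rightarrow> nat" where "lev w = opt V E (cut w)"

lemma lev_le_opt: "lev w \<le> opt V E w"
  unfolding lev_def by (rule opt_mono[OF fin]) (simp add: wI_cut)

lemma opt_le_lev_low:
  assumes "VS w \<noteq> {}"
  shows "(of_nat (opt V E w) :: ennreal) \<le> of_nat (lev w) + (\<Sum>v\<in>VI w. of_nat (z1 w) / of_nat (card (VS w)))"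
proof -
  obtain T where T: "T \<subseteq> V" "independent_set E T" "opt V E w = (\<Sum>v\<in>T. wI w v)"
    using opt_attained[OF fin] .
  have finT: "finite T" using T(1) fin finite_subset by blast
  define low where "low = {v \<in> T. v \<in> VI w \<and> z1 w > 2 * card (VS w) * wI w v}"
  have s: "card (VS w) > 0" using assms by (simp add: card_gt_0_iff)
  have "(\<Sum>v\<in>T. wI w v) \<le> (\<Sum>v\<in>T. wI (cut w) v + (if v \<in> low then wI w v else 0))"
    using T(1) by (intro sum_mono) (auto simp: wI_cut low_def mem_VI)
  also have "\<dots> = (\<Sum>v\<in>T. wI (cut w) v) + (\<Sum>v\<in>low. wI w v)"
  proof -
    have "low \<subseteq> T" by (auto simp: low_def)
    then show ?thesis using finT by (simp add: sum.distrib sum.If_cases Int_absorb1)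
  qed
  also have "\<dots> \<le> lev w + (\<Sum>v\<in>low. wI w v)"
    unfolding lev_def by (intro add_right_mono opt_ge fin T)
  finally have "(of_nat (opt V E w) :: ennreal) \<le> of_nat (lev w + (\<Sum>v\<in>low. wI w v))"
    unfolding T(3) by (rule of_nat_mono)
  also have "\<dots> = of_nat (lev w) + (\<Sum>v\<in>low. of_nat (wI w v))" by simp
  also have "(\<Sum>v\<in>low. of_nat (wI w v)) \<le> (\<Sum>v\<in>low. of_nat (z1 w) / of_nat (card (VS w)) :: ennreal)"
  proof (intro sum_mono)
    fix v assume "v \<in> low"
    then have "2 * (card (VS w) * wI w v) < z1 w" by (simp add: low_def mult.assoc)
    then have "card (VS w) * wI w v \<le> z1 w" by linarith
    then have "real (wI w v) \<le> real (z1 w) / real (card (VS w))"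
      using s by (simp add: field_simps flip: of_nat_mult)
    then show "of_nat (wI w v) \<le> (of_nat (z1 w) / of_nat (card (VS w)) :: ennreal)"
      using s by (simp add: ennreal_of_nat_eq_real_of_nat divide_ennreal ennreal_leI)
  qed
  \<comment> \<open>Charging every arrival, not only the light ones in the optimum, removes the
    dependence on \<open>T\<close> and makes the error accessible to exchanges.\<close>
  also have "\<dots> \<le> (\<Sum>v\<in>VI w. of_nat (z1 w) / of_nat (card (VS w)))"
    by (intro sum_mono2) (auto simp: low_def)
  finally show ?thesis by (simp add: add_left_mono)
qed

text \<open>Exchanging each arrival \<open>v\<close> into the sample leaves one term for each
  sampled \<open>v \<noteq> top1\<close>. Seen from the exchanged outcome, the divisor is the sample
  size without \<open>v\<close>, which is also the number of terms. So the sum collapses to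
  \<open>z1\<close>, and it has terms only if two nodes are present.\<close>

lemma low_le:
  "EW (\<lambda>w. of_bool (top1 w \<in> VS w) * (\<Sum>v\<in>VI w. of_nat (z1 w) / of_nat (card (VS w)))) \<le>
    cc * EW (\<lambda>w. of_bool (two w) * of_nat (z1 w))"
proof -
  let ?d = "\<lambda>w. of_bool (top1 w \<in> VS w) * (of_nat (z1 w) / of_nat (card (VS w))) :: ennreal"
  have "EW (\<lambda>w. of_bool (top1 w \<in> VS w) * (\<Sum>v\<in>VI w. of_nat (z1 w) / of_nat (card (VS w)))) =
    EW (\<lambda>w. \<Sum>v\<in>V. of_bool (wI w v > 0) * ?d w)"
  proof (rule EW_cong)
    fix w
    have "(\<Sum>v\<in>V. of_bool (wI w v > 0) * ?d w) = (\<Sum>v\<in>VI w. ?d w)"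
      using fin by (intro sum.mono_neutral_cong_right) (auto simp: VI_def positive_nodes_def)
    then show "of_bool (top1 w \<in> VS w) * (\<Sum>v\<in>VI w. of_nat (z1 w) / of_nat (card (VS w))) =
      (\<Sum>v\<in>V. of_bool (wI w v > 0) * ?d w)" by (simp add: mult_ac)
  qed
  also have "\<dots> \<le> (\<Sum>v\<in>V. cc * EW (\<lambda>w. of_bool (wS w v > 0) * ?d (flip v w)))"
    unfolding EW_sum by (intro sum_mono exchange_IS)
  also have "\<dots> = cc * EW (\<lambda>w. \<Sum>v\<in>V. of_bool (wS w v > 0) * ?d (flip v w))"
    by (simp only: EW_sum sum_distrib_left)
  also have "EW (\<lambda>w. \<Sum>v\<in>V. of_bool (wS w v > 0) * ?d (flip v w)) \<le> EW (\<lambda>w. of_bool (two w) * of_nat (z1 w))"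
  proof (rule EW_mono)
    fix w assume w: "w \<in> set_pmf W"
    let ?A = "VS w - {top1 w}"
    have eq: "of_bool (wS w v > 0) * ?d (flip v w) =
      of_bool (v \<in> ?A \<and> top1 w \<in> VS w) * (of_nat (z1 w) / of_nat (card ?A))" if v: "v \<in> V" for v
    proof (cases "wS w v > 0")
      case True
      then have "v \<in> VS w" using v by (simp add: mem_VS)
      note S = VS_flip_S[OF w this]
      show ?thesis
      \<comment> \<open>For \<open>v = top1 w\<close> the node \<open>top1\<close> arrives in
        \<open>flip v w\<close>, so the indicator in \<open>?d\<close> vanishes.\<close>
      proof (cases "top1 w \<in> VS w \<and> v \<noteq> top1 w")
        case T: True
        then show ?thesis using True \<open>v \<in> VS w\<close> by (simp add: S)
      next
        case False
        then have "top1 w \<notin> VS (flip v w)" "\<not> (v \<in> ?A \<and> top1 w \<in> VS w)" using S by auto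
        then show ?thesis by simp
      qed
    next
      case False
      then have "v \<notin> ?A" using v by (simp add: mem_VS)
      then show ?thesis using False by simp
    qed
    have "(\<Sum>v\<in>V. of_bool (wS w v > 0) * ?d (flip v w)) =
      (\<Sum>v\<in>V. of_bool (v \<in> ?A \<and> top1 w \<in> VS w) * (of_nat (z1 w) / of_nat (card ?A)))"
      by (intro sum.cong refl eq)
    also have "\<dots> = (\<Sum>v\<in>?A. of_bool (top1 w \<in> VS w) * (of_nat (z1 w) / of_nat (card ?A)))"
    proof -
      have "?A \<subseteq> V" using sub(2)[of w] by blast
      then show ?thesis by (intro sum.mono_neutral_cong_right fin) auto
    qed
    also have "\<dots> = of_bool (top1 w \<in> VS w) * (of_nat (card ?A) * (of_nat (z1 w) / of_nat (card ?A)))"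
      by (simp only: sum_constant mult_ac)
    also have "\<dots> \<le> of_bool (two w) * of_nat (z1 w)"
    proof (cases "top1 w \<in> VS w \<and> card ?A > 0")
      case True
      have "card (VS w) = Suc (card ?A)" using True by (intro card.remove) auto
      moreover have "card (VS w) \<le> card (pres w)" by (intro card_mono) (auto simp: pres_eq)
      ultimately have "two w" using True by (simp only: two_def) linarith
      moreover have "of_nat (card ?A) * (of_nat (z1 w) / of_nat (card ?A)) = (of_nat (z1 w) :: ennreal)"
        using True by (intro ennreal_mult_divide_of_nat) blast
      ultimately show ?thesis by (simp only: of_bool_eq mult_1) simp
    next
      case False
      then have "top1 w \<notin> VS w \<or> card ?A = 0" by blast
      then show ?thesis by (elim disjE) (simp_all only: mult_zero_left mult_zero_right of_nat_0 of_bool_eq zero_le)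
    qed
    finally show "(\<Sum>v\<in>V. of_bool (wS w v > 0) * ?d (flip v w)) \<le> of_bool (two w) * of_nat (z1 w)" .
  qed
  finally show ?thesis by (simp add: mult_left_mono)
qed

text \<open>The two events in which the algorithm is successful: the heaviest node is sampled and the
  algorithm collects one of the weight classes below it, or the heaviest node arrives, the second
  heaviest one is sampled, and \<open>X = -1\<close> isolates the former.\<close>

definition Q :: "weights \<Rightarrow> ennreal" where
  "Q w = of_bool (top1 w \<in> VS w) * of_nat (lev w)
    + of_bool (two w \<and> top1 w \<in> VI w \<and> top2 w \<in> VS w \<and> 2 * z2 w \<le> z1 w) * of_nat (z1 w)"

text \<open>If \<open>2 * z2 <= z1\<close>, prescribe that \<open>top1\<close> arrives and
  \<open>top2\<close> is sampled: this is the second term of \<open>Q\<close>. Otherwise prescribe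
  the opposite roles: then the arriving \<open>top2\<close> weighs more than \<open>z1 / 2\<close>,
  survives \<open>cut\<close> and alone makes \<open>lev\<close> at least
  \<open>z1 / 2\<close>.\<close>

lemma z1_two_le: "EW (\<lambda>w. of_bool (two w) * of_nat (z1 w)) \<le> ennreal (2 * (1 + c)\<^sup>2) * EW Q"
proof -
  let ?H = "\<lambda>w. of_bool (2 * z2 w \<le> z1 w) * of_nat (z1 w) :: ennreal"
  let ?L = "\<lambda>w. of_bool (\<not> 2 * z2 w \<le> z1 w) * of_nat (z1 w) :: ennreal"
  let ?h = "\<lambda>w. of_bool (two w \<and> top1 w \<in> VI w \<and> top2 w \<in> VS w) * ?H w"
  let ?l = "\<lambda>w. of_bool (two w \<and> top1 w \<in> VS w \<and> top2 w \<in> VI w) * ?L w"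
  have "EW (\<lambda>w. of_bool (two w) * of_nat (z1 w)) =
    EW (\<lambda>w. of_bool (two w) * ?H w + of_bool (two w) * ?L w)"
    by (intro EW_cong) auto
  also have "\<dots> = EW (\<lambda>w. of_bool (two w) * ?H w) + EW (\<lambda>w. of_bool (two w) * ?L w)"
    by (rule EW_add)
  also have "\<dots> \<le> (1 + cc) * ((1 + cc) * EW ?h) + (1 + cc) * ((1 + cc) * EW ?l)"
    by (intro add_mono two_IS_le two_SI_le) simp_all
  also have "\<dots> = (1 + cc) * ((1 + cc) * EW (\<lambda>w. ?h w + ?l w))"
    by (simp only: EW_add distrib_left)
  also have "EW (\<lambda>w. ?h w + ?l w) \<le> EW (\<lambda>w. 2 * Q w)"
  proof (rule EW_mono)
    fix w assume w: "w \<in> set_pmf W"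
    have "?l w \<le> 2 * (of_bool (top1 w \<in> VS w) * of_nat (lev w))"
    proof (cases "two w \<and> top1 w \<in> VS w \<and> top2 w \<in> VI w \<and> \<not> 2 * z2 w \<le> z1 w")
      case True
      then have S: "card (VS w) \<ge> 1" by (metis Suc_leI card_gt_0_iff empty_iff finite_sets(2) One_nat_def)
      have wS: "wS w (top2 w) = 0" "wI w (top2 w) = z2 w" and V: "top2 w \<in> V"
        using exclusive[OF w, of "top2 w"] True by (auto simp: VI_def positive_nodes_def z2_def tot_def)
      have "z1 w \<le> 2 * z2 w" using True by simp
      also have "\<dots> \<le> 2 * card (VS w) * z2 w" using S by simp
      finally have "wI (cut w) (top2 w) = z2 w" using wS by (simp add: wI_cut)
      moreover have "(\<Sum>v\<in>{top2 w}. wI (cut w) v) \<le> lev w"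
        unfolding lev_def using V no_loop by (intro opt_ge fin) (auto simp: independent_set_def)
      ultimately have "z1 w \<le> 2 * lev w" using \<open>z1 w \<le> 2 * z2 w\<close> by simp
      then have "(of_nat (z1 w) :: ennreal) \<le> of_nat (2 * lev w)" by (rule of_nat_mono)
      then show ?thesis using True by simp
    qed auto
    moreover have "?h w \<le> 2 * (of_bool (two w \<and> top1 w \<in> VI w \<and> top2 w \<in> VS w \<and> 2 * z2 w \<le> z1 w) * of_nat (z1 w))"
      by (cases "two w \<and> top1 w \<in> VI w \<and> top2 w \<in> VS w \<and> 2 * z2 w \<le> z1 w")
        (auto intro: ennreal_le_double)
    ultimately show "?h w + ?l w \<le> 2 * Q w"
      unfolding Q_def distrib_left by (subst add.commute) (rule add_mono)
  qed
  also have "EW (\<lambda>w. 2 * Q w) = 2 * EW Q" by (rule EW_cmult)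
  finally have "EW (\<lambda>w. of_bool (two w) * of_nat (z1 w)) \<le> (1 + cc) * ((1 + cc) * (2 * EW Q))"
    by (simp add: mult_left_mono)
  also have "\<dots> = ennreal (1 + c) * (ennreal (1 + c) * (ennreal 2 * EW Q))"
    using c by (simp add: ennreal_plus)
  also have "\<dots> = ennreal (2 * (1 + c)\<^sup>2) * EW Q"
  proof -
    have eq: "2 * (1 + c)\<^sup>2 = (1 + c) * ((1 + c) * 2)" by (simp add: power2_eq_square)
    have "ennreal ((1 + c) * ((1 + c) * 2)) = ennreal (1 + c) * (ennreal (1 + c) * ennreal 2)"
      using c by (simp only: ennreal_mult add_nonneg_nonneg mult_nonneg_nonneg zero_le_one
          zero_le_numeral order_trans[OF zero_le_one])
    then show ?thesis unfolding eq by (simp only: mult.assoc)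
  qed
  finally show ?thesis .
qed

lemma opt_le_Q: "EW (\<lambda>w. of_nat (opt V E w)) \<le> ennreal (C1 c) * EW Q"
proof -
  define Z where "Z = EW (\<lambda>w. of_bool (two w) * of_nat (z1 w))"
  have S: "EW (\<lambda>w. of_bool (top1 w \<in> VS w) * of_nat (opt V E w)) \<le> EW Q + cc * Z"
  proof -
    have "EW (\<lambda>w. of_bool (top1 w \<in> VS w) * of_nat (opt V E w)) \<le> EW (\<lambda>w. Q w +
      of_bool (top1 w \<in> VS w) * (\<Sum>v\<in>VI w. of_nat (z1 w) / of_nat (card (VS w))))"
    proof (rule EW_mono)
      fix w
      show "of_bool (top1 w \<in> VS w) * of_nat (opt V E w) \<le> Q w +
        of_bool (top1 w \<in> VS w) * (\<Sum>v\<in>VI w. of_nat (z1 w) / of_nat (card (VS w)))"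
      proof (cases "top1 w \<in> VS w")
        case True
        then have "VS w \<noteq> {}" by blast
        from opt_le_lev_low[OF this] have "of_nat (opt V E w) \<le>
          Q w + (\<Sum>v\<in>VI w. of_nat (z1 w) / of_nat (card (VS w)))"
          using True by (elim order_trans) (auto simp: Q_def intro!: add_mono)
        then show ?thesis using True by simp
      qed simp
    qed
    also have "\<dots> \<le> EW Q + cc * Z"
      unfolding EW_add Z_def by (intro add_left_mono low_le)
    finally show ?thesis .
  qed
  have T: "EW (\<lambda>w. of_bool (pres w \<noteq> {}) * of_nat (z1 w)) \<le> (4 * cc + 1) * Z"
  proof -
    have "EW (\<lambda>w. of_bool (pres w \<noteq> {}) * of_nat (z1 w)) \<le>
      EW (\<lambda>w. of_bool (card (pres w) = 1) * of_nat (z1 w) + of_bool (two w) * of_nat (z1 w))"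
    proof (rule EW_mono)
      fix w
      have "pres w = {} \<or> card (pres w) = 1 \<or> two w"
        unfolding two_def using card_0_eq[OF finite_sets(3), of w] by linarith
      then show "of_bool (pres w \<noteq> {}) * of_nat (z1 w) \<le>
        (of_bool (card (pres w) = 1) * of_nat (z1 w) + of_bool (two w) * of_nat (z1 w) :: ennreal)"
        by (elim disjE) simp_all
    qed
    also have "\<dots> \<le> 4 * cc * Z + Z"
      unfolding EW_add Z_def by (intro add_right_mono single_le)
    finally show ?thesis by (simp add: distrib_right)
  qed
  have "EW (\<lambda>w. of_nat (opt V E w)) \<le> (1 + cc) * (EW Q + cc * Z) + (4 * cc + 1) * Z"
    by (rule order_trans[OF opt_top_le]) (intro add_mono mult_left_mono S T zero_le)
  also have "\<dots> = (1 + cc) * EW Q + ((1 + cc) * cc + (4 * cc + 1)) * Z"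
    by (simp add: distrib_left distrib_right mult.assoc add.assoc)
  also have "\<dots> \<le> (1 + cc) * EW Q + ((1 + cc) * cc + (4 * cc + 1)) * (ennreal (2 * (1 + c)\<^sup>2) * EW Q)"
    using z1_two_le by (intro add_left_mono mult_left_mono) (simp_all add: Z_def)
  also have "\<dots> = ((1 + cc) + ((1 + cc) * cc + (4 * cc + 1)) * ennreal (2 * (1 + c)\<^sup>2)) * EW Q"
    by (simp only: distrib_right mult.assoc)
  also have "(1 + cc) + ((1 + cc) * cc + (4 * cc + 1)) * ennreal (2 * (1 + c)\<^sup>2) = ennreal (C1 c)"
  proof -
    have 1: "1 + cc = ennreal (1 + c)" using c by (simp add: ennreal_plus)
    have 2: "4 * cc + 1 = ennreal (4 * c + 1)" using c by (simp add: ennreal_plus ennreal_mult)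
    show ?thesis unfolding 1 2 C1_def using c
      by (simp add: ennreal_mult[symmetric] ennreal_plus[symmetric] del: ennreal_plus)
  qed
  finally show ?thesis .
qed

end

section \<open>Weight classes\<close>

definition rsize :: "real \<Rightarrow> nat \<Rightarrow> nat" where
  "rsize c s = card {-1..\<lceil>log 2 ((c + 2) * real s)\<rceil>}"

lemma card_X_range: "card (X_range c A) = rsize c (card A)"
  by (simp add: X_range_def rsize_def)

lemma X_range_mono:
  assumes "c \<ge> 1" "1 \<le> card A" "card A \<le> card B"
  shows "X_range c A \<subseteq> X_range c B"
proof -
  have "log 2 ((c + 2) * real (card A)) \<le> log 2 ((c + 2) * real (card B))"
    using assms by (intro log_mono mult_left_mono) auto
  then have "\<lceil>log 2 ((c + 2) * real (card A))\<rceil> \<le> \<lceil>log 2 ((c + 2) * real (card B))\<rceil>"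
    by (rule ceiling_mono)
  then show ?thesis by (auto simp: X_range_def)
qed

lemma ceiling_log_ge_1: "c \<ge> 1 \<Longrightarrow> 1 \<le> s \<Longrightarrow> 1 \<le> \<lceil>log 2 ((c + 2) * real s)\<rceil>"
proof -
  assume a: "c \<ge> 1" "1 \<le> s"
  have "3 * 1 \<le> (c + 2) * real s" using a by (intro mult_mono) auto
  then have "log 2 1 < log 2 ((c + 2) * real s)" by (intro log_less) auto
  then show ?thesis by (simp add: one_le_ceiling)
qed

lemma rsize_eq:
  assumes "c \<ge> 1" "1 \<le> s"
  shows "real (rsize c s) = real_of_int \<lceil>log 2 ((c + 2) * real s)\<rceil> + 2"
proof -
  define m where "m = \<lceil>log 2 ((c + 2) * real s)\<rceil>"
  have "1 \<le> m" unfolding m_def by (rule ceiling_log_ge_1[OF assms])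
  then have "real (card {-1..m}) = real_of_int m + 2" by simp
  then show ?thesis by (simp only: rsize_def m_def)
qed

lemma rsize_pos: "c \<ge> 1 \<Longrightarrow> 1 \<le> s \<Longrightarrow> 0 < real (rsize c s)"
  using rsize_eq[of c s] ceiling_log_ge_1[of c s] by linarith

lemma rsize_mono:
  assumes "c \<ge> 1" "1 \<le> s" "s \<le> s'"
  shows "rsize c s \<le> rsize c s'"
proof -
  have "log 2 ((c + 2) * real s) \<le> log 2 ((c + 2) * real s')"
    using assms by (intro log_mono mult_left_mono) auto
  then have "\<lceil>log 2 ((c + 2) * real s)\<rceil> \<le> \<lceil>log 2 ((c + 2) * real s')\<rceil>"
    by (rule ceiling_mono)
  then have "real (rsize c s) \<le> real (rsize c s')" using assms by (simp add: rsize_eq)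
  then show ?thesis by simp
qed

text \<open>Doubling the argument raises the ceiling of the logarithm by 1, and the range already
  has at least three elements. An exchange alters the sample size by one, so this controls its
  effect on the law of \<open>X\<close>.\<close>

lemma rsize_Suc_le:
  assumes "c \<ge> 1" "1 \<le> s"
  shows "rsize c (Suc s) \<le> 2 * rsize c s"
proof -
  have "(c + 2) * real (Suc s) \<le> 2 * ((c + 2) * real s)"
    using assms mult_left_mono[of "real (Suc s)" "2 * real s" "c + 2"] by simp
  then have "log 2 ((c + 2) * real (Suc s)) \<le> log 2 (2 * ((c + 2) * real s))"
    using assms by (intro log_mono) auto
  also have "\<dots> = log 2 ((c + 2) * real s) + 1"
    using assms by (subst log_mult) auto
  finally have "\<lceil>log 2 ((c + 2) * real (Suc s))\<rceil> \<le> \<lceil>log 2 ((c + 2) * real s) + 1\<rceil>"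
    by (rule ceiling_mono)
  then have "\<lceil>log 2 ((c + 2) * real (Suc s))\<rceil> \<le> \<lceil>log 2 ((c + 2) * real s)\<rceil> + 1"
    by (simp only: ceiling_add_one)
  moreover have "real (rsize c (Suc s)) = real_of_int \<lceil>log 2 ((c + 2) * real (Suc s))\<rceil> + 2"
    using assms by (intro rsize_eq) auto
  ultimately have "real (rsize c (Suc s)) \<le> 2 * real (rsize c s)"
    using ceiling_log_ge_1[OF assms] rsize_eq[OF assms] by linarith
  then show ?thesis by linarith
qed

text \<open>The \<open>+ 1\<close> leaves room for one sampled node lost in an exchange. It is
  absorbed since \<open>4 * (s + 1) <= 6 * s\<close> for \<open>s >= 2\<close>, since a power of two
  below 8 is at most 4 for \<open>s = 1\<close>, and since
  \<open>6 * s <= 2 * ((c + 2) * s)\<close>. The ceiling supplies the last factor 2.\<close>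

lemma level_in_X_range:
  assumes "c \<ge> 1" "1 \<le> card A" "2 ^ k < 4 * (card A + 1)"
  shows "int k \<in> X_range c A"
proof -
  let ?s = "card A"
  have "2 ^ k < 6 * ?s"
  proof (cases "?s = 1")
    case True
    have "2 ^ k \<le> (4::nat)"
    proof (cases "k \<le> 2")
      case True
      then show ?thesis using power_increasing[of k 2 "2::nat"] by simp
    next
      case False
      then have "(2::nat) ^ 3 \<le> 2 ^ k" by (intro power_increasing) auto
      then show ?thesis using assms(3) \<open>?s = 1\<close> by simp
    qed
    then show ?thesis using True by simp
  next
    case False
    then have "4 * (?s + 1) \<le> 6 * ?s" using assms(2) by arith
    then show ?thesis using assms(3) by (rule order.strict_trans2[rotated])
  qed
  then have "real (2 ^ k) < real (6 * ?s)" by (simp only: of_nat_less_iff)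
  also have "real (6 * ?s) \<le> 2 * ((c + 2) * real ?s)"
    using assms by (simp add: mult_right_mono)
  finally have "log 2 (2 ^ k) < log 2 (2 * ((c + 2) * real ?s))"
    using assms by (intro log_less) auto
  also have "\<dots> = 1 + log 2 ((c + 2) * real ?s)"
    using assms by (subst log_mult) auto
  finally have "real k < 1 + log 2 ((c + 2) * real ?s)" by (simp add: log_nat_power)
  then have "int k \<le> \<lceil>log 2 ((c + 2) * real ?s)\<rceil>" by linarith
  then show ?thesis by (simp add: X_range_def)
qed

section \<open>Expected payoff for fixed weights\<close>

context split_model
begin

definition q :: real where "q = 1 / (2 * real \<rho> * c)"

definition vm :: "weights \<Rightarrow> node" where "vm w = v_max tb (VS w) (wS w)"

text \<open>A lower bound for the expected payoff for given weights and given \<open>X\<close>, as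
  \<open>val_le_alg\<close> shows: only nodes of \<open>M2\<close> that are isolated after thinning
  are counted. Below, \<open>g\<close> is the probability of each value of \<open>X\<close>, and
  \<open>val\<close> averages over \<open>X\<close>.\<close>

definition gain :: "weights \<Rightarrow> int \<Rightarrow> ennreal" where
  "gain w X = (let p = 2 powr (- real_of_int X) * real (wS w (vm w));
      M = M2 E ord {v \<in> VS w - {vm w}. p \<le> real (wS w v)} {v \<in> VI w. p \<le> real (wI w v)}
    in \<Sum>v\<in>M. of_nat (wI w v) * ennreal (q * (1 - q) ^ card (nbrs E M v)))"

definition g :: "weights \<Rightarrow> ennreal" where "g w = ennreal (1 / real (rsize c (card (VS w))))"

definition val :: "weights \<Rightarrow> ennreal" where
  "val w = of_bool (VS w \<noteq> {}) * (g w * (\<Sum>X\<in>X_range c (VS w). gain w X))"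

lemma rho_c: "1 \<le> real \<rho> * c"
proof -
  have "1 * 1 \<le> real \<rho> * c" using c rho by (intro mult_mono) auto
  then show ?thesis by simp
qed

lemma q: "0 < q" "q \<le> 1/2" "0 \<le> q" "q \<le> 1"
  using rho_c by (auto simp: q_def field_simps)

lemma g_le_1: "g w \<le> 1"
  unfolding g_def by (rule order_trans[OF ennreal_leI[of _ 1]]) (auto simp: divide_le_eq_1)

lemma g_mono: "1 \<le> card (VS w) \<Longrightarrow> card (VS w) \<le> card (VS w') \<Longrightarrow> g w' \<le> g w"
  unfolding g_def using rsize_mono[OF c, of "card (VS w)" "card (VS w')"]
    rsize_pos[OF c, of "card (VS w)"] rsize_pos[OF c, of "card (VS w')"]
  by (intro ennreal_leI divide_left_mono) auto

lemma g_Suc: "1 \<le> card (VS w) \<Longrightarrow> card (VS w') = Suc (card (VS w)) \<Longrightarrow> g w \<le> 2 * g w'"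
proof -
  assume a: "1 \<le> card (VS w)" "card (VS w') = Suc (card (VS w))"
  have "0 < real (rsize c (card (VS w)))" "0 < real (rsize c (card (VS w')))"
    using a rsize_pos[OF c, of "card (VS w)"] rsize_pos[OF c, of "card (VS w')"] by auto
  moreover have "real (rsize c (card (VS w'))) \<le> 2 * real (rsize c (card (VS w)))"
    using rsize_Suc_le[OF c a(1)] unfolding a(2) by linarith
  ultimately have "1 / real (rsize c (card (VS w))) \<le> 2 * (1 / real (rsize c (card (VS w'))))"
    by (simp add: field_simps)
  then have "g w \<le> ennreal (2 * (1 / real (rsize c (card (VS w')))))"
    unfolding g_def by (rule ennreal_leI)
  also have "\<dots> = 2 * g w'" unfolding g_def by (subst ennreal_mult) auto
  finally show ?thesis .
qed

lemma finite_rng [simp]: "finite (X_range c A)" by (simp add: X_range_def)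

lemma minus_1_in_rng: "VS w \<noteq> {} \<Longrightarrow> -1 \<in> X_range c (VS w)"
proof -
  assume "VS w \<noteq> {}"
  then have "1 \<le> card (VS w)" by (simp add: Suc_leI card_gt_0_iff)
  from ceiling_log_ge_1[OF c this] have "-1 \<le> \<lceil>log 2 ((c + 2) * real (card (VS w)))\<rceil>" by linarith
  then show ?thesis unfolding X_range_def by (simp only: atLeastAtMost_iff order_refl simp_thms)
qed

lemma gain_le_val:
  assumes "X \<in> X_range c (VS w)" "VS w \<noteq> {}"
  shows "g w * gain w X \<le> val w"
  using assms unfolding val_def by (auto intro!: mult_left_mono member_le_sum)

text \<open>For \<open>X = -1\<close> the threshold is \<open>2 * z2\<close>: no sampled node
  reaches it, and among the arrivals only \<open>top1\<close> does. So \<open>M1\<close> is empty,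
  and \<open>top1\<close> is accepted as soon as its thinning coin succeeds.\<close>

lemma heavy_le_val:
  assumes w: "w \<in> set_pmf W" and "two w" "top1 w \<in> VI w" "top2 w \<in> VS w" "2 * z2 w \<le> z1 w"
  shows "ennreal q * (g w * of_nat (z1 w)) \<le> val w"
proof -
  have wt: "wI w (top2 w) = 0" "wS w (top1 w) = 0" "top1 w \<notin> VS w" "top2 w \<notin> VI w"
    using exclusive[OF w] assms VI_VS_disjoint[OF w]
    by (auto simp: VI_def VS_def positive_nodes_def) (metis less_numeral_extra(3))+
  have z: "wS w (top2 w) = z2 w" "wI w (top1 w) = z1 w" using wt by (simp_all add: z1_def z2_def tot_def)
  have z2: "z2 w > 0" using z assms(4) by (simp add: VS_def positive_nodes_def)
  have "v_max tb (VS w) (wS w) = v_max tb (pres w - {top1 w}) (tot w)"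
  proof (rule v_max_subset[OF tb _ fin])
    show "pres w - {top1 w} \<subseteq> V" using sub(3) by blast
    show "VS w \<subseteq> pres w - {top1 w}" using wt by (auto simp: pres_eq)
    show "v_max tb (pres w - {top1 w}) (tot w) \<in> VS w" using assms(4) by (simp add: top2_def)
    fix u assume "u \<in> VS w"
    then show "wS w u = tot w u"
      using exclusive[OF w, of u] by (auto simp: tot_def VS_def positive_nodes_def)
  qed
  then have vm: "vm w = top2 w" by (simp add: vm_def top2_def)
  have S: "{v \<in> VS w - {vm w}. 2 * real (z2 w) \<le> real (wS w v)} = {}"
  proof -
    have "wS w v \<le> z2 w" if "v \<in> VS w" for v
    proof -
      have "tot w v \<le> z2 w" using that wt by (intro top2_props(3) assms) (auto simp: pres_eq)
      then show ?thesis by (simp add: tot_def)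
    qed
    then show ?thesis using z2 by fastforce
  qed
  have I: "{v \<in> VI w. 2 * real (z2 w) \<le> real (wI w v)} = {top1 w}"
  proof -
    have "wI w v \<le> z2 w" if "v \<in> VI w" "v \<noteq> top1 w" for v
    proof -
      have "tot w v \<le> z2 w" using that by (intro top2_props(3) assms) (auto simp: pres_eq)
      then show ?thesis by (simp add: tot_def)
    qed
    moreover have "2 * real (z2 w) \<le> real (z1 w)" using assms(5) by linarith
    ultimately show ?thesis using z2 z assms(3) by fastforce
  qed
  have "M1 E ord {} = {}" by (simp add: M1_def)
  then have M: "M2 E ord {} {top1 w} = {top1 w}" by (auto simp: M2_def in_M2_def)
  have nb: "nbrs E {top1 w} (top1 w) = {}" using no_loop by (auto simp: nbrs_def)
  have "gain w (-1) = of_nat (z1 w) * ennreal q"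
  proof -
    have p: "2 powr (- real_of_int (-1)) * real (wS w (vm w)) = 2 * real (z2 w)"
      by (simp add: vm z)
    show ?thesis unfolding gain_def Let_def p S I M by (simp add: nb z)
  qed
  then have "g w * (of_nat (z1 w) * ennreal q) \<le> val w"
    using gain_le_val[of "-1" w] minus_1_in_rng[of w] assms(4) by auto
  then show ?thesis by (simp add: mult_ac)
qed

section \<open>Weight classes below a sampled maximum\<close>

definition Sk :: "nat \<Rightarrow> weights \<Rightarrow> node set" where
  "Sk k w = {v \<in> VS w - {top1 w}. real (z1 w) / 2 ^ k \<le> real (wS w v)}"
definition Ik :: "nat \<Rightarrow> weights \<Rightarrow> node set" where
  "Ik k w = {v \<in> VI w. real (z1 w) / 2 ^ k \<le> real (wI w v)}"
definition hk :: "nat \<Rightarrow> weights \<Rightarrow> ennreal" where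
  "hk k w = of_bool (top1 w \<in> VS w \<and> int k \<in> X_range c (VS w)) * (g w * ennreal (real (z1 w) / 2 ^ k))"
text \<open>Stricter than \<open>hk\<close>: if an exchange takes one node out of the sample,
  \<open>2 ^ k < 4 * card VS\<close> before it still guarantees that \<open>k\<close> is in the
  range of \<open>X\<close> after it.\<close>

definition hL :: "nat \<Rightarrow> weights \<Rightarrow> ennreal" where
  "hL k w = of_bool (top1 w \<in> VS w \<and> 2 ^ k < 4 * card (VS w)) * (g w * ennreal (real (z1 w) / 2 ^ k))"
definition iso :: "nat \<Rightarrow> weights \<Rightarrow> ennreal" where
  "iso k w = (\<Sum>v\<in>M2 E ord (Sk k w) (Ik k w).
    ennreal ((1 - q) ^ card (nbrs E (M2 E ord (Sk k w) (Ik k w)) v)))"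

lemma Sk_sub: "Sk k w \<subseteq> V" and Ik_sub: "Ik k w \<subseteq> V"
  using sub(1,2)[of w] by (auto simp: Sk_def Ik_def simp del: sub)

lemma card_VS_pos: "v \<in> VS w \<Longrightarrow> 1 \<le> card (VS w)"
  by (metis Suc_leI card_gt_0_iff empty_iff finite_sets(2) One_nat_def)

lemma hL_le_hk: "hL k w \<le> hk k w"
  unfolding hL_def hk_def using level_in_X_range[OF c, of "VS w" k] card_VS_pos[of "top1 w" w]
  by (intro mult_right_mono) auto

text \<open>A sampled \<open>top1\<close> is the heaviest sampled node of the algorithm, so
  \<open>Sk\<close> and \<open>Ik\<close> are the sets that it passes to \<open>A1\<close> for
  \<open>X = k\<close>. Each accepted node weighs at least the threshold.\<close>

lemma gain_ge_iso:
  assumes w: "w \<in> set_pmf W" "top1 w \<in> VS w"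
  shows "ennreal q * (ennreal (real (z1 w) / 2 ^ k) * iso k w) \<le> gain w (int k)"
proof -
  have z: "wS w (top1 w) = z1 w"
    using exclusive[OF w(1), of "top1 w"] w(2) by (auto simp: z1_def tot_def VS_def positive_nodes_def)
  have "v_max tb (VS w) (wS w) = v_max tb (pres w) (tot w)"
  proof (rule v_max_subset[OF tb _ fin])
    show "v_max tb (pres w) (tot w) \<in> VS w" using w(2) by (simp add: top1_def)
    fix u assume "u \<in> VS w"
    then show "wS w u = tot w u"
      using exclusive[OF w(1), of u] by (auto simp: tot_def VS_def positive_nodes_def)
  qed (auto simp: pres_eq)
  then have vm: "vm w = top1 w" by (simp add: vm_def top1_def)
  let ?M = "M2 E ord (Sk k w) (Ik k w)"
  have p: "2 powr (- real_of_int (int k)) * real (wS w (vm w)) = real (z1 w) / 2 ^ k"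
    by (simp add: vm z powr_minus powr_realpow field_simps)
  have gain: "gain w (int k) = (\<Sum>v\<in>?M. of_nat (wI w v) * ennreal (q * (1 - q) ^ card (nbrs E ?M v)))"
    unfolding gain_def p by (simp add: vm Let_def Sk_def Ik_def)
  have "ennreal q * (ennreal (real (z1 w) / 2 ^ k) * iso k w) =
    (\<Sum>v\<in>?M. ennreal (real (z1 w) / 2 ^ k) * ennreal (q * (1 - q) ^ card (nbrs E ?M v)))"
    unfolding iso_def using q by (simp add: sum_distrib_left ennreal_mult mult_ac del: sum_ennreal)
  also have "\<dots> \<le> gain w (int k)"
    unfolding gain ennreal_of_nat_eq_real_of_nat
    by (intro sum_mono mult_right_mono ennreal_leI) (auto simp: M2_def Ik_def)
  finally show ?thesis .
qed

lemma Sk_flip: "u \<noteq> v \<Longrightarrow> u \<in> Sk k (flip v w) \<longleftrightarrow> u \<in> Sk k w"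
  and Ik_flip: "u \<noteq> v \<Longrightarrow> u \<in> Ik k (flip v w) \<longleftrightarrow> u \<in> Ik k w"
  by (auto simp: Sk_def Ik_def mem_VS_flip mem_VI_flip wS_flip wI_flip)

lemma pass_flip:
  assumes "v \<in> V" "v = u \<or> precedes ord v u"
  shows "in_M2 E ord (Sk k (flip u w)) v \<longleftrightarrow> in_M2 E ord (Sk k w) v"
proof (rule in_M2_cong[OF no_loop ord(1)])
  fix z assume "precedes ord z v"
  then have "z \<noteq> u" using assms(2) precedes_irrefl[OF ord(1)] precedes_trans[OF ord(1)] by blast
  then show "z \<in> Sk k (flip u w) \<longleftrightarrow> z \<in> Sk k w" by (rule Sk_flip)
qed (use assms ord in auto)

text \<open>A node of \<open>M1\<close> is exchanged into the arrivals. It is not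
  \<open>top1\<close>, so the threshold stays; its test reads earlier nodes only; the sample
  shrinks, so \<open>g\<close> does not decrease, and the slack in \<open>hL\<close> keeps
  \<open>k\<close> in the range.\<close>

lemma M1_level_le:
  "EW (\<lambda>w. hL k w * of_nat (card (M1 E ord (Sk k w)))) \<le>
    cc * EW (\<lambda>w. hk k w * of_nat (card (M2 E ord (Sk k w) (Ik k w))))"
proof -
  have N: "M2 E ord (Sk k w) (Sk k w) \<subseteq> V" and M: "M2 E ord (Sk k w) (Ik k w) \<subseteq> V" for w
    using Sk_sub[of k w] Ik_sub[of k w] by (auto simp: M2_def)
  have "EW (\<lambda>w. hL k w * of_nat (card (M1 E ord (Sk k w)))) =
    (\<Sum>v\<in>V. EW (\<lambda>w. hL k w * of_bool (v \<in> M2 E ord (Sk k w) (Sk k w))))"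
    unfolding M1_eq[OF Sk_sub] ennreal_of_nat_sum_bool[OF fin N] by (rule nn_integral_pmf_mult_sum)
  also have "\<dots> \<le> (\<Sum>v\<in>V. cc * EW (\<lambda>w. hk k w * of_bool (v \<in> M2 E ord (Sk k w) (Ik k w))))"
  proof (rule sum_mono)
    fix v assume v: "v \<in> V"
    let ?F = "\<lambda>w. hL k w * of_bool (v \<in> M2 E ord (Sk k w) (Sk k w))"
    have "EW ?F = EW (\<lambda>w. of_bool (wS w v > 0) * ?F w)"
      by (intro EW_cong) (auto simp: M2_def Sk_def VS_def positive_nodes_def)
    also have "\<dots> \<le> cc * EW (\<lambda>w. of_bool (wI w v > 0) * ?F (flip v w))" by (rule exchange_SI[OF v])
    also have "EW (\<lambda>w. of_bool (wI w v > 0) * ?F (flip v w)) \<le>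
      EW (\<lambda>w. hk k w * of_bool (v \<in> M2 E ord (Sk k w) (Ik k w)))"
    proof (rule EW_mono)
      fix w assume w: "w \<in> set_pmf W"
      show "of_bool (wI w v > 0) * ?F (flip v w) \<le> hk k w * of_bool (v \<in> M2 E ord (Sk k w) (Ik k w))"
      proof (cases "wI w v > 0 \<and> top1 w \<in> VS (flip v w) \<and> 2 ^ k < 4 * card (VS (flip v w)) \<and>
          v \<in> M2 E ord (Sk k (flip v w)) (Sk k (flip v w))")
        case False
        then have "of_bool (wI w v > 0) * ?F (flip v w) = 0" by (auto simp: hL_def)
        then show ?thesis by (simp only: zero_le)
      next
        case True
        have vI: "v \<in> VI w" using True v by (simp add: mem_VI)
        then have vS: "v \<notin> VS w" by (rule VI_VS_disjoint[OF w])
        have S: "VS (flip v w) = insert v (VS w)" by (rule VS_flip_I[OF vI])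
        have card: "card (VS (flip v w)) = Suc (card (VS w))" using S vS by simp
        have "v \<noteq> top1 w" "v \<in> Sk k (flip v w)" using True by (auto simp: M2_def Sk_def)
        then have t: "top1 w \<in> VS w" and "v \<in> Ik k w"
          using True vI S by (auto simp: Sk_def Ik_def wS_flip)
        moreover have "in_M2 E ord (Sk k w) v"
          using True pass_flip[OF v, of v k w] by (simp add: M2_def)
        ultimately have m: "v \<in> M2 E ord (Sk k w) (Ik k w)" by (simp add: M2_def)
        have "g (flip v w) \<le> g w" using card_VS_pos[OF t] card by (intro g_mono) auto
        moreover have "int k \<in> X_range c (VS w)"
          using True card card_VS_pos[OF t] by (intro level_in_X_range c) auto
        ultimately show ?thesis using True t m by (simp add: hL_def hk_def mult_right_mono)
      qed
    qed
    finally show "EW ?F \<le> cc * EW (\<lambda>w. hk k w * of_bool (v \<in> M2 E ord (Sk k w) (Ik k w)))"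
      by (simp add: mult_left_mono)
  qed
  also have "\<dots> = cc * EW (\<lambda>w. hk k w * of_nat (card (M2 E ord (Sk k w) (Ik k w))))"
    unfolding ennreal_of_nat_sum_bool[OF fin M] nn_integral_pmf_mult_sum by (simp only: sum_distrib_left)
  finally show ?thesis .
qed

text \<open>\<open>isolated_lower_bound\<close> needs finite total mass, while weights may have
  infinite mean. Truncation at \<open>z1 w <= m\<close> supplies it, is respected by
  \<open>flip\<close>, and is removed by monotone convergence.\<close>

lemma EW_truncate:
  assumes "\<And>m. EW (\<lambda>w. of_bool (z1 w \<le> m) * f w) \<le> B"
  shows "EW f \<le> B"
proof -
  have "EW f = EW (\<lambda>w. SUP m. of_bool (z1 w \<le> m) * f w)"
  proof (rule EW_cong)
    fix w
    show "f w = (SUP m. of_bool (z1 w \<le> m) * f w)"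
      by (rule antisym, rule SUP_upper2[of "z1 w"]) (auto intro!: SUP_least)
  qed
  also have "\<dots> = (SUP m. EW (\<lambda>w. of_bool (z1 w \<le> m) * f w))"
    by (rule nn_integral_monotone_convergence_SUP) (auto simp: incseq_def le_fun_def intro!: mult_right_mono)
  also have "\<dots> \<le> B" by (rule SUP_least[OF assms])
  finally show ?thesis .
qed

text \<open>Exchanging \<open>u\<close> into the sample enlarges it by one node: this costs
  \<open>c\<close> for the weights and a factor 2 for \<open>g\<close>, by \<open>g_Suc\<close>. So
  \<open>K = 2 * c\<close>, and \<open>4 * q * K * \<rho> = 4\<close> gives the exponent.\<close>

lemma M2_level_le:
  "EW (\<lambda>w. hk k w * of_nat (card (M2 E ord (Sk k w) (Ik k w)))) \<le> ennreal (exp 4) * EW (\<lambda>w. hk k w * iso k w)"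
proof (rule EW_truncate)
  fix m
  define h where "h w = of_bool (z1 w \<le> m) * hk k w" for w
  have "EW (\<lambda>w. h w * of_nat (card (M2 E ord (Sk k w) (Ik k w)))) \<le> ennreal (exp 4) * EW (\<lambda>w. h w * (\<Sum>v\<in>M2 E ord (Sk k w) (Ik k w).
      ennreal ((1 - q) ^ card (nbrs E (M2 E ord (Sk k w) (Ik k w)) v))))"
  proof (rule isolated_lower_bound[OF Sk_sub Ik_sub, of "2 * c" q 4])
    show "4 * q * (2 * c) * real \<rho> \<le> 4" using c rho by (simp add: q_def field_simps)
    have "h w \<le> of_nat m" for w
    proof (cases "z1 w \<le> m")
      case True
      have "real (z1 w) / 2 ^ k \<le> real (z1 w)" by (simp add: divide_le_eq mult_le_cancel_left1)
      then have "real (z1 w) / 2 ^ k \<le> real m" using True by linarith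
      then have "ennreal (real (z1 w) / 2 ^ k) \<le> of_nat m"
        by (simp add: ennreal_of_nat_eq_real_of_nat ennreal_leI)
      then have "g w * ennreal (real (z1 w) / 2 ^ k) \<le> 1 * of_nat m"
        by (intro mult_mono g_le_1) auto
      then show ?thesis by (simp add: h_def hk_def)
    qed (simp add: h_def)
    then have "EW h \<le> EW (\<lambda>_. of_nat m)" by (intro EW_mono) blast
    also have "\<dots> < \<infinity>" by (simp add: of_nat_less_top)
    finally show "EW h < \<infinity>" .
    fix u v assume uv: "u \<in> V" "v \<in> V" "precedes ord v u"
    then have ne: "v \<noteq> u" using precedes_irrefl[OF ord(1)] by blast
    let ?M = "\<lambda>w. M2 E ord (Sk k w) (Ik k w)" and ?N = "\<lambda>w. M2 E ord (Sk k w) (Sk k w)"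
    let ?F = "\<lambda>w. h w * of_bool (v \<in> ?M w \<and> u \<in> ?M w)"
    have "EW ?F = EW (\<lambda>w. of_bool (wI w u > 0) * ?F w)"
      by (intro EW_cong) (auto simp: M2_def Ik_def VI_def positive_nodes_def)
    also have "\<dots> \<le> cc * EW (\<lambda>w. of_bool (wS w u > 0) * ?F (flip u w))" by (rule exchange_IS[OF uv(1)])
    also have "EW (\<lambda>w. of_bool (wS w u > 0) * ?F (flip u w)) \<le> EW (\<lambda>w. 2 * (h w * of_bool (v \<in> ?M w \<and> u \<in> ?N w)))"
    proof (rule EW_mono)
      fix w assume w: "w \<in> set_pmf W"
      let ?w = "flip u w"
      show "of_bool (wS w u > 0) * ?F ?w \<le> 2 * (h w * of_bool (v \<in> ?M w \<and> u \<in> ?N w))"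
      proof (cases "wS w u > 0 \<and> z1 w \<le> m \<and> top1 w \<in> VS ?w \<and> int k \<in> X_range c (VS ?w) \<and> v \<in> ?M ?w \<and> u \<in> ?M ?w")
        case False
        then have "of_bool (wS w u > 0) * ?F ?w = 0" by (auto simp: h_def hk_def)
        then show ?thesis by (simp only: zero_le)
      next
        case True
        have uS: "u \<in> VS w" using True uv by (simp add: mem_VS)
        have S: "VS ?w = VS w - {u}" by (rule VS_flip_S[OF w uS])
        have pos: "1 \<le> card (VS ?w)" using True card_VS_pos by blast
        have card: "card (VS w) = Suc (card (VS ?w))"
          unfolding S using uS by (intro card.remove) auto
        have t: "top1 w \<in> VS w" "u \<noteq> top1 w" using True S by auto
        have "u \<in> Sk k w" using True uS t by (simp add: M2_def Ik_def Sk_def wI_flip)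
        moreover have "in_M2 E ord (Sk k w) u" "in_M2 E ord (Sk k w) v"
          using True pass_flip[of u u k w] pass_flip[of v u k w] uv by (simp_all add: M2_def)
        moreover have "v \<in> Ik k w" using True Ik_flip[OF ne, of k w] by (simp add: M2_def)
        ultimately have mm: "v \<in> ?M w" "u \<in> ?N w" by (simp_all add: M2_def)
        have X: "int k \<in> X_range c (VS w)"
          using True X_range_mono[OF c pos, of "VS w"] card by auto
        have "g ?w \<le> 2 * g w" using pos card by (rule g_Suc)
        then have "g ?w * ennreal (real (z1 w) / 2 ^ k) \<le> 2 * g w * ennreal (real (z1 w) / 2 ^ k)"
          by (rule mult_right_mono) simp
        then show ?thesis using True t mm X by (simp add: h_def hk_def mult.assoc)
      qed
    qed
    also have "\<dots> = 2 * EW (\<lambda>w. h w * of_bool (v \<in> ?M w \<and> u \<in> ?N w))" by (rule EW_cmult)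
    finally have "EW ?F \<le> cc * (2 * EW (\<lambda>w. h w * of_bool (v \<in> ?M w \<and> u \<in> ?N w)))"
      by (simp add: mult_left_mono)
    then show "EW ?F \<le> ennreal (2 * c) * EW (\<lambda>w. h w * of_bool (v \<in> ?M w \<and> u \<in> ?N w))"
      using c by (simp add: ennreal_mult mult_ac)
  qed (use q c in auto)
  also have "\<dots> \<le> ennreal (exp 4) * EW (\<lambda>w. hk k w * iso k w)"
    unfolding iso_def h_def by (intro mult_left_mono EW_mono mult_right_mono) auto
  finally show "EW (\<lambda>w. of_bool (z1 w \<le> m) * (hk k w * of_nat (card (M2 E ord (Sk k w) (Ik k w)))))
    \<le> ennreal (exp 4) * EW (\<lambda>w. hk k w * iso k w)"
    by (simp only: h_def mult.assoc)
qed

end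

section \<open>Decomposing the optimum into weight classes\<close>

lemma dyadic_level:
  fixes x z s :: nat
  assumes "0 < x" "x \<le> z" "z \<le> 2 * s * x"
  obtains k where "2 ^ k < 4 * s" "real z / 2 ^ k \<le> real x" "real x \<le> 2 * (real z / 2 ^ k)"
proof -
  \<comment> \<open>Minimality also gives \<open>2 ^ (k - 1) * x < z\<close>, from which both upper
    bounds follow; for \<open>k = 0\<close> they follow from \<open>x <= z\<close> and
    \<open>0 < s\<close>.\<close>
  define k where "k = (LEAST k. z \<le> 2 ^ k * x)"
  have "z \<le> 2 ^ z * x" using assms(1) less_exp[of z] by (metis less_imp_le_nat mult_le_mono mult.right_neutral Suc_leI One_nat_def)
  then have k: "z \<le> 2 ^ k * x" unfolding k_def by (rule LeastI)
  have s: "0 < s" using assms by (cases s) auto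
  have "real z \<le> 2 ^ k * real x" using k by (metis of_nat_le_iff of_nat_mult of_nat_numeral of_nat_power)
  then have 1: "real z / 2 ^ k \<le> real x" by (simp add: field_simps)
  show ?thesis
  proof (cases k)
    case 0
    then show ?thesis using that[of 0] 1 s assms(2) by simp
  next
    case (Suc j)
    have "\<not> z \<le> 2 ^ j * x" using not_less_Least[of j "\<lambda>k. z \<le> 2 ^ k * x"] Suc k_def by auto
    then have lt: "2 ^ j * x < z" by simp
    then have "2 ^ j * x < 2 * s * x" using assms(3) by linarith
    then have "2 ^ j < 2 * s" by simp
    then have "2 ^ k < 4 * s" using Suc by simp
    moreover have "real (2 ^ j * x) < real z" using lt by (simp only: of_nat_less_iff)
    then have "real x \<le> 2 * (real z / 2 ^ k)" using Suc by (simp add: field_simps)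
    ultimately show ?thesis using that 1 by blast
  qed
qed

context split_model
begin

text \<open>Each surviving node of the optimum is paid by a class \<open>k\<close> whose threshold
  is within a factor 2 of its weight, and \<open>card_independent_le\<close> bounds the part of the
  optimum in that class. Since \<open>k < 2 ^ k < 4 * card V\<close>, finitely many classes
  suffice.\<close>

lemma lev_le_levels:
  assumes w: "w \<in> set_pmf W" "top1 w \<in> VS w"
  shows "of_nat (lev w) \<le> (\<Sum>k<4 * card V. of_bool (2 ^ k < 4 * card (VS w)) * (2 * ennreal (real (z1 w) / 2 ^ k)) *
    (of_nat (card (M2 E ord (Sk k w) (Ik k w))) + of_nat \<rho> * of_nat (card (M1 E ord (Sk k w)))))"
proof -
  obtain T where T: "T \<subseteq> V" "independent_set E T" "opt V E (cut w) = (\<Sum>v\<in>T. wI (cut w) v)"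
    using opt_attained[OF fin] .
  have finT: "finite T" using T(1) fin finite_subset by blast
  let ?c = "\<lambda>k. of_bool (2 ^ k < 4 * card (VS w)) * (2 * ennreal (real (z1 w) / 2 ^ k)) :: ennreal"
  have one: "of_nat (wI (cut w) v) \<le> (\<Sum>k<4 * card V. ?c k * of_bool (v \<in> Ik k w))" if v: "v \<in> T" for v
  proof (cases "wI (cut w) v = 0")
    case False
    then have x: "wI (cut w) v = wI w v" "0 < wI w v" "z1 w \<le> 2 * card (VS w) * wI w v"
      by (auto simp: wI_cut split: if_splits)
    have vI: "v \<in> VI w" using x v T by (auto simp: mem_VI)
    then have "tot w v \<le> z1 w" by (intro top1_props(2)) (auto simp: pres_eq)
    then have "wI w v \<le> z1 w" by (simp add: tot_def)
    then obtain k where k: "2 ^ k < 4 * card (VS w)" "real (z1 w) / 2 ^ k \<le> real (wI w v)"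
      "real (wI w v) \<le> 2 * (real (z1 w) / 2 ^ k)"
      using dyadic_level[OF x(2) _ x(3)] by blast
    have "k < 2 ^ k" by (rule less_exp)
    moreover have "card (VS w) \<le> card V" by (intro card_mono fin) simp
    ultimately have kV: "k < 4 * card V" using k(1) by linarith
    have "of_nat (wI w v) \<le> ennreal (2 * (real (z1 w) / 2 ^ k))"
      unfolding ennreal_of_nat_eq_real_of_nat by (rule ennreal_leI[OF k(3)])
    also have "\<dots> = 2 * ennreal (real (z1 w) / 2 ^ k)" by (subst ennreal_mult) auto
    also have "\<dots> = ?c k * of_bool (v \<in> Ik k w)" using k vI by (simp add: Ik_def)
    also have "\<dots> \<le> (\<Sum>k<4 * card V. ?c k * of_bool (v \<in> Ik k w))"
      using kV by (intro member_le_sum) auto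
    finally show ?thesis using x(1) by simp
  qed simp
  have "of_nat (lev w) = (\<Sum>v\<in>T. of_nat (wI (cut w) v) :: ennreal)" by (simp add: lev_def T(3))
  also have "\<dots> \<le> (\<Sum>v\<in>T. \<Sum>k<4 * card V. ?c k * of_bool (v \<in> Ik k w))"
    by (intro sum_mono one)
  also have "\<dots> = (\<Sum>k<4 * card V. ?c k * (\<Sum>v\<in>T. of_bool (v \<in> Ik k w)))"
    by (subst sum.swap) (simp only: sum_distrib_left)
  also have "\<dots> \<le> (\<Sum>k<4 * card V. ?c k *
    (of_nat (card (M2 E ord (Sk k w) (Ik k w))) + of_nat \<rho> * of_nat (card (M1 E ord (Sk k w)))))"
  proof (intro sum_mono mult_left_mono)
    fix k
    have "(\<Sum>v\<in>T. of_bool (v \<in> Ik k w)) = (of_nat (card (T \<inter> Ik k w)) :: ennreal)"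
      using finT by simp
    also have "\<dots> \<le> of_nat (card (M2 E ord (Sk k w) (Ik k w)) + \<rho> * card (M1 E ord (Sk k w)))"
      using T(2) by (intro of_nat_mono card_independent_le Sk_sub Ik_sub) (auto simp: independent_set_def)
    finally show "(\<Sum>v\<in>T. of_bool (v \<in> Ik k w)) \<le> (of_nat (card (M2 E ord (Sk k w) (Ik k w)))
      + of_nat \<rho> * of_nat (card (M1 E ord (Sk k w))) :: ennreal)" by simp
  qed simp
  finally show ?thesis .
qed

text \<open>The factors stand for rounding weights to thresholds, for \<open>M2\<close> together
  with \<open>\<rho>\<close> times \<open>M1\<close>, and for isolation.\<close>

definition C2 :: real where "C2 = 2 * (1 + real \<rho> * c) * exp 4"

text \<open>The classes are distinct values of \<open>X\<close>, and the factor \<open>g\<close> in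
  \<open>hk\<close> is the probability of each. So the bounds for all classes add up to part of the
  single average \<open>val\<close>, and the number of classes is lost only once, through
  \<open>g\<close>.\<close>

lemma levels_le_val:
  "ennreal q * EW (\<lambda>w. g w * (of_bool (top1 w \<in> VS w) * of_nat (lev w))) \<le> ennreal C2 * EW val"
proof -
  let ?m = "\<lambda>k w. of_nat (card (M2 E ord (Sk k w) (Ik k w))) :: ennreal"
  let ?n = "\<lambda>k w. of_nat (card (M1 E ord (Sk k w))) :: ennreal"
  let ?K = "{..<4 * card V}"
  have "EW (\<lambda>w. g w * (of_bool (top1 w \<in> VS w) * of_nat (lev w))) \<le>
    EW (\<lambda>w. \<Sum>k\<in>?K. 2 * (hL k w * ?m k w + of_nat \<rho> * (hL k w * ?n k w)))"
  proof (rule EW_mono)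
    fix w assume w: "w \<in> set_pmf W"
    show "g w * (of_bool (top1 w \<in> VS w) * of_nat (lev w)) \<le>
      (\<Sum>k\<in>?K. 2 * (hL k w * ?m k w + of_nat \<rho> * (hL k w * ?n k w)))"
    proof (cases "top1 w \<in> VS w")
      case True
      have "g w * of_nat (lev w) \<le> g w * (\<Sum>k\<in>?K. of_bool (2 ^ k < 4 * card (VS w)) * (2 * ennreal (real (z1 w) / 2 ^ k)) *
        (?m k w + of_nat \<rho> * ?n k w))"
        by (intro mult_left_mono lev_le_levels[OF w True]) simp
      also have "\<dots> = (\<Sum>k\<in>?K. 2 * (hL k w * ?m k w + of_nat \<rho> * (hL k w * ?n k w)))"
        unfolding sum_distrib_left using True
        by (intro sum.cong refl) (simp add: hL_def algebra_simps)
      finally show ?thesis using True by simp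
    qed simp
  qed
  also have "\<dots> = (\<Sum>k\<in>?K. 2 * (EW (\<lambda>w. hL k w * ?m k w) + of_nat \<rho> * EW (\<lambda>w. hL k w * ?n k w)))"
    by (simp only: EW_sum EW_cmult EW_add)
  also have "\<dots> \<le> (\<Sum>k\<in>?K. 2 * (EW (\<lambda>w. hk k w * ?m k w) + of_nat \<rho> * (cc * EW (\<lambda>w. hk k w * ?m k w))))"
    by (intro sum_mono mult_left_mono add_mono M1_level_le EW_mono mult_right_mono hL_le_hk) auto
  also have "\<dots> = (\<Sum>k\<in>?K. ennreal (2 * (1 + real \<rho> * c)) * EW (\<lambda>w. hk k w * ?m k w))"
  proof (rule sum.cong[OF refl])
    fix k
    have "ennreal (2 * (1 + real \<rho> * c)) = 2 * (1 + of_nat \<rho> * cc)"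
      using c by (simp add: ennreal_mult ennreal_plus ennreal_of_nat_eq_real_of_nat)
    then show "2 * (EW (\<lambda>w. hk k w * ?m k w) + of_nat \<rho> * (cc * EW (\<lambda>w. hk k w * ?m k w))) =
      ennreal (2 * (1 + real \<rho> * c)) * EW (\<lambda>w. hk k w * ?m k w)"
      by (simp only: distrib_right distrib_left mult.assoc mult_1)
  qed
  also have "\<dots> \<le> (\<Sum>k\<in>?K. ennreal (2 * (1 + real \<rho> * c)) * (ennreal (exp 4) * EW (\<lambda>w. hk k w * iso k w)))"
    by (intro sum_mono mult_left_mono M2_level_le) simp
  also have "\<dots> = ennreal C2 * EW (\<lambda>w. \<Sum>k\<in>?K. hk k w * iso k w)"
  proof -
    have "ennreal C2 = ennreal (2 * (1 + real \<rho> * c)) * ennreal (exp 4)"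
      unfolding C2_def using c by (intro ennreal_mult) auto
    then show ?thesis by (simp only: EW_sum sum_distrib_left mult.assoc)
  qed
  finally have "ennreal q * EW (\<lambda>w. g w * (of_bool (top1 w \<in> VS w) * of_nat (lev w))) \<le>
    ennreal q * (ennreal C2 * EW (\<lambda>w. \<Sum>k\<in>?K. hk k w * iso k w))"
    by (rule mult_left_mono) simp
  also have "\<dots> = ennreal C2 * EW (\<lambda>w. ennreal q * (\<Sum>k\<in>?K. hk k w * iso k w))"
    by (simp only: EW_cmult mult.left_commute)
  also have "\<dots> \<le> ennreal C2 * EW val"
  proof (intro mult_left_mono EW_mono)
    fix w assume w: "w \<in> set_pmf W"
    let ?L = "{k \<in> ?K. int k \<in> X_range c (VS w)}"
    show "ennreal q * (\<Sum>k\<in>?K. hk k w * iso k w) \<le> val w"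
    proof (cases "top1 w \<in> VS w")
      case True
      have "ennreal q * (\<Sum>k\<in>?K. hk k w * iso k w) = (\<Sum>k\<in>?K. ennreal q * (hk k w * iso k w))"
        by (rule sum_distrib_left)
      also have "\<dots> = (\<Sum>k\<in>?L. g w * (ennreal q * (ennreal (real (z1 w) / 2 ^ k) * iso k w)))"
        using True by (intro sum.mono_neutral_cong_right) (auto simp: hk_def mult_ac)
      also have "\<dots> \<le> (\<Sum>k\<in>?L. g w * gain w (int k))"
        by (intro sum_mono mult_left_mono gain_ge_iso w True) simp
      also have "\<dots> = (\<Sum>X\<in>int ` ?L. g w * gain w X)"
        by (subst sum.reindex) auto
      also have "\<dots> \<le> (\<Sum>X\<in>X_range c (VS w). g w * gain w X)"
        by (intro sum_mono2) auto
      also have "\<dots> = val w" using True by (auto simp: val_def sum_distrib_left)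
      finally show ?thesis .
    qed (simp add: hk_def)
  qed simp
  finally show ?thesis .
qed

lemma Q_le_val: "ennreal q * EW (\<lambda>w. g w * Q w) \<le> ennreal (C2 + 1) * EW val"
proof -
  let ?h = "\<lambda>w. of_bool (two w \<and> top1 w \<in> VI w \<and> top2 w \<in> VS w \<and> 2 * z2 w \<le> z1 w) * of_nat (z1 w) :: ennreal"
  have "ennreal q * EW (\<lambda>w. g w * Q w) =
    ennreal q * EW (\<lambda>w. g w * (of_bool (top1 w \<in> VS w) * of_nat (lev w))) + EW (\<lambda>w. ennreal q * (g w * ?h w))"
    by (simp only: Q_def distrib_left EW_add EW_cmult)
  also have "\<dots> \<le> ennreal C2 * EW val + EW val"
  proof (intro add_mono levels_le_val EW_mono)
    fix w assume "w \<in> set_pmf W"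
    then show "ennreal q * (g w * ?h w) \<le> val w"
      using heavy_le_val[of w]
      by (cases "two w \<and> top1 w \<in> VI w \<and> top2 w \<in> VS w \<and> 2 * z2 w \<le> z1 w") auto
  qed
  also have "\<dots> = ennreal (C2 + 1) * EW val"
    using c by (simp add: C2_def distrib_right)
  finally show ?thesis .
qed

text \<open>Negative correlation: a sampled \<open>u\<close> does not arrive, so erasing its weights
  does not lower the optimum. The optimum without \<open>u\<close> is independent of the event that
  \<open>u\<close> is sampled.\<close>

lemma opt_times_card_le: "EW (\<lambda>w. of_nat (opt V E w) * of_nat (card (VS w))) \<le> ennreal N * EW (\<lambda>w. of_nat (opt V E w))"
proof -
  have "EW (\<lambda>w. of_nat (opt V E w) * of_nat (card (VS w))) =
    (\<Sum>u\<in>V. EW (\<lambda>w. of_nat (opt V E w) * of_bool (u \<in> VS w)))"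
    unfolding ennreal_of_nat_sum_bool[OF fin sub(2)] by (rule nn_integral_pmf_mult_sum)
  also have "\<dots> \<le> (\<Sum>u\<in>V. P u * EW (\<lambda>w. of_nat (opt V E w)))"
  proof (rule sum_mono)
    fix u assume u: "u \<in> V"
    let ?z = "\<lambda>w. w(u := (0, 0))"
    have "EW (\<lambda>w. of_nat (opt V E w) * of_bool (u \<in> VS w)) \<le>
      EW (\<lambda>w. of_bool (wS w u > 0) * of_nat (opt V E (?z w)))"
    proof (rule EW_mono)
      fix w assume w: "w \<in> set_pmf W"
      have "opt V E w \<le> opt V E (?z w)" if "wS w u > 0"
        using that exclusive[OF w, of u] by (intro opt_mono fin) (auto simp: wI_def)
      then show "of_nat (opt V E w) * of_bool (u \<in> VS w) \<le> (of_bool (wS w u > 0) * of_nat (opt V E (?z w)) :: ennreal)"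
        using u by (auto simp: mem_VS)
    qed
    also have "\<dots> = P u * EW (\<lambda>w. of_nat (opt V E (?z w)))"
      by (rule indep[OF u]) simp
    also have "\<dots> \<le> P u * EW (\<lambda>w. of_nat (opt V E w))"
      by (intro mult_left_mono EW_mono of_nat_mono opt_mono fin) (auto simp: wI_def)
    finally show "EW (\<lambda>w. of_nat (opt V E w) * of_bool (u \<in> VS w)) \<le> P u * EW (\<lambda>w. of_nat (opt V E w))" .
  qed
  also have "\<dots> = (\<Sum>u\<in>V. P u) * EW (\<lambda>w. of_nat (opt V E w))" by (rule sum_distrib_right[symmetric])
  also have "\<dots> \<le> ennreal N * EW (\<lambda>w. of_nat (opt V E w))" by (intro mult_right_mono P_le) simp
  finally show ?thesis .
qed

text \<open>The two terms of \<open>Q\<close> exclude each other by the role of \<open>top1\<close>,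
  and each is at most the weight of one independent set of arrivals.\<close>

lemma Q_le_opt: "w \<in> set_pmf W \<Longrightarrow> Q w \<le> of_nat (opt V E w)"
proof -
  assume w: "w \<in> set_pmf W"
  show ?thesis
  proof (cases "top1 w \<in> VI w")
    case True
    then have "top1 w \<notin> VS w" by (rule VI_VS_disjoint[OF w])
    then have "Q w \<le> of_nat (z1 w)" by (simp add: Q_def)
    also have "z1 w = wI w (top1 w)"
      using exclusive[OF w, of "top1 w"] True by (auto simp: z1_def tot_def VI_def positive_nodes_def)
    also have "\<dots> = (\<Sum>v\<in>{top1 w}. wI w v)" by simp
    also have "(of_nat \<dots> :: ennreal) \<le> of_nat (opt V E w)"
      using True no_loop by (intro of_nat_mono opt_ge fin) (auto simp: independent_set_def VI_def positive_nodes_def)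
    finally show ?thesis .
  next
    case False
    then show ?thesis using lev_le_opt[of w] by (auto simp: Q_def)
  qed
qed

lemma VS_nonempty_Q: "Q w \<noteq> 0 \<Longrightarrow> 1 \<le> card (VS w)"
  unfolding Q_def by (rule ccontr) (use card_VS_pos in auto)

text \<open>Under the law weighted by \<open>Q\<close>, the mean of \<open>card (VS w)\<close> is at most \<open>C1 c * N\<close>. By Markov's
  inequality the number of choices for \<open>X\<close> is logarithmic in \<open>N\<close> on at least half of the mass.\<close>

lemma Q_le_g:
  assumes T: "2 * C1 c * N \<le> real T" "1 \<le> T"
  shows "EW Q \<le> ennreal (2 * real (rsize c T)) * EW (\<lambda>w. g w * Q w)"
proof -
  have gQ: "Q w \<le> of_nat (rsize c m) * (g w * Q w)" if "card (VS w) \<le> m" for w m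
  proof (cases "Q w = 0")
    case False
    then have pos: "1 \<le> card (VS w)" by (rule VS_nonempty_Q)
    have "1 \<le> real (rsize c m) * (1 / real (rsize c (card (VS w))))"
      using rsize_mono[OF c pos that] rsize_pos[OF c pos] by simp
    then have "1 \<le> of_nat (rsize c m) * g w"
      unfolding g_def ennreal_of_nat_eq_real_of_nat
      by (subst ennreal_mult[symmetric]) (auto simp: ennreal_leI[of 1, simplified])
    then have "1 * Q w \<le> of_nat (rsize c m) * g w * Q w" by (rule mult_right_mono) simp
    then show ?thesis by (simp add: mult.assoc)
  qed simp
  show ?thesis
  proof (cases "EW Q < \<infinity>")
    case True
    have "of_nat T * EW (\<lambda>w. of_bool (card (VS w) > T) * Q w) \<le> EW (\<lambda>w. of_nat (opt V E w) * of_nat (card (VS w)))"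
      unfolding EW_cmult[symmetric]
    proof (rule EW_mono)
      fix w assume w: "w \<in> set_pmf W"
      show "of_nat T * (of_bool (card (VS w) > T) * Q w) \<le> of_nat (opt V E w) * of_nat (card (VS w))"
      proof (cases "card (VS w) > T")
        case True
        then have "of_nat T * Q w \<le> of_nat (card (VS w)) * of_nat (opt V E w)"
          by (intro mult_mono Q_le_opt w of_nat_mono) auto
        then show ?thesis using True by (simp add: mult.commute)
      qed simp
    qed
    also have "\<dots> \<le> ennreal N * (ennreal (C1 c) * EW Q)"
      by (rule order_trans[OF opt_times_card_le]) (intro mult_left_mono opt_le_Q zero_le)
    finally have "2 * (of_nat T * EW (\<lambda>w. of_bool (card (VS w) > T) * Q w)) \<le> 2 * (ennreal N * (ennreal (C1 c) * EW Q))"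
      by (rule mult_left_mono) simp
    also have "\<dots> = ennreal (2 * C1 c * N) * EW Q"
      using N C1_ge_1[of c] c by (simp add: ennreal_mult mult_ac)
    also have "\<dots> \<le> of_nat T * EW Q"
      unfolding ennreal_of_nat_eq_real_of_nat by (intro mult_right_mono ennreal_leI T) simp
    finally have "of_nat T * (2 * EW (\<lambda>w. of_bool (card (VS w) > T) * Q w)) \<le> of_nat T * EW Q"
      by (simp only: mult.left_commute)
    then have big: "2 * EW (\<lambda>w. of_bool (card (VS w) > T) * Q w) \<le> EW Q"
      using T(2) by (subst (asm) ennreal_mult_le_mult_iff) auto
    have "EW Q = EW (\<lambda>w. of_bool (card (VS w) \<le> T) * Q w + of_bool (card (VS w) > T) * Q w)"
      by (intro EW_cong) auto
    then have "2 * EW Q = 2 * EW (\<lambda>w. of_bool (card (VS w) \<le> T) * Q w) + 2 * EW (\<lambda>w. of_bool (card (VS w) > T) * Q w)"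
      by (simp only: EW_add distrib_left)
    also have "\<dots> \<le> 2 * EW (\<lambda>w. of_bool (card (VS w) \<le> T) * Q w) + EW Q"
      by (intro add_left_mono big)
    finally have "EW Q + EW Q \<le> EW Q + 2 * EW (\<lambda>w. of_bool (card (VS w) \<le> T) * Q w)"
      by (simp only: mult_2 add.commute)
    then have "EW Q \<le> 2 * EW (\<lambda>w. of_bool (card (VS w) \<le> T) * Q w)"
      using True by (subst (asm) ennreal_add_left_cancel_le) auto
    also have "\<dots> \<le> 2 * EW (\<lambda>w. of_nat (rsize c T) * (g w * Q w))"
    proof (intro mult_left_mono EW_mono)
      fix w
      show "of_bool (card (VS w) \<le> T) * Q w \<le> of_nat (rsize c T) * (g w * Q w)"
        using gQ[of w T] by (cases "card (VS w) \<le> T") simp_all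
    qed simp
    also have "\<dots> = ennreal (2 * real (rsize c T)) * EW (\<lambda>w. g w * Q w)"
      by (simp add: EW_cmult ennreal_mult ennreal_of_nat_eq_real_of_nat mult.assoc)
    finally show ?thesis .
  next
    \<comment> \<open>For infinite \<open>EW Q\<close> the cancellations above fail, but the crude
      bound \<open>card (VS w) <= card V\<close> shows that the right side is infinite too.\<close>
    case False
    have "EW Q \<le> EW (\<lambda>w. of_nat (rsize c (card V)) * (g w * Q w))"
      by (intro EW_mono gQ card_mono fin) simp
    then have "EW Q \<le> of_nat (rsize c (card V)) * EW (\<lambda>w. g w * Q w)" by (simp only: EW_cmult)
    then have "of_nat (rsize c (card V)) * EW (\<lambda>w. g w * Q w) = \<infinity>"
      using False by (simp add: top_unique less_top[symmetric])
    then have "EW (\<lambda>w. g w * Q w) = \<infinity>" by (simp add: ennreal_mult_eq_top_iff)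
    moreover have "ennreal (2 * real (rsize c T)) \<noteq> 0" using rsize_pos[OF c T(2)] by simp
    ultimately show ?thesis by (simp add: ennreal_mult_top)
  qed
qed

lemma opt_le_val:
  assumes T: "2 * C1 c * N \<le> real T" "1 \<le> T"
  shows "EW (\<lambda>w. of_nat (opt V E w)) \<le>
    ennreal (C1 c * (2 * real (rsize c T)) * (2 * real \<rho> * c) * (C2 + 1)) * EW val"
proof -
  have C: "0 \<le> C1 c" "0 \<le> C2 + 1" using C1_ge_1[of c] c by (auto simp: C2_def)
  have "EW (\<lambda>w. of_nat (opt V E w)) \<le> ennreal (C1 c) * (ennreal (2 * real (rsize c T)) * EW (\<lambda>w. g w * Q w))"
    by (rule order_trans[OF opt_le_Q]) (intro mult_left_mono Q_le_g T zero_le)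
  also have "EW (\<lambda>w. g w * Q w) = ennreal (2 * real \<rho> * c) * (ennreal q * EW (\<lambda>w. g w * Q w))"
  proof -
    have "ennreal (2 * real \<rho> * c) * ennreal q = ennreal (2 * real \<rho> * c * q)"
      using c q by (intro ennreal_mult[symmetric]) auto
    also have "2 * real \<rho> * c * q = 1" using c rho by (simp add: q_def)
    finally show ?thesis by (simp add: mult.assoc[symmetric])
  qed
  also have "ennreal (C1 c) * (ennreal (2 * real (rsize c T)) * (ennreal (2 * real \<rho> * c) * (ennreal q * EW (\<lambda>w. g w * Q w)))) \<le>
    ennreal (C1 c) * (ennreal (2 * real (rsize c T)) * (ennreal (2 * real \<rho> * c) * (ennreal (C2 + 1) * EW val)))"
    by (intro mult_left_mono Q_le_val zero_le)
  also have "\<dots> = ennreal (C1 c * (2 * real (rsize c T)) * (2 * real \<rho> * c) * (C2 + 1)) * EW val"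
    using C c by (simp only: ennreal_mult mult_nonneg_nonneg of_nat_0_le_iff zero_le_numeral
        order_trans[OF zero_le_one] mult.assoc)
  finally show ?thesis .
qed

end

section \<open>The weighted algorithm\<close>

definition split_pmf :: "(nat \<times> nat) pmf \<Rightarrow> (nat \<times> nat) pmf" where
  "split_pmf d = bind_pmf d (\<lambda>x. bind_pmf (bernoulli_pmf (1/2)) (\<lambda>h.
     return_pmf (if h then (0, snd x) else (fst x, 0))))"

definition coins_pmf :: "node set \<Rightarrow> (node \<Rightarrow> bool) pmf" where
  "coins_pmf V = Pi_pmf V False (\<lambda>_. bernoulli_pmf (1/2))"

lemma nn_integral_split_pmf:
  "(\<integral>\<^sup>+x. G x \<partial>split_pmf d) =
    ennreal (1/2) * (\<integral>\<^sup>+x. G (0, snd x) \<partial>d) + ennreal (1/2) * (\<integral>\<^sup>+x. G (fst x, 0) \<partial>d)"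
  by (simp add: split_pmf_def nn_integral_add nn_integral_cmult mult.commute[of _ "inverse 2"])

text \<open>The coin of a node acts on that node alone, so the split weights again have a product
  law. Outside \<open>V\<close> all weights are \<open>(0, 0)\<close>, which splitting leaves
  unchanged.\<close>

lemma nn_integral_split_weights:
  assumes fin: "finite V"
  shows "(\<integral>\<^sup>+w. \<integral>\<^sup>+f. F (split_weights f w) \<partial>coins_pmf V \<partial>weights_pmf V D) =
    (\<integral>\<^sup>+w. F w \<partial>Pi_pmf V (0, 0) (\<lambda>v. split_pmf (D v)))"
proof -
  let ?phi = "\<lambda>x h. if h then (0, snd x) else (fst x, 0 :: nat) :: nat \<times> nat"
  let ?s = "\<lambda>f w v. if v \<in> V then ?phi (w v) (f v) else (0, 0)"
  have "Pi_pmf V (0, 0) (\<lambda>v. split_pmf (D v)) =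
    bind_pmf (Pi_pmf V (0, 0) D) (\<lambda>w. bind_pmf (coins_pmf V) (\<lambda>f. return_pmf (?s f w)))"
    unfolding split_pmf_def coins_pmf_def
    by (simp add: Pi_pmf_bind[OF fin, where d' = "(0, 0)"] Pi_pmf_bind[OF fin, where d' = False]
        Pi_pmf_return_pmf[OF fin])
  then have "(\<integral>\<^sup>+w. F w \<partial>Pi_pmf V (0, 0) (\<lambda>v. split_pmf (D v))) =
    (\<integral>\<^sup>+w. \<integral>\<^sup>+f. F (?s f w) \<partial>coins_pmf V \<partial>weights_pmf V D)"
    by (simp add: weights_pmf_def)
  also have "\<dots> = (\<integral>\<^sup>+w. \<integral>\<^sup>+f. F (split_weights f w) \<partial>coins_pmf V \<partial>weights_pmf V D)"
  proof (rule nn_integral_cong_AE, rule AE_pmfI)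
    fix w assume w: "w \<in> set_pmf (weights_pmf V D)"
    have out: "w v = (0, 0)" if "v \<notin> V" for v
      using set_Pi_pmf_subset[OF fin, of "(0, 0)" D] w that by (auto simp: weights_pmf_def)
    have "?s f w = split_weights f w" for f
      using out by (auto simp: split_weights_def fun_eq_iff wS_def wI_def)
    then show "(\<integral>\<^sup>+f. F (?s f w) \<partial>coins_pmf V) = (\<integral>\<^sup>+f. F (split_weights f w) \<partial>coins_pmf V)" by simp
  qed
  finally show ?thesis by simp
qed

lemma expected_arrivals_eq:
  assumes "finite V"
  shows "ennreal (expected_arrivals V D) = (\<Sum>v\<in>V. \<integral>\<^sup>+x. of_bool (fst x > 0) \<partial>D v)"
proof -
  have bound: "norm (real (card (positive_nodes V (wI w)))) \<le> real (card V)" for w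
    using card_mono[OF assms positive_nodes_subset, of "wI w"] by simp
  have "ennreal (expected_arrivals V D) = (\<integral>\<^sup>+w. ennreal (real (card (positive_nodes V (wI w)))) \<partial>weights_pmf V D)"
    unfolding expected_arrivals_def
    by (rule nn_integral_eq_integral[symmetric])
       (auto intro!: measure_pmf.integrable_const_bound[where B = "real (card V)"] bound)
  also have "\<dots> = (\<integral>\<^sup>+w. (\<Sum>v\<in>V. of_bool (v \<in> positive_nodes V (wI w))) \<partial>weights_pmf V D)"
    unfolding ennreal_of_nat_eq_real_of_nat[symmetric] ennreal_of_nat_sum_bool[OF assms positive_nodes_subset]
    by (rule refl)
  also have "\<dots> = (\<Sum>v\<in>V. \<integral>\<^sup>+w. of_bool (v \<in> positive_nodes V (wI w)) \<partial>weights_pmf V D)"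
    by (rule nn_integral_sum) auto
  also have "\<dots> = (\<Sum>v\<in>V. \<integral>\<^sup>+x. of_bool (fst x > 0) \<partial>D v)"
  proof (rule sum.cong[OF refl])
    fix v assume v: "v \<in> V"
    show "(\<integral>\<^sup>+w. of_bool (v \<in> positive_nodes V (wI w)) \<partial>weights_pmf V D) = (\<integral>\<^sup>+x. of_bool (fst x > 0) \<partial>D v)"
      using nn_integral_Pi_pmf_indep[OF assms v, where F = "\<lambda>_. 1" and g = "\<lambda>x. of_bool (fst x > 0)" and d = "(0, 0)" and D = D] v
      by (simp add: weights_pmf_def positive_nodes_def wI_def)
  qed
  finally show ?thesis .
qed

lemma split_model_split_weights:
  assumes c: "c \<ge> 1" and rho: "\<rho> \<ge> 1" and inst: "sampling_instance c \<rho> V E ord D"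
    and tb: "enumerates tb V" and n: "expected_arrivals V D \<ge> 2"
  shows "split_model V E ord \<rho> c tb (Pi_pmf V (0, 0) (\<lambda>v. split_pmf (D v)))
    (\<lambda>u. \<integral>\<^sup>+x. of_bool (snd x > 0) \<partial>split_pmf (D u)) (c * expected_arrivals V D)"
proof -
  define W where "W = Pi_pmf V (0, 0) (\<lambda>v. split_pmf (D v))"
  define P where "P u = (\<integral>\<^sup>+x. of_bool (snd x > 0) \<partial>split_pmf (D u))" for u
  define a where "a u = (\<integral>\<^sup>+x. of_bool (fst x > 0) \<partial>D u)" for u
  have c0: "c \<ge> 0" using c by simp
  interpret ordered_graph V E ord \<rho>
    using inst rho by unfold_locales (auto simp: sampling_instance_def)
  have sim: "similar c (D v)" if "v \<in> V" for v using inst that by (simp add: sampling_instance_def)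
  have P: "P u = ennreal (1/2) * (\<integral>\<^sup>+x. of_bool (snd x > 0) \<partial>D u)" for u
    by (simp add: P_def nn_integral_split_pmf)
  have n_eq: "ennreal (expected_arrivals V D) = (\<Sum>v\<in>V. a v)"
    unfolding a_def by (rule expected_arrivals_eq[OF fin])
  have a_le: "a u \<le> ennreal (2 * c) * P u" if "u \<in> V" for u
  proof -
    have "a u \<le> ennreal c * (\<integral>\<^sup>+x. of_bool (snd x > 0) \<partial>D u)"
      using similar_fst_le[OF sim[OF that] c0, of "\<lambda>_. 1"] by (simp add: a_def)
    also have "ennreal c = ennreal (2 * c) * ennreal (1/2)"
      using c by (subst ennreal_mult[symmetric]) auto
    finally show ?thesis by (simp only: P mult.assoc)
  qed
  have P_le: "P u \<le> ennreal c * a u" if "u \<in> V" for u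
  proof -
    have "P u \<le> 1 * (\<integral>\<^sup>+x. of_bool (snd x > 0) \<partial>D u)"
    proof -
      have "ennreal (1/2) \<le> 1" using ennreal_leI[of "1/2" 1] by simp
      then show ?thesis unfolding P by (rule mult_right_mono) simp
    qed
    also have "\<dots> \<le> ennreal c * a u"
      using similar_snd_le[OF sim[OF that] c0, of "\<lambda>_. 1"] by (simp add: a_def)
    finally show ?thesis .
  qed
  have flip_upd: "flip v (f(v := x)) = f(v := prod.swap x)" for v f x by (simp add: flip_def)
  show ?thesis
    unfolding W_def[symmetric] P_def[symmetric]
  proof unfold_locales
    show "enumerates tb V" "c \<ge> 1" by fact+
    show "wI w v = 0 \<or> wS w v = 0" if "w \<in> set_pmf W" for w v
    proof (cases "v \<in> V")
      case True
      then have "w v \<in> set_pmf (split_pmf (D v))"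
        using that fin by (auto simp: W_def set_Pi_pmf PiE_dflt_def)
      then show ?thesis by (auto simp: split_pmf_def wI_def wS_def split: if_splits)
    next
      case False
      then show ?thesis
        using that fin by (auto simp: W_def set_Pi_pmf PiE_dflt_def wI_def)
    qed
  next
    fix v :: node and F :: "weights \<Rightarrow> ennreal" assume v: "v \<in> V"
    show "(\<integral>\<^sup>+w. of_bool (0 < wI w v) * F w \<partial>W) \<le> ennreal c * (\<integral>\<^sup>+w. of_bool (0 < wS w v) * F (flip v w) \<partial>W)"
      unfolding W_def nn_integral_Pi_pmf_coord[OF fin v] nn_integral_split_pmf flip_upd
    proof (subst nn_integral_cmult[symmetric], simp, intro nn_integral_mono)
      fix f
      \<comment> \<open>One branch of the coin vanishes on each side: to arrive means tails and
        weight \<open>fst x\<close>, to be sampled means heads and weight \<open>snd x\<close>. The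
        swap gives both the same form, and the probabilities 1/2 agree.\<close>
      have "(\<integral>\<^sup>+x. of_bool (fst x > 0) * F (f(v := (fst x, 0))) \<partial>D v)
        \<le> ennreal c * (\<integral>\<^sup>+x. of_bool (snd x > 0) * F (f(v := (snd x, 0))) \<partial>D v)"
        by (rule similar_fst_le[OF sim[OF v] c0, of "\<lambda>b. F (f(v := (b, 0)))"])
      then show "ennreal (1/2) * (\<integral>\<^sup>+x. of_bool (0 < wI (f(v := (0, snd x))) v) * F (f(v := (0, snd x))) \<partial>D v)
          + ennreal (1/2) * (\<integral>\<^sup>+x. of_bool (0 < wI (f(v := (fst x, 0))) v) * F (f(v := (fst x, 0))) \<partial>D v)
        \<le> ennreal c * (ennreal (1/2) * (\<integral>\<^sup>+x. of_bool (0 < wS (f(v := (0, snd x))) v) * F (f(v := prod.swap (0, snd x))) \<partial>D v)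
          + ennreal (1/2) * (\<integral>\<^sup>+x. of_bool (0 < wS (f(v := (fst x, 0))) v) * F (f(v := prod.swap (fst x, 0))) \<partial>D v))"
        by (simp add: wI_def wS_def mult.left_commute[of "ennreal c"] mult_left_mono)
    qed
    show "(\<integral>\<^sup>+w. of_bool (0 < wS w v) * F w \<partial>W) \<le> ennreal c * (\<integral>\<^sup>+w. of_bool (0 < wI w v) * F (flip v w) \<partial>W)"
      unfolding W_def nn_integral_Pi_pmf_coord[OF fin v] nn_integral_split_pmf flip_upd
    proof (subst nn_integral_cmult[symmetric], simp, intro nn_integral_mono)
      fix f
      have "(\<integral>\<^sup>+x. of_bool (snd x > 0) * F (f(v := (0, snd x))) \<partial>D v)
        \<le> ennreal c * (\<integral>\<^sup>+x. of_bool (fst x > 0) * F (f(v := (0, fst x))) \<partial>D v)"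
        by (rule similar_snd_le[OF sim[OF v] c0, of "\<lambda>b. F (f(v := (0, b)))"])
      then show "ennreal (1/2) * (\<integral>\<^sup>+x. of_bool (0 < wS (f(v := (0, snd x))) v) * F (f(v := (0, snd x))) \<partial>D v)
          + ennreal (1/2) * (\<integral>\<^sup>+x. of_bool (0 < wS (f(v := (fst x, 0))) v) * F (f(v := (fst x, 0))) \<partial>D v)
        \<le> ennreal c * (ennreal (1/2) * (\<integral>\<^sup>+x. of_bool (0 < wI (f(v := (0, snd x))) v) * F (f(v := prod.swap (0, snd x))) \<partial>D v)
          + ennreal (1/2) * (\<integral>\<^sup>+x. of_bool (0 < wI (f(v := (fst x, 0))) v) * F (f(v := prod.swap (fst x, 0))) \<partial>D v))"
        by (simp add: wI_def wS_def mult.left_commute[of "ennreal c"] mult_left_mono)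
    qed
  next
    fix u :: node and F :: "weights \<Rightarrow> ennreal" assume u: "u \<in> V" and F: "\<And>w x. F (w(u := x)) = F w"
    show "(\<integral>\<^sup>+w. of_bool (0 < wS w u) * F w \<partial>W) = P u * (\<integral>\<^sup>+w. F w \<partial>W)"
      unfolding W_def P_def wS_def
      by (rule nn_integral_Pi_pmf_indep[where g = "\<lambda>x. of_bool (snd x > 0)", OF fin u F])
  next
    fix v assume v: "v \<in> V"
    \<comment> \<open>Here \<open>n >= 2\<close> enters: \<open>v\<close> accounts for at most one
      expected arrival, so the other nodes account for at least one, and each arrival probability is
      at most \<open>2 * c\<close> times the probability of being sampled after the coin.\<close>
    have "2 \<le> ennreal (expected_arrivals V D)" using n ennreal_leI[of 2] by simp
    also have "\<dots> = a v + (\<Sum>u\<in>V - {v}. a u)" unfolding n_eq by (rule sum.remove[OF fin v])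
    also have "a v \<le> 1"
    proof -
      have "a v \<le> (\<integral>\<^sup>+x. 1 \<partial>D v)" unfolding a_def by (intro nn_integral_mono) auto
      then show ?thesis by simp
    qed
    also have "(\<Sum>u\<in>V - {v}. a u) \<le> (\<Sum>u\<in>V - {v}. ennreal (2 * c) * P u)"
      by (intro sum_mono a_le) auto
    also have "\<dots> = ennreal (2 * c) * (\<Sum>u\<in>V - {v}. P u)" by (rule sum_distrib_left[symmetric])
    finally have "1 + 1 \<le> 1 + ennreal (2 * c) * (\<Sum>u\<in>V - {v}. P u)"
      by (simp add: add_mono one_add_one)
    then have "1 \<le> ennreal (2 * c) * (\<Sum>u\<in>V - {v}. P u)"
      by (simp only: ennreal_add_left_cancel_le) simp
    then have "ennreal (1 / (2 * c)) * 1 \<le> ennreal (1 / (2 * c)) * (ennreal (2 * c) * (\<Sum>u\<in>V - {v}. P u))"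
      by (rule mult_left_mono) simp
    also have "\<dots> = ennreal (1 / (2 * c) * (2 * c)) * (\<Sum>u\<in>V - {v}. P u)"
      using c by (subst ennreal_mult) (auto simp: mult.assoc)
    also have "1 / (2 * c) * (2 * c) = 1" using c by simp
    finally show "ennreal (1 / (2 * c)) \<le> (\<Sum>u\<in>V - {v}. P u)" by simp
  next
    have "(\<Sum>u\<in>V. P u) \<le> (\<Sum>u\<in>V. ennreal c * a u)" by (intro sum_mono P_le)
    also have "\<dots> = ennreal c * ennreal (expected_arrivals V D)" by (simp only: n_eq sum_distrib_left)
    also have "\<dots> = ennreal (c * expected_arrivals V D)" using c n by (intro ennreal_mult[symmetric]) auto
    finally show "(\<Sum>u\<in>V. P u) \<le> ennreal (c * expected_arrivals V D)" .
  next
    show "0 \<le> c * expected_arrivals V D" using c n by simp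
  qed
qed

text \<open>Each node of a fixed optimal set keeps its online weight with probability 1/2.\<close>

lemma opt_le_split:
  assumes "finite V"
  shows "(of_nat (opt V E w) :: ennreal) \<le> 2 * (\<integral>\<^sup>+f. of_nat (opt V E (split_weights f w)) \<partial>coins_pmf V)"
proof -
  obtain T where T: "T \<subseteq> V" "independent_set E T" "opt V E w = (\<Sum>v\<in>T. wI w v)"
    using opt_attained[OF assms] .
  have half: "(\<integral>\<^sup>+f. of_bool (\<not> f v) \<partial>coins_pmf V) = ennreal (1/2)" if "v \<in> V" for v
    using nn_integral_Pi_pmf_indep[OF assms that, where F = "\<lambda>_. 1" and g = "\<lambda>b. of_bool (\<not> b)" and d = False
        and D = "\<lambda>_. bernoulli_pmf (1/2)"]
    by (simp add: coins_pmf_def)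
  have "ennreal (1/2) * of_nat (opt V E w) = (\<Sum>v\<in>T. of_nat (wI w v) * ennreal (1/2))"
    by (simp add: T(3) sum_distrib_left mult.commute)
  also have "\<dots> = (\<Sum>v\<in>T. of_nat (wI w v) * (\<integral>\<^sup>+f. of_bool (\<not> f v) \<partial>coins_pmf V))"
    using T(1) half by (intro sum.cong refl) auto
  also have "\<dots> = (\<integral>\<^sup>+f. (\<Sum>v\<in>T. of_nat (wI w v) * of_bool (\<not> f v)) \<partial>coins_pmf V)"
    by (subst nn_integral_sum) (simp_all add: nn_integral_cmult)
  also have "\<dots> \<le> (\<integral>\<^sup>+f. of_nat (opt V E (split_weights f w)) \<partial>coins_pmf V)"
  proof (rule nn_integral_mono)
    fix f :: "node \<Rightarrow> bool"
    have "(\<Sum>v\<in>T. of_nat (wI w v) * of_bool (\<not> f v) :: ennreal) = of_nat (\<Sum>v\<in>T. wI (split_weights f w) v)"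
      unfolding of_nat_sum by (intro sum.cong refl) (simp add: wI_def split_weights_def)
    also have "\<dots> \<le> of_nat (opt V E (split_weights f w))"
      by (intro of_nat_mono opt_ge assms T)
    finally show "(\<Sum>v\<in>T. of_nat (wI w v) * of_bool (\<not> f v) :: ennreal) \<le> of_nat (opt V E (split_weights f w))" .
  qed
  finally have "2 * (ennreal (1/2) * of_nat (opt V E w)) \<le>
    2 * (\<integral>\<^sup>+f. of_nat (opt V E (split_weights f w)) \<partial>coins_pmf V)"
    by (rule mult_left_mono) simp
  moreover have "2 * ennreal (1/2) = 1"
    using ennreal_mult[of 2 "1/2"] by simp
  ultimately show ?thesis by (simp add: mult.assoc[symmetric])
qed

section \<open>From payoffs to the competitive ratio\<close>

context split_model
begin

text \<open>Filtering the original arrivals by the modified weights leaves exactly the online set of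
  \<open>gain\<close>, and on that set the original and modified online weights agree. The factor
  \<open>g\<close> becomes the uniform law of \<open>X\<close>.\<close>

lemma val_le_alg:
  assumes arr: "\<And>X t. enumerates (xs X t) (positive_nodes V (wI w))"
  shows "val (split_weights f w) \<le> (\<integral>\<^sup>+X. \<integral>\<^sup>+t. of_nat (\<Sum>v\<in>weighted_alg V E ord tb w f X t (xs X t). wI w v)
    \<partial>thinning_pmf V \<rho> c \<partial>pmf_of_set (X_range c (positive_nodes V (wS (split_weights f w)))))"
proof (cases "VS (split_weights f w) = {}")
  case False
  define w' where "w' = split_weights f w"
  let ?A = "X_range c (VS w')"
  let ?alg = "\<lambda>X. \<integral>\<^sup>+t. of_nat (\<Sum>v\<in>weighted_alg V E ord tb w f X t (xs X t). wI w v) \<partial>thinning_pmf V \<rho> c"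
  have A: "finite ?A" "?A \<noteq> {}" using minus_1_in_rng[of w'] False by (auto simp: w'_def)
  have gain: "gain w' X \<le> ?alg X" for X
  proof -
    define p where "p = 2 powr (- real_of_int X) * real (wS w' (vm w'))"
    define S where "S = {v \<in> VS w' - {vm w'}. p \<le> real (wS w' v)}"
    define I where "I = {v \<in> VI w'. p \<le> real (wI w' v)}"
    have IV: "I \<subseteq> V" using sub(1)[of w'] by (auto simp: I_def simp del: sub)
    have I_eq: "wI w v = wI w' v" if "v \<in> I" for v
      using that by (auto simp: I_def w'_def VI_def positive_nodes_def wI_def split_weights_def split: if_splits)
    have pos: "v \<in> positive_nodes V (wI w)" if "v \<in> I" for v
      using that I_eq[OF that] by (simp add: I_def VI_def positive_nodes_def)
    let ?xs = "\<lambda>t. filter (\<lambda>v. v \<in> VI w' \<and> p \<le> real (wI w' v)) (xs X t)"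
    have set: "set (?xs t) = I" for t
      using arr[of X t] pos by (auto simp: enumerates_def I_def)
    have alg: "weighted_alg V E ord tb w f X t (xs X t) = A1 E ord S t (?xs t)" for t
      using False unfolding weighted_alg_def Let_def S_def p_def w'_def VS_def VI_def vm_def by simp
    have "gain w' X = (\<Sum>v\<in>M2 E ord S I. of_nat (wI w' v) * ennreal (q * (1 - q) ^ card (nbrs E (M2 E ord S I) v)))"
      by (simp add: gain_def Let_def p_def S_def I_def)
    also have "\<dots> = (\<Sum>v\<in>M2 E ord S I. of_nat (wI w v) * ennreal (q * (1 - q) ^ card (nbrs E (M2 E ord S I) v)))"
      using I_eq by (intro sum.cong refl) (auto simp: M2_def)
    also have "\<dots> \<le> ?alg X"
      unfolding alg thinning_pmf_def q_def[symmetric]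
      by (rule A1_expectation_ge[OF IV set q(3,4)])
    finally show ?thesis .
  qed
  have "val w' = g w' * (\<Sum>X\<in>?A. gain w' X)" using False by (simp add: val_def w'_def)
  also have "\<dots> \<le> g w' * (\<Sum>X\<in>?A. ?alg X)" by (intro mult_left_mono sum_mono gain) simp
  also have "\<dots> = (\<Sum>X\<in>?A. ?alg X) / of_nat (card ?A)"
  proof -
    have "0 < card ?A" using A by (simp add: card_gt_0_iff)
    then have "g w' = inverse (of_nat (card ?A))"
      by (simp add: g_def card_X_range[symmetric] ennreal_of_nat_eq_real_of_nat inverse_ennreal inverse_eq_divide)
    then show ?thesis by (simp add: divide_ennreal_def mult.commute)
  qed
  also have "\<dots> = (\<integral>\<^sup>+X. ?alg X \<partial>pmf_of_set ?A)"
    by (rule nn_integral_pmf_of_set[OF A(2,1), symmetric])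
  finally show ?thesis by (simp add: w'_def VS_def)
qed (simp add: val_def)

end


lemma weighted_alg_expectation_le:
  assumes c: "c \<ge> 1" and rho: "\<rho> \<ge> 1" and inst: "sampling_instance c \<rho> V E ord D"
    and tb: "enumerates tb V" and adv: "adversary V fst arr" and n: "expected_arrivals V D \<ge> 2"
    and T: "2 * C1 c * (c * expected_arrivals V D) \<le> real T" "1 \<le> T"
  shows "(\<integral>\<^sup>+\<omega>. of_nat ((\<lambda>(w, f, X, t). opt V E w) \<omega>) \<partial>outcome_pmf c \<rho> V D) \<le>
    ennreal (2 * (C1 c * (2 * real (rsize c T)) * (2 * real \<rho> * c) * (2 * (1 + real \<rho> * c) * exp 4 + 1))) *
    (\<integral>\<^sup>+\<omega>. of_nat ((\<lambda>(w, f, X, t). \<Sum>v\<in>weighted_alg V E ord tb w f X t (arr (w, f, X, t)). wI w v) \<omega>)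
      \<partial>outcome_pmf c \<rho> V D)"
proof -
  interpret split_model V E ord \<rho> c tb "Pi_pmf V (0, 0) (\<lambda>v. split_pmf (D v))"
    "\<lambda>u. \<integral>\<^sup>+x. of_bool (snd x > 0) \<partial>split_pmf (D u)" "c * expected_arrivals V D"
    by (rule split_model_split_weights[OF c rho inst tb n])
  define K where "K = C1 c * (2 * real (rsize c T)) * (2 * real \<rho> * c) * (C2 + 1)"
  have "(\<integral>\<^sup>+\<omega>. of_nat ((\<lambda>(w, f, X, t). opt V E w) \<omega>) \<partial>outcome_pmf c \<rho> V D) =
    (\<integral>\<^sup>+w. of_nat (opt V E w) \<partial>weights_pmf V D)"
    by (simp add: outcome_pmf_def)
  also have "\<dots> \<le> (\<integral>\<^sup>+w. 2 * (\<integral>\<^sup>+f. of_nat (opt V E (split_weights f w)) \<partial>coins_pmf V) \<partial>weights_pmf V D)"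
    by (intro nn_integral_mono opt_le_split fin)
  also have "\<dots> = 2 * EW (\<lambda>w. of_nat (opt V E w))"
    by (subst nn_integral_cmult)
      (simp_all add: nn_integral_split_weights[OF fin, where F = "\<lambda>w. of_nat (opt V E w)"])
  also have "\<dots> \<le> 2 * (ennreal K * EW val)"
    unfolding K_def by (intro mult_left_mono opt_le_val T) simp
  also have "EW val = (\<integral>\<^sup>+w. \<integral>\<^sup>+f. val (split_weights f w) \<partial>coins_pmf V \<partial>weights_pmf V D)"
    by (rule nn_integral_split_weights[OF fin, symmetric])
  also have "2 * (ennreal K * \<dots>) \<le> 2 * (ennreal K * (\<integral>\<^sup>+w. \<integral>\<^sup>+f. \<integral>\<^sup>+X. \<integral>\<^sup>+t.
      of_nat (\<Sum>v\<in>weighted_alg V E ord tb w f X t (arr (w, f, X, t)). wI w v)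
    \<partial>thinning_pmf V \<rho> c \<partial>pmf_of_set (X_range c (positive_nodes V (wS (split_weights f w))))
    \<partial>coins_pmf V \<partial>weights_pmf V D))"
    using adv by (intro mult_left_mono nn_integral_mono val_le_alg) (auto simp: adversary_def)
  also have "\<dots> = ennreal (2 * K) * (\<integral>\<^sup>+\<omega>. of_nat ((\<lambda>(w, f, X, t).
      \<Sum>v\<in>weighted_alg V E ord tb w f X t (arr (w, f, X, t)). wI w v) \<omega>) \<partial>outcome_pmf c \<rho> V D)"
  proof -
    have "0 \<le> K" using c C1_ge_1[of c] by (simp add: K_def C2_def)
    then have "2 * ennreal K = ennreal (2 * K)" by (simp add: ennreal_mult)
    then show ?thesis by (simp add: outcome_pmf_def coins_pmf_def mult.assoc[symmetric])
  qed
  finally show ?thesis by (simp only: K_def C2_def)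
qed

text \<open>Chosen so that \<open>(c + 2) * T <= A0 c * n\<close> for the bound \<open>T\<close> on
  the sample size that enters \<open>Q_le_g\<close>.\<close>

definition A0 :: "real \<Rightarrow> real" where "A0 c = (c + 2) * (3 * C1 c * c)"

lemma rsize_le_log:
  assumes c: "c \<ge> 1" and n: "n \<ge> 2"
  shows "real (rsize c (nat \<lceil>2 * C1 c * (c * n)\<rceil>)) \<le> (log 2 (A0 c) + 4) * log 2 n"
    and "1 \<le> nat \<lceil>2 * C1 c * (c * n)\<rceil>" "0 \<le> log 2 (A0 c)"
proof -
  have C1: "1 \<le> C1 c" using c C1_ge_1 by simp
  have "1 * (1 * 1) \<le> C1 c * (c * n)" using C1 c n by (intro mult_mono) auto
  then have y: "1 \<le> C1 c * (c * n)" by simp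
  define T where "T = nat \<lceil>2 * C1 c * (c * n)\<rceil>"
  have "1 \<le> \<lceil>2 * C1 c * (c * n)\<rceil>" using y by linarith
  then have T1: "1 \<le> T" and T_eq: "real T = real_of_int \<lceil>2 * C1 c * (c * n)\<rceil>" unfolding T_def by linarith+
  then show "1 \<le> nat \<lceil>2 * C1 c * (c * n)\<rceil>" unfolding T_def by simp
  \<comment> \<open>With \<open>y = C1 c * (c * n) >= 1\<close> the ceiling of \<open>2 * y\<close>
    is at most \<open>2 * y + 1 <= 3 * y\<close>.\<close>
  have T3: "real T \<le> 3 * (C1 c * (c * n))" unfolding T_eq using y by linarith
  have "1 * (1 * 1 * 1) \<le> (c + 2) * (3 * C1 c * c)" using C1 c by (intro mult_mono) auto
  then have A: "1 \<le> A0 c" by (simp add: A0_def)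
  then show A0: "0 \<le> log 2 (A0 c)" by simp
  have "(c + 2) * real T \<le> (c + 2) * (3 * (C1 c * (c * n)))" using c by (intro mult_left_mono T3) simp
  also have "\<dots> = A0 c * n" by (simp add: A0_def)
  finally have "log 2 ((c + 2) * real T) \<le> log 2 (A0 c * n)"
    using c T1 by (intro log_mono) auto
  also have "\<dots> = log 2 (A0 c) + log 2 n" using A n by (subst log_mult) auto
  finally have "real (rsize c T) \<le> log 2 (A0 c) + log 2 n + 3"
    using rsize_eq[OF c T1] by linarith
  \<comment> \<open>\<open>n >= 2\<close> gives \<open>log 2 n >= 1\<close>, which absorbs the
    additive constants.\<close>
  moreover have ln: "1 \<le> log 2 n" using n by (subst le_log_iff) auto
  moreover have "log 2 (A0 c) * 1 \<le> log 2 (A0 c) * log 2 n" by (intro mult_left_mono ln A0)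
  ultimately show "real (rsize c (nat \<lceil>2 * C1 c * (c * n)\<rceil>)) \<le> (log 2 (A0 c) + 4) * log 2 n"
    unfolding T_def by (simp add: distrib_right)
qed

lemma weighted_ratio_le:
  assumes c: "c \<ge> 1" and rho: "\<rho> \<ge> 1" and inst: "sampling_instance c \<rho> V E ord D"
    and tb: "enumerates tb V" and adv: "adversary V fst arr" and n: "expected_arrivals V D \<ge> 2"
  shows "weighted_ratio_on c \<rho> V E ord tb D arr \<le>
    ennreal (40 * exp 4 * c\<^sup>2 * C1 c * (log 2 (A0 c) + 4) * real \<rho> ^ 2 * log 2 (expected_arrivals V D))"
proof -
  define T where "T = nat \<lceil>2 * C1 c * (c * expected_arrivals V D)\<rceil>"
  note R = rsize_le_log[OF c n, folded T_def]
  have T: "2 * C1 c * (c * expected_arrivals V D) \<le> real T" unfolding T_def by linarith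
  define L where "L = (log 2 (A0 c) + 4) * log 2 (expected_arrivals V D)"
  have C1: "1 \<le> C1 c" using c C1_ge_1 by simp
  have "1 * 1 \<le> real \<rho> * c" using c rho by (intro mult_mono) auto
  then have "1 * exp 4 \<le> (real \<rho> * c) * exp 4" by (intro mult_right_mono) auto
  moreover have "1 \<le> exp (4::real)" by simp
  moreover have "2 * (1 + real \<rho> * c) * exp 4 = 2 * exp 4 + 2 * ((real \<rho> * c) * exp 4)"
    by (simp add: algebra_simps)
  ultimately have e: "2 * (1 + real \<rho> * c) * exp 4 + 1 \<le> 5 * (real \<rho> * c * exp 4)" by linarith
  have L: "real (rsize c T) \<le> L" using R(1) by (simp only: L_def)
  then have L0: "0 \<le> L" by (rule order_trans[rotated]) simp
  have "C1 c * (2 * real (rsize c T)) * (2 * real \<rho> * c) \<le> C1 c * (2 * L) * (2 * real \<rho> * c)"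
    using C1 c L by (intro mult_right_mono mult_left_mono) auto
  then have "C1 c * (2 * real (rsize c T)) * (2 * real \<rho> * c) * (2 * (1 + real \<rho> * c) * exp 4 + 1) \<le>
    C1 c * (2 * L) * (2 * real \<rho> * c) * (5 * (real \<rho> * c * exp 4))"
    by (rule mult_mono[OF _ e]) (use C1 c L0 in auto)
  then have "2 * (C1 c * (2 * real (rsize c T)) * (2 * real \<rho> * c) * (2 * (1 + real \<rho> * c) * exp 4 + 1)) \<le>
    2 * (C1 c * (2 * L) * (2 * real \<rho> * c) * (5 * (real \<rho> * c * exp 4)))"
    by (rule mult_left_mono) simp
  \<comment> \<open>40 is the product of 2 for the coins, 2 for Markov's inequality, 2 from
    \<open>1 / q\<close> and 5 from \<open>e\<close>.\<close>
  also have "\<dots> = 40 * exp 4 * c\<^sup>2 * C1 c * (log 2 (A0 c) + 4) * real \<rho> ^ 2 * log 2 (expected_arrivals V D)"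
    by (simp add: L_def power2_eq_square)
  finally have le: "ennreal (2 * (C1 c * (2 * real (rsize c T)) * (2 * real \<rho> * c) * (2 * (1 + real \<rho> * c) * exp 4 + 1))) \<le>
    ennreal (40 * exp 4 * c\<^sup>2 * C1 c * (log 2 (A0 c) + 4) * real \<rho> ^ 2 * log 2 (expected_arrivals V D))"
    by (rule ennreal_leI)
  show ?thesis
    unfolding weighted_ratio_on_def
    by (rule competitive_ratio_le,
        rule order_trans[OF weighted_alg_expectation_le[OF c rho inst tb adv n T R(2)]])
       (intro mult_right_mono le zero_le)
qed

theorem theorem6:
  fixes c :: real
  assumes "c \<ge> 1"
  shows "(\<exists>K::real. \<forall>\<rho>\<ge>1. A1_ratio c \<rho> \<le> ennreal (K * real \<rho> ^ 2)) \<and>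
    (\<exists>K::real. \<forall>\<rho>\<ge>1. \<forall>V E ord tb D arr.
       sampling_instance c \<rho> V E ord D \<and> enumerates tb V \<and> adversary V fst arr \<and>
       expected_arrivals V D \<ge> 2 \<longrightarrow>
       weighted_ratio_on c \<rho> V E ord tb D arr
         \<le> ennreal K * A1_ratio c \<rho> * ennreal (log 2 (expected_arrivals V D)))"
proof (intro conjI exI allI impI)
  show "A1_ratio c \<rho> \<le> ennreal (4 * exp 2 * c\<^sup>2 * real \<rho> ^ 2)" if "\<rho> \<ge> 1" for \<rho>
    using A1_ratio_le[OF assms that] .
next
  fix \<rho> V E ord tb D and arr :: "outcome \<Rightarrow> node list"
  assume rho: "\<rho> \<ge> (1::nat)"
    and "sampling_instance c \<rho> V E ord D \<and> enumerates tb V \<and> adversary V fst arr \<and> expected_arrivals V D \<ge> 2"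
  then have *: "sampling_instance c \<rho> V E ord D" "enumerates tb V" "adversary V fst arr"
    and n: "expected_arrivals V D \<ge> 2" by auto
  \<comment> \<open>The constant of \<open>weighted_ratio_le\<close> divided by
    \<open>2 * c\<close>: the factor \<open>2 * c * \<rho>^2\<close> that is split off is the lower
    bound in \<open>A1_ratio_ge\<close>.\<close>
  define K where "K = 20 * exp 4 * c * C1 c * (log 2 (A0 c) + 4)"
  define l where "l = log 2 (expected_arrivals V D)"
  have K: "0 \<le> K" and l: "0 \<le> l"
    using assms C1_ge_1[of c] rsize_le_log(3)[OF assms n] n by (auto simp: K_def l_def)
  have "weighted_ratio_on c \<rho> V E ord tb D arr \<le> ennreal (K * (2 * c * real \<rho> ^ 2) * l)"
    using weighted_ratio_le[OF assms rho * n] by (simp add: K_def l_def power2_eq_square mult_ac)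
  also have "\<dots> = ennreal K * ennreal (2 * c * real \<rho> ^ 2) * ennreal l"
    using K l assms by (simp only: ennreal_mult mult_nonneg_nonneg zero_le_power of_nat_0_le_iff
        zero_le_numeral order_trans[OF zero_le_one])
  also have "\<dots> \<le> ennreal K * A1_ratio c \<rho> * ennreal l"
    by (intro mult_right_mono mult_left_mono A1_ratio_ge assms rho zero_le)
  finally show "weighted_ratio_on c \<rho> V E ord tb D arr \<le>
    ennreal (20 * exp 4 * c * C1 c * (log 2 (A0 c) + 4)) * A1_ratio c \<rho> * ennreal (log 2 (expected_arrivals V D))"
    by (simp only: K_def l_def)
qed

end
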